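(* Let $(V,\omega)$ be a symplectic vector space of even dimension $n\ge2$, and consider the resolution $$0\to\Gamma(C_{n+1})\xrightarrow{\bar\partial_n}\cdots\xrightarrow{\bar\partial_3}\Gamma(C_3)\xrightarrow{\,d_2(\phi_2^\omega)^{-1}\partial_2\,}\Gamma(\mathfrak{sp}(V,\omega))\to\mathcal F_\omega(V)\to0$$ of the foliation generated by $\mathfrak{sp}(V,\omega)$, with $\Gamma(\mathfrak{sp}(V,\omega))$ in degree $0$ and $\Gamma(C_{p+1})$ in degree $1-p$ for $p\ge2$. Define a graded skew-symmetric binary operation $\llbracket-,-\rrbracket$ on it as follows. When at least one entry has degree $0$, $\llbracket-,-\rrbracket=\{-,-\}$, where $\{A,B\}=[A,B]$ and $\{A,\eta+\mathrm{im}\,\phi^\omega_{k+1}\}=[A,\eta]+\mathrm{im}\,\phi^\omega_{k+1}$ for $A,B\in\Gamma(\mathfrak{sp}(V,\omega))$, $\eta\in\Gamma(\wedge^kV^*\otimes\wedge^2V^* )$. For $p,q\ge2$ and (classes of) $\omega_p\in\Gamma(\wedge^pV^*\otimes\wedge^2V^* )$, $\omega_q\in\Gamma(\wedge^qV^*\otimes\wedge^2V^* )$, $$\llbracket\omega_p,\omega_q\rrbracket:=[r^\omega_{p-1}\partial_pP_p(\omega_p),P_q(\omega_q)]+[P_p(\omega_p),r^\omega_{q-1}\partial_qP_q(\omega_q)]\ \bmod\ \mathrm{im}(\phi^\omega_{p+q})\ \in\Gamma(\mathrm{coker}(\phi^\omega_{p+q})),$$ where $P_p=\mathrm{id}-\phi^\omega_{p+1}\circ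 r^\omega_p:\Gamma(\wedge^pV^*\otimes\wedge^2V^* )\to\Gamma(\ker(r_p^\omega))$. Then the differential of the resolution is a derivation of $\llbracket-,-\rrbracket$.
   Context: $\Gamma(U)=C^\infty(V,U)$; $\{e_i\},\{e^i\}$ dual bases of $V,V^*$, $x^i$ linear coordinates, repeated indices summed; linear maps are extended $C^\infty(V)$-linearly. $\mathfrak{sp}(V,\omega)=\{A\in\mathfrak{gl}(V)\mid\omega(Ax,y)+\omega(x,Ay)=0\}$; $\rho(\phi\otimes v)=\phi\,\partial_v$ on $\Gamma(V^*\otimes V)$; $\mathcal F_\omega(V)=\rho(\Gamma(\mathfrak{sp}(V,\omega)))$. $d_p(\alpha\otimes v)=x^i\iota_{e_i}\alpha\otimes v$ on $\Gamma(\wedge^pV^*\otimes V)$; $\partial_p(\alpha\otimes\tau)=-x^i\iota_{e_i}\alpha\otimes\tau$ on $\Gamma(\wedge^pV^*\otimes\wedge^2V^* )$. $\phi^\omega_p:\wedge^pV^*\otimes V\to\wedge^{p-1}V^*\otimes\wedge^2V^*$, $\phi^\omega_p(\alpha\otimes X)=(-1)^{p-1}\iota_{e_i}\alpha\otimes e^i\wedge\iota_X\omega$; $C_p=\mathrm{coker}(\phi_p^\omega)$ for $3\le p\le n+1$ (with $\phi^\omega_{n+1}=0$); $\bar\partial_p:\Gamma(C_{p+1})\to\Gamma(C_p)$ is induced by $\partial_p$; $\phi_2^\omega$ is an isomorphism. $r^\omega_p:\wedge^pV^*\otimes\wedge^2V^*\to\wedge^{p+1}V^*\otimes V$ ($p\ge1$)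 is $$r_p^\omega(\omega_p\otimes\tau)=\Big(\tfrac1{p+1}\omega_p\wedge\iota_{e_i}(\tau)-\tfrac{(-1)^p}{p(p+1)}\iota_{e_i}(\omega_p)\wedge\tau\Big)\otimes\omega^{-1}(e^i),$$ where $\omega^{-1}:V^*\to V$ is the inverse of $V\to V^*$, $v\mapsto\omega(\cdot,v)$; it is a left inverse of $\phi^\omega_{p+1}$. The brackets $[-,-]$: on $\Gamma(\wedge^\bullet V^*\otimes V)$, for $f_a\in C^\infty(V)$, $\psi_a\in\wedge^{k_a}V^*$, $w_a\in V$, $$[f_1\psi_1\otimes w_1,f_2\psi_2\otimes w_2]=f_1f_2\big(\psi_1\wedge\iota_{w_1}\psi_2\otimes w_2-(-1)^{(k_1-1)(k_2-1)}\psi_2\wedge\iota_{w_2}\psi_1\otimes w_1\big)+\delta_{k_1,1}f_1\rho(\psi_1\otimes w_1)(f_2)\psi_2\otimes w_2-\delta_{k_2,1}f_2\rho(\psi_2\otimes w_2)(f_1)\psi_1\otimes w_1.$$ For $\alpha\otimes X\in\wedge^pV^*\otimes V$ and $\beta\otimes\tau\in\wedge^qV^*\otimes\wedge^2V^*$ (constant sections) $$[\alpha\otimes X,\beta\otimes\tau]=(-1)^{p-1}\alpha\wedge\iota_X(\beta)\otimes\tau+\iota_{e_i}(\alpha)\wedge\beta\otimes e^i\wedge\iota_X(\tau),$$ extended to non-constant sections $C^\infty(V)$-linearly in the first entry and by the Leibniz rule in the second (with an anchor term $\rho(\alpha\otimes X)(f)$ only if $p=1$); and $[\beta\otimes\tau,\alpha\otimes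 X]=-(-1)^{(p-1)(q-1)}[\alpha\otimes X,\beta\otimes\tau]$. Elements of $\wedge^\bullet V^*\otimes\wedge^2V^*$ bracket to zero with each other. "The differential $D$ is a derivation" means $D\llbracket a,b\rrbracket=\llbracket Da,b\rrbracket+(-1)^{|a|}\llbracket a,Db\rrbracket$, where $D$ is zero on degree $0$. *)

theory Defs
  imports
    "HOL-Analysis.Analysis"
    "HOL-Library.Function_Algebras"
    "HOL-Library.Set_Algebras"
begin

text \<open>
  \<open>V\<close> is a Euclidean space type \<open>'a\<close>; its inner product serves only to write coordinates: the basis
  \<open>e_i\<close> is \<open>Basis\<close>, the coordinate \<open>x^i\<close> is \<open>x \<bullet> i\<close> and the dual basis vector \<open>e^i\<close> is \<open>\<lambda>v. i \<bullet> v\<close>.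

  Elements of \<open>\<Lambda>^p V* \<otimes> W\<close> are alternating multilinear maps with \<open>p\<close> arguments and values in \<open>W\<close>,
  presented as functions on lists that vanish on lists of any other length. With \<open>W = \<Lambda>^2 V*\<close> this
  gives functions of two lists. So \<open>\<alpha> \<otimes> v\<close> is \<open>\<lambda>us. \<alpha> us *\<^sub>R v\<close> and \<open>\<alpha> \<otimes> \<tau>\<close> is \<open>\<lambda>us vs. \<alpha> us * \<tau> vs\<close>.
  The operations below are written for arbitrary elements; the lemmas at the end evaluate them on
  decomposable ones, which span.
\<close>

type_synonym 'a form = "'a list \<Rightarrow> real"
type_synonym 'a vform = "'a list \<Rightarrow> 'a"
type_synonym 'a tform = "'a list \<Rightarrow> 'a list \<Rightarrow> real"

definition alt_forms :: "nat \<Rightarrow> ('a::real_vector list \<Rightarrow> 'b::real_vector) set" where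
  "alt_forms p = {\<alpha>.
     (\<forall>us. length us \<noteq> p \<longrightarrow> \<alpha> us = 0) \<and>
     (\<forall>us i. length us = p \<longrightarrow> i < p \<longrightarrow> linear (\<lambda>v. \<alpha> (us[i := v]))) \<and>
     (\<forall>us. length us = p \<longrightarrow> \<not> distinct us \<longrightarrow> \<alpha> us = 0)}"

definition alt_tforms :: "nat \<Rightarrow> 'a::real_vector tform set" where
  "alt_tforms p = {T. (\<forall>vs. (\<lambda>us. T us vs) \<in> alt_forms p) \<and> (\<forall>us. T us \<in> alt_forms 2)}"

definition iota :: "'a \<Rightarrow> ('a list \<Rightarrow> 'b) \<Rightarrow> 'a list \<Rightarrow> 'b" where
  "iota v \<alpha> = (\<lambda>us. \<alpha> (v # us))"

definition one_form :: "('a \<Rightarrow> real) \<Rightarrow> 'a form" where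
  "one_form f = (\<lambda>us. case us of [v] \<Rightarrow> f v | _ \<Rightarrow> 0)"

text \<open>
  The wedge product is the sum over shuffles, without factorials. A shuffle is given by the set \<open>I\<close>
  of positions of the arguments that go to the first factor, and its sign by the number of
  inversions. \<open>wedge_contract\<close> is the induced linear map \<open>\<alpha> \<otimes> \<beta> \<mapsto> \<alpha> \<and> \<beta>\<close>.
\<close>

definition shuffle_sign :: "nat \<Rightarrow> nat set \<Rightarrow> real" where
  "shuffle_sign n I = (-1) ^ card {(i, j). i \<in> I \<and> j \<in> {..<n} - I \<and> j < i}"

definition wedge_contract :: "'a tform \<Rightarrow> 'a form" where
  "wedge_contract T us =
     (\<Sum>I\<in>Pow {..<length us}. shuffle_sign (length us) I * T (nths us I) (nths us (- I)))"

definition wedge :: "'a form \<Rightarrow> 'a form \<Rightarrow> 'a form" where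
  "wedge \<alpha> \<beta> = wedge_contract (\<lambda>us vs. \<alpha> us * \<beta> vs)"

definition symplectic :: "('a::euclidean_space \<Rightarrow> 'a \<Rightarrow> real) \<Rightarrow> bool" where
  "symplectic \<omega> \<longleftrightarrow> bilinear \<omega> \<and> (\<forall>v. \<omega> v v = 0) \<and> (\<forall>u. (\<forall>v. \<omega> u v = 0) \<longrightarrow> u = 0)"

definition omega_inv :: "('a \<Rightarrow> 'a \<Rightarrow> real) \<Rightarrow> ('a \<Rightarrow> real) \<Rightarrow> 'a" where
  "omega_inv \<omega> \<xi> = (THE v. \<forall>u. \<omega> u v = \<xi> u)"

definition phi :: "('a::euclidean_space \<Rightarrow> 'a \<Rightarrow> real) \<Rightarrow> nat \<Rightarrow> 'a vform \<Rightarrow> 'a tform" where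
  "phi \<omega> p A = (\<lambda>us vs. (-1) ^ (p - 1) *
     (\<Sum>i\<in>Basis. wedge (one_form (\<lambda>v. i \<bullet> v)) (one_form (\<omega> (iota i A us))) vs))"

definition r_inv :: "('a::euclidean_space \<Rightarrow> 'a \<Rightarrow> real) \<Rightarrow> nat \<Rightarrow> 'a tform \<Rightarrow> 'a vform" where
  "r_inv \<omega> p T = (\<lambda>us. \<Sum>i\<in>Basis.
     (1 / (real p + 1) * wedge_contract (\<lambda>vs. iota i (T vs)) us
      - (-1) ^ p / (real p * (real p + 1)) * wedge_contract (iota i T) us)
     *\<^sub>R omega_inv \<omega> (\<lambda>v. i \<bullet> v))"


text \<open>
  Sections over \<open>V\<close>. A section is smooth iff all its evaluations on arguments are.
\<close>

type_synonym 'a vsection = "'a \<Rightarrow> 'a vform"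
type_synonym 'a tsection = "'a \<Rightarrow> 'a tform"

primrec C_k :: "nat \<Rightarrow> ('a::euclidean_space \<Rightarrow> 'b::real_normed_vector) \<Rightarrow> bool" where
  "C_k 0 f \<longleftrightarrow> continuous_on UNIV f"
| "C_k (Suc k) f \<longleftrightarrow>
     f differentiable_on UNIV \<and> (\<forall>v. C_k k (\<lambda>x. frechet_derivative f (at x) v))"

definition smooth :: "('a::euclidean_space \<Rightarrow> 'b::real_normed_vector) \<Rightarrow> bool" where
  "smooth f \<longleftrightarrow> (\<forall>k. C_k k f)"

definition Gamma_V :: "nat \<Rightarrow> 'a::euclidean_space vsection set" where
  "Gamma_V p = {A. (\<forall>x. A x \<in> alt_forms p) \<and> (\<forall>us. smooth (\<lambda>x. A x us))}"

definition Gamma_T :: "nat \<Rightarrow> 'a::euclidean_space tsection set" where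
  "Gamma_T p = {T. (\<forall>x. T x \<in> alt_tforms p) \<and> (\<forall>us vs. smooth (\<lambda>x. T x us vs))}"

text \<open>An endomorphism \<open>A\<close> is an element of \<open>V* \<otimes> V\<close>, its value at \<open>v\<close> being \<open>A [v]\<close>.\<close>

definition sp :: "('a::euclidean_space \<Rightarrow> 'a \<Rightarrow> real) \<Rightarrow> 'a vform set" where
  "sp \<omega> = {A \<in> alt_forms 1. \<forall>u v. \<omega> (A [u]) v + \<omega> u (A [v]) = 0}"

definition Gamma_sp :: "('a::euclidean_space \<Rightarrow> 'a \<Rightarrow> real) \<Rightarrow> 'a vsection set" where
  "Gamma_sp \<omega> = {A \<in> Gamma_V 1. \<forall>x. A x \<in> sp \<omega>}"

text \<open>At \<open>x\<close> the vector field \<open>\<rho>(\<phi> \<otimes> v) = \<phi> \<partial>_v\<close> has the value \<open>\<phi>(x) v\<close>, so \<open>\<rho>(A)\<close> has the value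
  \<open>A x [x]\<close>.\<close>

definition rho :: "'a::euclidean_space vsection \<Rightarrow> ('a \<Rightarrow> 'b::real_normed_vector) \<Rightarrow> 'a \<Rightarrow> 'b" where
  "rho A f x = frechet_derivative f (at x) (A x [x])"

definition d_op :: "'a::euclidean_space vsection \<Rightarrow> 'a vsection" where
  "d_op A = (\<lambda>x us. \<Sum>i\<in>Basis. (x \<bullet> i) *\<^sub>R iota i (A x) us)"

definition del :: "'a::euclidean_space tsection \<Rightarrow> 'a tsection" where
  "del T = (\<lambda>x us vs. - (\<Sum>i\<in>Basis. (x \<bullet> i) * iota i (T x) us vs))"

definition phi_sec :: "('a::euclidean_space \<Rightarrow> 'a \<Rightarrow> real) \<Rightarrow> nat \<Rightarrow> 'a vsection \<Rightarrow> 'a tsection" where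
  "phi_sec \<omega> p A = (\<lambda>x. phi \<omega> p (A x))"

definition r_sec :: "('a::euclidean_space \<Rightarrow> 'a \<Rightarrow> real) \<Rightarrow> nat \<Rightarrow> 'a tsection \<Rightarrow> 'a vsection" where
  "r_sec \<omega> p T = (\<lambda>x. r_inv \<omega> p (T x))"

definition phi2_inv_sec :: "('a::euclidean_space \<Rightarrow> 'a \<Rightarrow> real) \<Rightarrow> 'a tsection \<Rightarrow> 'a vsection" where
  "phi2_inv_sec \<omega> T = (\<lambda>x. the_inv_into (alt_forms 2) (phi \<omega> 2) (T x))"

definition P_op :: "('a::euclidean_space \<Rightarrow> 'a \<Rightarrow> real) \<Rightarrow> nat \<Rightarrow> 'a tsection \<Rightarrow> 'a tsection" where
  "P_op \<omega> p T = T - phi_sec \<omega> (p + 1) (r_sec \<omega> p T)"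


text \<open>
  In the brackets, \<open>p\<close> and \<open>q\<close> are the form degrees of the arguments. The \<open>V\<close>-factors are expanded in
  the basis, \<open>A = \<Sum>i. (A \<bullet> i) \<otimes> i\<close>. Signs use \<open>p + 1\<close>, which has the parity of \<open>p - 1\<close> also for
  \<open>p = 0\<close>.
\<close>

definition vcomp :: "'a::euclidean_space \<Rightarrow> 'a vform \<Rightarrow> 'a form" where
  "vcomp i A = (\<lambda>us. A us \<bullet> i)"

definition bracket_VV ::
    "nat \<Rightarrow> nat \<Rightarrow> 'a::euclidean_space vsection \<Rightarrow> 'a vsection \<Rightarrow> 'a vsection" where
  "bracket_VV p q A B = (\<lambda>x us.
     (\<Sum>i\<in>Basis. \<Sum>j\<in>Basis.
        wedge (vcomp i (A x)) (iota i (vcomp j (B x))) us *\<^sub>R j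
        - (-1) ^ ((p + 1) * (q + 1)) *\<^sub>R
          wedge (vcomp j (B x)) (iota j (vcomp i (A x))) us *\<^sub>R i)
     + (if p = 1 then rho A (\<lambda>y. B y us) x else 0)
     - (if q = 1 then rho B (\<lambda>y. A y us) x else 0))"

definition bracket_VT ::
    "nat \<Rightarrow> 'a::euclidean_space vsection \<Rightarrow> 'a tsection \<Rightarrow> 'a tsection" where
  "bracket_VT p A T = (\<lambda>x us vs.
     (\<Sum>j\<in>Basis.
        (-1) ^ (p + 1) * wedge (vcomp j (A x)) (\<lambda>ws. iota j (T x) ws vs) us
        + (\<Sum>i\<in>Basis. wedge (one_form (\<lambda>v. i \<bullet> v))
             (\<lambda>zs. wedge (iota i (vcomp j (A x))) (\<lambda>ws. iota j (T x ws) zs) us) vs))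
     + (if p = 1 then rho A (\<lambda>y. T y us vs) x else 0))"

definition bracket_TV ::
    "nat \<Rightarrow> nat \<Rightarrow> 'a::euclidean_space tsection \<Rightarrow> 'a vsection \<Rightarrow> 'a tsection" where
  "bracket_TV q p T A = (\<lambda>x us vs. - ((-1) ^ ((p + 1) * (q + 1))) * bracket_VT p A T x us vs)"


text \<open>
  \<open>\<Gamma>(C_p)\<close> is \<open>\<Gamma>(\<Lambda>^(p-1) V* \<otimes> \<Lambda>^2 V*)\<close> modulo the image \<open>im_phi \<omega> p\<close> of \<open>\<Gamma>(\<Lambda>^p V* \<otimes> V)\<close> under \<open>\<phi>_p\<close>;
  its elements are the cosets \<open>\<eta> +o im_phi \<omega> p\<close>. As \<open>\<Lambda>^p V*\<close> vanishes for \<open>p > n\<close>, \<open>im_phi \<omega> (n + 1)\<close>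
  is zero, and \<open>\<Gamma>(C_p)\<close> is zero for \<open>p > n + 1\<close>.

  An operation on classes is the union, over all representatives, of the cosets of the results.
  This is a single coset exactly when the operation is well defined.
\<close>

definition im_phi :: "('a::euclidean_space \<Rightarrow> 'a \<Rightarrow> real) \<Rightarrow> nat \<Rightarrow> 'a tsection set" where
  "im_phi \<omega> p = phi_sec \<omega> p ` Gamma_V p"

definition Gamma_C :: "('a::euclidean_space \<Rightarrow> 'a \<Rightarrow> real) \<Rightarrow> nat \<Rightarrow> 'a tsection set set" where
  "Gamma_C \<omega> p = (\<lambda>\<eta>. \<eta> +o im_phi \<omega> p) ` Gamma_T (p - 1)"

definition del_bar ::
    "('a::euclidean_space \<Rightarrow> 'a \<Rightarrow> real) \<Rightarrow> nat \<Rightarrow> 'a tsection set \<Rightarrow> 'a tsection set" where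
  "del_bar \<omega> p C = (\<Union>\<eta>\<in>C. del \<eta> +o im_phi \<omega> p)"

definition diff_last ::
    "('a::euclidean_space \<Rightarrow> 'a \<Rightarrow> real) \<Rightarrow> 'a tsection set \<Rightarrow> 'a vsection" where
  "diff_last \<omega> C = the_elem ((\<lambda>\<eta>. d_op (phi2_inv_sec \<omega> (del \<eta>))) ` C)"

definition bracket_sp_C ::
    "('a::euclidean_space \<Rightarrow> 'a \<Rightarrow> real) \<Rightarrow> nat \<Rightarrow> 'a vsection \<Rightarrow> 'a tsection set \<Rightarrow> 'a tsection set" where
  "bracket_sp_C \<omega> k A C = (\<Union>\<eta>\<in>C. bracket_VT 1 A \<eta> +o im_phi \<omega> (k + 1))"

definition bracket_C_sp ::
    "('a::euclidean_space \<Rightarrow> 'a \<Rightarrow> real) \<Rightarrow> nat \<Rightarrow> 'a tsection set \<Rightarrow> 'a vsection \<Rightarrow> 'a tsection set" where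
  "bracket_C_sp \<omega> k C A = (\<Union>\<eta>\<in>C. bracket_TV k 1 \<eta> A +o im_phi \<omega> (k + 1))"

definition bracket_C_C ::
    "('a::euclidean_space \<Rightarrow> 'a \<Rightarrow> real) \<Rightarrow> nat \<Rightarrow> nat \<Rightarrow>
     'a tsection set \<Rightarrow> 'a tsection set \<Rightarrow> 'a tsection set" where
  "bracket_C_C \<omega> p q C E = (\<Union>S\<in>C. \<Union>T\<in>E.
     (bracket_VT p (r_sec \<omega> (p - 1) (del (P_op \<omega> p S))) (P_op \<omega> q T)
      + bracket_TV p q (P_op \<omega> p S) (r_sec \<omega> (q - 1) (del (P_op \<omega> q T))))
     +o im_phi \<omega> (p + q))"


text \<open>
  The total space of the complex is the direct sum of its homogeneous parts: in \<open>(A, c)\<close>, \<open>A\<close> is the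
  component in \<open>\<Gamma>(sp)\<close> and \<open>c p\<close>, for \<open>p \<ge> 2\<close>, the component in \<open>\<Gamma>(C_(p+1))\<close>, of degree \<open>1 - p\<close>.
  The entries \<open>c 0\<close> and \<open>c 1\<close> carry no information and are always the zero class. The sum of two
  elements is their sum in the product type, as the sum of cosets is the sum of sets, but the zero
  element is \<open>cx_zero\<close>, not \<open>0\<close>.
\<close>

type_synonym 'a cx = "'a vsection \<times> (nat \<Rightarrow> 'a tsection set)"

definition zero_class :: "('a::euclidean_space \<Rightarrow> 'a \<Rightarrow> real) \<Rightarrow> nat \<Rightarrow> 'a tsection set" where
  "zero_class \<omega> p = im_phi \<omega> (p + 1)"

definition cx_zero :: "('a::euclidean_space \<Rightarrow> 'a \<Rightarrow> real) \<Rightarrow> 'a cx" where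
  "cx_zero \<omega> = (0, zero_class \<omega>)"

definition cx_deg :: "('a::euclidean_space \<Rightarrow> 'a \<Rightarrow> real) \<Rightarrow> int \<Rightarrow> 'a cx set" where
  "cx_deg \<omega> k =
     (if k = 0 then {(A, zero_class \<omega>) | A. A \<in> Gamma_sp \<omega>}
      else if k < 0 then
        {(0, (zero_class \<omega>)(nat (1 - k) := C)) | C. C \<in> Gamma_C \<omega> (nat (1 - k) + 1)}
      else {cx_zero \<omega>})"

definition cx_scale :: "('a::euclidean_space \<Rightarrow> 'a \<Rightarrow> real) \<Rightarrow> real \<Rightarrow> 'a cx \<Rightarrow> 'a cx" where
  "cx_scale \<omega> s a =
     ((\<lambda>x us. s *\<^sub>R fst a x us),
      (\<lambda>p. \<Union>\<eta>\<in>snd a p. (\<lambda>x us vs. s * \<eta> x us vs) +o im_phi \<omega> (p + 1)))"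

definition cx_diff :: "('a::euclidean_space \<Rightarrow> 'a \<Rightarrow> real) \<Rightarrow> 'a cx \<Rightarrow> 'a cx" where
  "cx_diff \<omega> a =
     (diff_last \<omega> (snd a 2),
      (\<lambda>p. if p < 2 then zero_class \<omega> p else del_bar \<omega> (p + 1) (snd a (p + 1))))"

text \<open>Classes with indices \<open>p\<close> and \<open>q\<close> have a bracket with index \<open>p + q - 1\<close>.\<close>

definition cx_bracket :: "('a::euclidean_space \<Rightarrow> 'a \<Rightarrow> real) \<Rightarrow> 'a cx \<Rightarrow> 'a cx \<Rightarrow> 'a cx" where
  "cx_bracket \<omega> a b =
     (bracket_VV 1 1 (fst a) (fst b),
      (\<lambda>m. if m < 2 then zero_class \<omega> m
           else bracket_sp_C \<omega> m (fst a) (snd b m) + bracket_C_sp \<omega> m (snd a m) (fst b)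
             + (\<Sum>p\<in>{2..<m}. bracket_C_C \<omega> p (m + 1 - p) (snd a p) (snd b (m + 1 - p)))))"


text \<open>The operations on decomposable elements.\<close>

lemma wedge_one_forms:
  "wedge (one_form f) (one_form g) [u, v] = f u * g v - f v * g u"
proof -
  have Pow2: "Pow {..<length [u, v]} = insert {} (insert {0} (insert {1} {{0, 1}}))"
    by (auto simp: numeral_2_eq_2 lessThan_Suc Pow_insert)
  have 2: "{(i, j). i \<in> {1::nat} \<and> j \<in> {..<2} - {1} \<and> j < i} = {(1, 0)}"
    and 3: "{(i, j). i \<in> {0::nat} \<and> j \<in> {..<2} - {0::nat} \<and> j < i} = {}"
    by auto
  have "shuffle_sign 2 {1} = -1" "shuffle_sign 2 {0} = 1"
    unfolding shuffle_sign_def 2 3 by auto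
  then show ?thesis
    unfolding wedge_def wedge_contract_def Pow2
    by (simp add: one_form_def nths_Cons numeral_2_eq_2)
qed

lemma wedge_scale_left: "wedge (\<lambda>us. c * \<alpha> us) \<beta> us = c * wedge \<alpha> \<beta> us"
  and wedge_scale_right: "wedge \<alpha> (\<lambda>us. c * \<beta> us) us = c * wedge \<alpha> \<beta> us"
  by (simp_all add: wedge_def wedge_contract_def sum_distrib_left mult_ac)

lemma wedge_sum_right:
  "wedge \<alpha> (\<lambda>us. \<Sum>i\<in>B. \<beta> i us) us = (\<Sum>i\<in>B. wedge \<alpha> (\<beta> i) us)"
  unfolding wedge_def wedge_contract_def sum_distrib_left by (rule sum.swap)

lemma iota_expand:
  fixes \<psi> :: "'a::euclidean_space form"
  assumes "\<psi> \<in> alt_forms k"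
  shows "(\<Sum>i\<in>Basis. (w \<bullet> i) * \<psi> (i # us)) = \<psi> (w # us)"
proof (cases "Suc (length us) = k")
  case True
  have "linear (\<lambda>v. \<psi> ((w # us)[0 := v]))"
    using assms True unfolding alt_forms_def mem_Collect_eq
    by (elim conjE allE[of _ "w # us"] allE[of _ "0::nat"]) simp
  then have lin: "linear (\<lambda>v. \<psi> (v # us))" by simp
  have "\<psi> (w # us) = \<psi> ((\<Sum>i\<in>Basis. (w \<bullet> i) *\<^sub>R i) # us)"
    by (simp add: euclidean_representation)
  also have "\<dots> = (\<Sum>i\<in>Basis. (w \<bullet> i) * \<psi> (i # us))"
    using linear_sum[OF lin, of "\<lambda>i. (w \<bullet> i) *\<^sub>R i" Basis] linear_scale[OF lin] by simp
  finally show ?thesis by simp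
next
  case False
  then show ?thesis using assms by (simp add: alt_forms_def)
qed

lemma wedge_iota_expand:
  fixes \<psi> :: "'a::euclidean_space form"
  assumes "\<psi> \<in> alt_forms k"
  shows "(\<Sum>i\<in>Basis. (w \<bullet> i) * wedge \<alpha> (iota i \<psi>) us) = wedge \<alpha> (iota w \<psi>) us"
proof -
  have "iota w \<psi> = (\<lambda>us. \<Sum>i\<in>Basis. (w \<bullet> i) * iota i \<psi> us)"
    unfolding iota_def iota_expand[OF assms] by (rule refl)
  then show ?thesis by (simp only: wedge_sum_right wedge_scale_right)
qed

lemma rho_decomposable:
  assumes "f differentiable at x"
  shows "rho (\<lambda>x us. one_form \<phi> us *\<^sub>R v) f x = \<phi> x *\<^sub>R frechet_derivative f (at x) v"
proof -
  have "linear (frechet_derivative f (at x))"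
    using assms by (rule linear_frechet_derivative)
  then show ?thesis
    by (simp add: rho_def one_form_def linear_scale)
qed

lemma phi_decomposable:
  assumes "bilinear \<omega>"
  shows "phi \<omega> p (\<lambda>us. \<alpha> us *\<^sub>R X) =
    (\<lambda>us vs. (-1) ^ (p - 1) * (\<Sum>i\<in>Basis. iota i \<alpha> us *
       wedge (one_form (\<lambda>v. i \<bullet> v)) (one_form (\<omega> X)) vs))"
proof -
  have "one_form (\<omega> (c *\<^sub>R X)) = (\<lambda>us. c * one_form (\<omega> X) us)" for c
    using bilinear_lmul[OF assms] by (auto simp: one_form_def split: list.splits)
  then show ?thesis
    by (simp add: phi_def iota_def wedge_scale_right)
qed

lemma r_inv_decomposable:
  "r_inv \<omega> p (\<lambda>us vs. \<alpha> us * \<tau> vs) = (\<lambda>us. \<Sum>i\<in>Basis.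
     (1 / (real p + 1) * wedge \<alpha> (iota i \<tau>) us
      - (-1) ^ p / (real p * (real p + 1)) * wedge (iota i \<alpha>) \<tau> us)
     *\<^sub>R omega_inv \<omega> (\<lambda>v. i \<bullet> v))"
  by (simp add: r_inv_def wedge_def iota_def)

lemma rho_scaled:
  fixes g :: "'a::euclidean_space \<Rightarrow> real"
  assumes "g differentiable at x"
  shows "rho (\<lambda>x us. (f x * \<psi> us) *\<^sub>R w) (\<lambda>y. (g y * c) *\<^sub>R v) x =
    (f x * rho (\<lambda>x us. \<psi> us *\<^sub>R w) g x * c) *\<^sub>R v"
proof -
  have g: "(g has_derivative frechet_derivative g (at x)) (at x)"
    using assms by (simp add: frechet_derivative_works)
  then have "((\<lambda>y. (g y * c) *\<^sub>R v) has_derivative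
      (\<lambda>h. (frechet_derivative g (at x) h * c) *\<^sub>R v)) (at x)"
    by (auto intro!: derivative_eq_intros)
  then have "frechet_derivative (\<lambda>y. (g y * c) *\<^sub>R v) (at x) =
      (\<lambda>h. (frechet_derivative g (at x) h * c) *\<^sub>R v)"
    by (rule frechet_derivative_at[symmetric])
  moreover have "linear (frechet_derivative g (at x))"
    using assms by (rule linear_frechet_derivative)
  ultimately show ?thesis
    by (simp add: rho_def linear_scale mult_ac)
qed

lemma bracket_VV_decomposable:
  fixes f g :: "'a::euclidean_space \<Rightarrow> real"
  assumes \<psi>: "\<psi> \<in> alt_forms p" and \<zeta>: "\<zeta> \<in> alt_forms q"
    and f: "f differentiable at x" and g: "g differentiable at x"
  shows "bracket_VV p q (\<lambda>x us. (f x * \<psi> us) *\<^sub>R w) (\<lambda>x us. (g x * \<zeta> us) *\<^sub>R v) x us =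
    (f x * g x) *\<^sub>R (wedge \<psi> (iota w \<zeta>) us *\<^sub>R v
      - ((-1) ^ ((p + 1) * (q + 1)) * wedge \<zeta> (iota v \<psi>) us) *\<^sub>R w)
    + (if p = 1 then (f x * rho (\<lambda>x us. \<psi> us *\<^sub>R w) g x * \<zeta> us) *\<^sub>R v else 0)
    - (if q = 1 then (g x * rho (\<lambda>x us. \<zeta> us *\<^sub>R v) f x * \<psi> us) *\<^sub>R w else 0)"
proof -
  define s :: real where "s = (-1) ^ ((p + 1) * (q + 1))"
  have vc: "vcomp i (\<lambda>us. (c * \<psi>' us) *\<^sub>R w') = (\<lambda>us. (c * (w' \<bullet> i)) * \<psi>' us)"
    for i c and \<psi>' :: "'a form" and w'
    by (auto simp: vcomp_def)
  have io: "iota i (\<lambda>us. c * \<psi>' us) = (\<lambda>us. c * iota i \<psi>' us)" for i c and \<psi>' :: "'a form"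
    by (simp add: iota_def)
  have 1: "(\<Sum>i\<in>Basis. \<Sum>j\<in>Basis. (f x * (w \<bullet> i) * (g x * (v \<bullet> j)) * wedge \<psi> (iota i \<zeta>) us) *\<^sub>R j)
      = (f x * g x * wedge \<psi> (iota w \<zeta>) us) *\<^sub>R v"
  proof -
    have "(\<Sum>i\<in>Basis. \<Sum>j\<in>Basis. (f x * (w \<bullet> i) * (g x * (v \<bullet> j)) * wedge \<psi> (iota i \<zeta>) us) *\<^sub>R j)
      = (\<Sum>i\<in>Basis. (f x * g x * ((w \<bullet> i) * wedge \<psi> (iota i \<zeta>) us)) *\<^sub>R (\<Sum>j\<in>Basis. (v \<bullet> j) *\<^sub>R j))"
      by (simp add: scaleR_sum_right mult_ac)
    then show ?thesis
      by (simp only: euclidean_representation scaleR_sum_left[symmetric] sum_distrib_left[symmetric]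
          wedge_iota_expand[OF \<zeta>])
  qed
  have 2: "(\<Sum>i\<in>Basis. \<Sum>j\<in>Basis. s *\<^sub>R (g x * (v \<bullet> j) * (f x * (w \<bullet> i)) * wedge \<zeta> (iota j \<psi>) us) *\<^sub>R i)
      = (f x * g x * (s * wedge \<zeta> (iota v \<psi>) us)) *\<^sub>R w"
  proof -
    have "(\<Sum>i\<in>Basis. \<Sum>j\<in>Basis. s *\<^sub>R (g x * (v \<bullet> j) * (f x * (w \<bullet> i)) * wedge \<zeta> (iota j \<psi>) us) *\<^sub>R i)
      = (\<Sum>j\<in>Basis. (s * f x * g x * ((v \<bullet> j) * wedge \<zeta> (iota j \<psi>) us)) *\<^sub>R (\<Sum>i\<in>Basis. (w \<bullet> i) *\<^sub>R i))"
      by (subst sum.swap) (simp add: scaleR_sum_right mult_ac)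
    also have "\<dots> = (s * f x * g x * wedge \<zeta> (iota v \<psi>) us) *\<^sub>R w"
      by (simp only: euclidean_representation scaleR_sum_left[symmetric] sum_distrib_left[symmetric]
          wedge_iota_expand[OF \<psi>])
    finally show ?thesis by (simp add: mult_ac)
  qed
  show ?thesis
    unfolding bracket_VV_def vc io wedge_scale_left wedge_scale_right
      rho_scaled[OF f] rho_scaled[OF g] s_def[symmetric]
    using 1 2 by (simp add: sum_subtractf mult.assoc scaleR_diff_right)
qed

lemma bracket_VT_decomposable:
  fixes f g :: "'a::euclidean_space \<Rightarrow> real"
  assumes \<beta>: "\<beta> \<in> alt_forms q" and \<tau>: "\<tau> \<in> alt_forms 2"
    and g: "g differentiable at x"
  shows "bracket_VT p (\<lambda>x us. (f x * \<alpha> us) *\<^sub>R X) (\<lambda>x us vs. g x * (\<beta> us * \<tau> vs)) x us vs =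
    f x * g x * ((-1) ^ (p + 1) * wedge \<alpha> (iota X \<beta>) us * \<tau> vs
      + (\<Sum>i\<in>Basis. wedge (iota i \<alpha>) \<beta> us * wedge (one_form (\<lambda>v. i \<bullet> v)) (iota X \<tau>) vs))
    + (if p = 1 then f x * rho (\<lambda>x us. \<alpha> us *\<^sub>R X) g x * (\<beta> us * \<tau> vs) else 0)"
proof -
  define s :: real where "s = (-1) ^ (p + 1)"
  have vc: "vcomp j (\<lambda>us. (f x * \<alpha> us) *\<^sub>R X) = (\<lambda>us. (f x * (X \<bullet> j)) * \<alpha> us)" for j
    by (auto simp: vcomp_def)
  have io1: "iota j (\<lambda>us vs. g x * (\<beta> us * \<tau> vs)) ws vs = (g x * \<tau> vs) * iota j \<beta> ws"
    and io2: "iota j (\<lambda>vs. g x * (\<beta> ws * \<tau> vs)) zs = (g x * iota j \<tau> zs) * \<beta> ws"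
    and io3: "iota i (\<lambda>us. c * \<alpha> us) = (\<lambda>us. c * iota i \<alpha> us)" for i j ws vs zs c
    by (simp_all add: iota_def)
  have w: "wedge \<gamma> (\<lambda>zs. g x * iota j \<tau> zs * d) vs = g x * d * wedge \<gamma> (iota j \<tau>) vs" for \<gamma> d j
  proof -
    have "(\<lambda>zs. g x * iota j \<tau> zs * d) = (\<lambda>zs. (g x * d) * iota j \<tau> zs)"
      by (auto simp: mult_ac)
    then show ?thesis by (simp only: wedge_scale_right)
  qed
  have 1: "(\<Sum>j\<in>Basis. s * (f x * (X \<bullet> j) * (g x * \<tau> vs * wedge \<alpha> (iota j \<beta>) us)))
      = f x * g x * (s * wedge \<alpha> (iota X \<beta>) us * \<tau> vs)"
    unfolding wedge_iota_expand[OF \<beta>, of X, symmetric]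
    by (simp add: sum_distrib_left sum_distrib_right mult_ac)
  have 2: "(\<Sum>j\<in>Basis. \<Sum>i\<in>Basis. f x * (X \<bullet> j) * g x * wedge (iota i \<alpha>) \<beta> us * wedge (one_form (\<lambda>v. i \<bullet> v)) (iota j \<tau>) vs)
      = f x * g x * (\<Sum>i\<in>Basis. wedge (iota i \<alpha>) \<beta> us * wedge (one_form (\<lambda>v. i \<bullet> v)) (iota X \<tau>) vs)"
    unfolding wedge_iota_expand[OF \<tau>, of X, symmetric]
    by (subst sum.swap) (simp add: sum_distrib_left mult_ac)
  have 3: "rho (\<lambda>x us. (f x * \<alpha> us) *\<^sub>R X) (\<lambda>y. g y * (\<beta> us * \<tau> vs)) x
      = f x * rho (\<lambda>x us. \<alpha> us *\<^sub>R X) g x * (\<beta> us * \<tau> vs)"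
    using rho_scaled[OF g, of f \<alpha> X "\<beta> us * \<tau> vs" "1::real"] by simp
  show ?thesis
    unfolding bracket_VT_def vc io1 io2 io3 wedge_scale_left wedge_scale_right 3
      s_def[symmetric] w
    using 1 2 by (simp add: sum.distrib distrib_left mult.assoc)
qed

end

theory Submission
  imports Defs
begin

text \<open>Forms with values in \<open>V\<close> act on tensor-valued forms like Lie derivatives along vector fields on the
  graded manifold \<open>V \<times> V[1]\<close>: up to sign, \<open>[X, T]\<close> is \<open>L_X T\<close>. The operators of the resolution have the
  same origin. Contraction with the Euler field \<open>x\<close> gives \<open>d\<close> and \<open>- \<partial>\<close>, and \<open>\<phi> X = L_X \<omega>\<close> for the
  constant form \<open>\<omega>\<close>. Two identities follow, for \<open>X\<close> of form degree \<open>p\<close>: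

  \<^item> \<open>\<partial>[X, T] = [dX, T] + (-1)^(p+1) [X, \<partial>T]\<close> (\<open>del_bracket_VT\<close> and, with \<open>dX\<close> replaced by \<open>0\<close>,
    \<open>del_bracket_VT_1\<close>);
  \<^item> \<open>\<phi>[X, Y] = [\<phi>X, Y] + (-1)^(p+1) [X, \<phi>Y]\<close> (\<open>phi_sec_bracket_VV\<close>).

  Moreover \<open>\<partial>\<phi> = - \<phi>d\<close> (\<open>del_phi_sec\<close>), \<open>r\<phi> = id\<close> (\<open>r_inv_phi\<close>) and \<open>\<phi>_2 r_1 = id\<close> (\<open>phi_r_inv_1\<close>).

  Let \<open>S\<close> and \<open>T\<close> represent classes of negative degree. The projection \<open>P\<close> only changes the
  representative, so assume \<open>S = P S\<close> and \<open>T = P T\<close>, and put \<open>X = r\<partial>S\<close>, \<open>Y = r\<partial>T\<close>. Then the bracket of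
  the classes is represented by \<open>[X, T] + [S, Y]\<close>, and the first identity gives
  \<open>\<partial>([X, T] + [S, Y]) = [dX, T] + [\<partial>S, Y] + (-1)^(p+1) ([X, \<partial>T] + [S, dY])\<close>.
  On the other hand \<open>P(\<partial>S) = \<partial>S - \<phi>X\<close> and \<open>r\<partial>(\<partial>S - \<phi>X) = r\<phi>dX = dX\<close>, so the bracket of the class of
  \<open>\<partial>S\<close> with that of \<open>T\<close> is represented by \<open>[dX, T] + [\<partial>S - \<phi>X, Y]\<close>; similarly in the other entry.
  The two sides of the derivation rule therefore differ by \<open>[\<phi>X, Y] + (-1)^(p+1) [X, \<phi>Y] = \<phi>[X, Y]\<close>,
  which is zero in the cokernel (\<open>del_bracket_rep\<close>). At the end of the complex, where \<open>p = 2\<close>, the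
  differential of \<open>S\<close> is \<open>dX\<close> itself and \<open>\<partial>S = \<phi>X\<close>, so that the same formula holds.

  If one entry is a section \<open>A\<close> of \<open>sp(V, \<omega>)\<close>, then \<open>\<phi>A = 0\<close>, so \<open>[A, _]\<close> commutes with \<open>\<phi>\<close> and, by the
  first identity, with \<open>\<partial>\<close>. For the last differential \<open>d \<phi>_2^(-1) \<partial>\<close> one also needs \<open>d[A, Z] = [A, dZ]\<close>
  (\<open>d_op_bracket_VV\<close>).

  At a point, the identities only use that contractions are graded derivations of a graded
  commutative product. On functions of lists, the contraction by \<open>v\<close> is \<open>\<alpha> \<mapsto> (\<lambda>us. \<alpha> (v # us))\<close>, and the
  graded Leibniz rule is a recursion for the shuffle sum along its list of arguments
  (\<open>wedge_contract_Cons\<close>); products and contractions are computed by induction with it.\<close>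

section \<open>Smooth functions\<close>

lemma C_k_frechet: "C_k (Suc k) f \<Longrightarrow> C_k k (\<lambda>x. frechet_derivative f (at x) v)"
  by simp

lemma C_k_Suc_D: "C_k (Suc k) f \<Longrightarrow> C_k k f"
proof (induction k arbitrary: f)
  case 0 then show ?case by (simp add: differentiable_imp_continuous_on)
next
  case (Suc k)
  then have "C_k k (\<lambda>x. frechet_derivative f (at x) v)" for v
    using C_k_frechet by blast
  with Suc.prems show ?case by simp
qed

lemma C_k_differentiable: "C_k (Suc k) f \<Longrightarrow> f differentiable (at x)"
  by (simp add: differentiable_on_def)

text \<open>Any formula for the derivative will do, so that the closure properties below follow from
  the differentiation rules by induction on \<open>k\<close>.\<close>

lemma C_k_SucI:
  assumes "\<And>x. (f has_derivative f' x) (at x)" and "\<And>v. C_k k (\<lambda>x. f' x v)"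
  shows "C_k (Suc k) f"
proof -
  have "frechet_derivative f (at x) = f' x" for x
    using frechet_derivative_at[OF assms(1)] by simp
  moreover have "f differentiable_on UNIV"
    using assms(1) by (auto simp: differentiable_on_def differentiable_def)
  ultimately show ?thesis using assms(2) by simp
qed

lemma C_k_const: "C_k k (\<lambda>_. c)"
proof (induction k arbitrary: c)
  case (Suc k)
  show ?case by (rule C_k_SucI[where f'="\<lambda>_ _. 0"]) (auto intro: Suc.IH)
qed simp

lemma C_k_has_derivative:
  "C_k (Suc k) f \<Longrightarrow> (f has_derivative frechet_derivative f (at x)) (at x)"
  using C_k_differentiable frechet_derivative_works by blast

lemma C_k_add: "C_k k f \<Longrightarrow> C_k k g \<Longrightarrow> C_k k (\<lambda>x. f x + g x)"
proof (induction k arbitrary: f g)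
  case (Suc k)
  show ?case
    by (rule C_k_SucI[OF has_derivative_add[OF Suc.prems[THEN C_k_has_derivative]]])
       (intro Suc.IH Suc.prems C_k_frechet)
qed (simp add: continuous_on_add)

lemma C_k_bounded_linear:
  assumes "bounded_linear L"
  shows "C_k k f \<Longrightarrow> C_k k (\<lambda>x. L (f x))"
proof (induction k arbitrary: f)
  case 0 then show ?case
    using bounded_linear.continuous_on[OF assms] by simp
next
  case (Suc k)
  show ?case
    by (rule C_k_SucI[OF bounded_linear.has_derivative[OF assms C_k_has_derivative[OF Suc.prems]]])
       (intro Suc.IH Suc.prems C_k_frechet)
qed

lemma C_k_scaleR: "C_k k f \<Longrightarrow> C_k k g \<Longrightarrow> C_k k (\<lambda>x. f x *\<^sub>R g x)"
proof (induction k arbitrary: f g)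
  case (Suc k)
  show ?case
    by (rule C_k_SucI[OF has_derivative_scaleR[OF Suc.prems[THEN C_k_has_derivative]]])
       (intro C_k_add Suc.IH Suc.prems C_k_frechet C_k_Suc_D)
qed (simp add: continuous_on_scaleR)

lemma C_k_id: "C_k k (\<lambda>x. x)"
proof (cases k)
  case (Suc l)
  show ?thesis unfolding Suc
    by (rule C_k_SucI[where f'="\<lambda>_ v. v"]) (auto intro: C_k_const)
qed simp

lemma smooth_const: "smooth (\<lambda>_. c)"
  by (simp add: smooth_def C_k_const)

lemma smooth_add: "smooth f \<Longrightarrow> smooth g \<Longrightarrow> smooth (\<lambda>x. f x + g x)"
  by (simp add: smooth_def C_k_add)

lemma smooth_bounded_linear: "bounded_linear L \<Longrightarrow> smooth f \<Longrightarrow> smooth (\<lambda>x. L (f x))"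
  by (simp add: smooth_def C_k_bounded_linear)

lemma smooth_scaleR: "smooth f \<Longrightarrow> smooth g \<Longrightarrow> smooth (\<lambda>x. f x *\<^sub>R g x)"
  by (simp add: smooth_def C_k_scaleR)

lemma smooth_mult:
  fixes f g :: "'a::euclidean_space \<Rightarrow> real"
  shows "smooth f \<Longrightarrow> smooth g \<Longrightarrow> smooth (\<lambda>x. f x * g x)"
  using smooth_scaleR[of f g] by simp

lemma smooth_minus: "smooth f \<Longrightarrow> smooth (\<lambda>x. - f x)"
  using smooth_bounded_linear[OF bounded_linear_minus[OF bounded_linear_ident]] .

lemma smooth_diff: "smooth f \<Longrightarrow> smooth g \<Longrightarrow> smooth (\<lambda>x. f x - g x)"
  using smooth_add[of f "\<lambda>x. - g x"] smooth_minus[of g] by simp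

lemma smooth_sum: "(\<And>i. i \<in> I \<Longrightarrow> smooth (f i)) \<Longrightarrow> smooth (\<lambda>x. \<Sum>i\<in>I. f i x)"
proof (induction I rule: infinite_finite_induct)
  case (insert i I) then show ?case by (simp add: smooth_add)
qed (simp_all add: smooth_const)

lemma smooth_inner: "smooth f \<Longrightarrow> smooth (\<lambda>x. f x \<bullet> i)"
  using smooth_bounded_linear[OF bounded_linear_inner_left] .

lemma smooth_coordinate: "smooth (\<lambda>x. x \<bullet> i)"
  by (rule smooth_inner) (simp add: smooth_def C_k_id)

lemma smooth_differentiable: "smooth f \<Longrightarrow> f differentiable (at x)"
  unfolding smooth_def using C_k_differentiable[of 0 f x] by blast

lemma smooth_has_derivative:
  "smooth f \<Longrightarrow> (f has_derivative frechet_derivative f (at x)) (at x)"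
  using smooth_differentiable frechet_derivative_works by blast

lemma smooth_frechet: "smooth f \<Longrightarrow> smooth (\<lambda>x. frechet_derivative f (at x) v)"
  unfolding smooth_def using C_k_frechet by blast

lemma smooth_linear_frechet: "smooth f \<Longrightarrow> linear (frechet_derivative f (at x))"
  using smooth_differentiable linear_frechet_derivative by blast

text \<open>The point and the direction vary together. Expanding the direction in the basis
  separates them.\<close>

lemma smooth_frechet_section:
  fixes w :: "'a::euclidean_space \<Rightarrow> 'a"
  assumes f: "smooth f" and w: "smooth w"
  shows "smooth (\<lambda>x. frechet_derivative f (at x) (w x))"
proof -
  have "frechet_derivative f (at x) (w x) =
      (\<Sum>i\<in>Basis. (w x \<bullet> i) *\<^sub>R frechet_derivative f (at x) i)" for x
    using linear_sum[OF smooth_linear_frechet[OF f, of x], of "\<lambda>i. (w x \<bullet> i) *\<^sub>R i" Basis]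
      linear_scale[OF smooth_linear_frechet[OF f, of x]]
    by (simp add: euclidean_representation)
  then show ?thesis
    by (simp only:) (intro smooth_sum smooth_scaleR smooth_inner smooth_frechet f w)
qed

lemma frechet_add:
  "smooth f \<Longrightarrow> smooth g \<Longrightarrow> frechet_derivative (\<lambda>y. f y + g y) (at x) h
    = frechet_derivative f (at x) h + frechet_derivative g (at x) h"
  using frechet_derivative_at[OF has_derivative_add[OF smooth_has_derivative[of f x] smooth_has_derivative[of g x]]]
  by (metis (no_types))

lemma frechet_bounded_linear:
  "bounded_linear L \<Longrightarrow> smooth f \<Longrightarrow>
    frechet_derivative (\<lambda>y. L (f y)) (at x) h = L (frechet_derivative f (at x) h)"
  using frechet_derivative_at[OF bounded_linear.has_derivative[OF _ smooth_has_derivative[of f x]]]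
  by (metis (no_types))

lemma frechet_zero: "frechet_derivative (\<lambda>_. c) (at x) h = 0"
  by (simp add: frechet_derivative_const)

section \<open>Alternating forms and the shuffle product\<close>

text \<open>A new first position causes no inversion if it goes to the first factor, and one inversion
  with each position in \<open>I\<close> if it goes to the second.\<close>

lemma shuffle_sign_Suc:
  assumes "I \<subseteq> {..<n}"
  shows "shuffle_sign (Suc n) (insert 0 (Suc ` I)) = shuffle_sign n I"
    and "shuffle_sign (Suc n) (Suc ` I) = (-1) ^ card I * shuffle_sign n I"
proof -
  let ?N = "{(i, j). i \<in> I \<and> j \<in> {..<n} - I \<and> j < i}"
  have fin: "finite I" using assms finite_subset by blast
  have finN: "finite ?N"
    by (rule finite_subset[of _ "I \<times> {..<n}"]) (use fin in auto)
  have 1: "{(i, j). i \<in> insert 0 (Suc ` I) \<and> j \<in> {..<Suc n} - insert 0 (Suc ` I) \<and> j < i}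
      = (\<lambda>(i, j). (Suc i, Suc j)) ` ?N" (is "?L = ?R")
  proof (rule set_eqI)
    fix z :: "nat \<times> nat"
    show "z \<in> ?L \<longleftrightarrow> z \<in> ?R"
      by (cases z; cases "fst z"; cases "snd z") (auto simp: image_iff)
  qed
  have 2: "{(i, j). i \<in> Suc ` I \<and> j \<in> {..<Suc n} - Suc ` I \<and> j < i}
      = (\<lambda>i. (Suc i, 0)) ` I \<union> (\<lambda>(i, j). (Suc i, Suc j)) ` ?N" (is "?L = ?R")
  proof (rule set_eqI)
    fix z :: "nat \<times> nat"
    show "z \<in> ?L \<longleftrightarrow> z \<in> ?R"
      by (cases z; cases "fst z"; cases "snd z") (auto simp: image_iff)
  qed
  have cN: "card ((\<lambda>(i, j). (Suc i, Suc j)) ` ?N) = card ?N"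
    by (rule card_image) (auto simp: inj_on_def)
  have cI: "card ((\<lambda>i. (Suc i, 0::nat)) ` I) = card I"
    by (rule card_image) (auto simp: inj_on_def)
  show "shuffle_sign (Suc n) (insert 0 (Suc ` I)) = shuffle_sign n I"
    unfolding shuffle_sign_def 1 cN ..
  have "card ((\<lambda>i. (Suc i, 0)) ` I \<union> (\<lambda>(i, j). (Suc i, Suc j)) ` ?N) = card I + card ?N"
    by (subst card_Un_disjoint) (use fin finN cN cI in auto)
  then show "shuffle_sign (Suc n) (Suc ` I) = (-1) ^ card I * shuffle_sign n I"
    unfolding shuffle_sign_def 2 by (simp add: power_add)
qed

lemma Pow_lessThan_Suc:
  "Pow {..<Suc n} = (\<lambda>I. insert 0 (Suc ` I)) ` Pow {..<n} \<union> (`) Suc ` Pow {..<n}"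
  by (simp add: lessThan_Suc_eq_insert_0 Pow_insert image_Pow_surj[symmetric] Un_commute image_image)

lemma wedge_contract_Nil: "wedge_contract T [] = T [] []"
  by (simp add: wedge_contract_def shuffle_sign_def)

text \<open>The graded Leibniz rule for contractions. The two terms collect the shuffles that give the first
  argument to the first or to the second factor. Being an identity between functions of two lists,
  it applies again to both terms on the right.\<close>

lemma wedge_contract_Cons:
  "wedge_contract T (v # us) = wedge_contract (iota v T) us
     + wedge_contract (\<lambda>xs ys. (-1) ^ length xs * T xs (v # ys)) us"
proof -
  let ?n = "length us"
  let ?g = "\<lambda>I. shuffle_sign (Suc ?n) I * T (nths (v # us) I) (nths (v # us) (- I))"
  have inj: "inj_on (\<lambda>I. insert 0 (Suc ` I)) (Pow {..<?n})" "inj_on ((`) Suc) (Pow {..<?n})"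
  proof (rule inj_onI)
    fix I J :: "nat set" assume "insert 0 (Suc ` I) = insert 0 (Suc ` J)"
    then have "Suc ` I = Suc ` J" by (auto simp: set_eq_iff)
    then show "I = J" by (simp add: inj_image_eq_iff)
  next
    show "inj_on ((`) Suc) (Pow {..<?n})" by (auto simp: inj_on_def inj_image_eq_iff)
  qed
  have "wedge_contract T (v # us) = sum ?g (Pow {..<Suc ?n})"
    by (simp add: wedge_contract_def)
  also have "\<dots> = sum ?g ((\<lambda>I. insert 0 (Suc ` I)) ` Pow {..<?n}) + sum ?g ((`) Suc ` Pow {..<?n})"
    unfolding Pow_lessThan_Suc by (rule sum.union_disjoint) auto
  also have "sum ?g ((\<lambda>I. insert 0 (Suc ` I)) ` Pow {..<?n}) = wedge_contract (iota v T) us"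
  proof -
    have "sum ?g ((\<lambda>I. insert 0 (Suc ` I)) ` Pow {..<?n}) =
        (\<Sum>I\<in>Pow {..<?n}. ?g (insert 0 (Suc ` I)))"
      by (rule sum.reindex_cong[OF inj(1)]) auto
    also have "\<dots> = wedge_contract (iota v T) us"
      unfolding wedge_contract_def
    proof (rule sum.cong[OF refl])
      fix I assume "I \<in> Pow {..<?n}"
      moreover have "{j. Suc j \<in> Suc ` I} = I" "{j. Suc j \<notin> Suc ` I} = - I" by auto
      ultimately show "?g (insert 0 (Suc ` I)) =
          shuffle_sign ?n I * iota v T (nths us I) (nths us (- I))"
        by (simp add: nths_Cons shuffle_sign_Suc iota_def)
    qed
    finally show ?thesis .
  qed
  also have "sum ?g ((`) Suc ` Pow {..<?n}) =
      wedge_contract (\<lambda>xs ys. (-1) ^ length xs * T xs (v # ys)) us"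
  proof -
    have "sum ?g ((`) Suc ` Pow {..<?n}) = (\<Sum>I\<in>Pow {..<?n}. ?g (Suc ` I))"
      by (rule sum.reindex_cong[OF inj(2)]) auto
    also have "\<dots> = wedge_contract (\<lambda>xs ys. (-1) ^ length xs * T xs (v # ys)) us"
      unfolding wedge_contract_def
    proof (rule sum.cong[OF refl])
      fix I assume I: "I \<in> Pow {..<?n}"
      moreover have "{j. Suc j \<in> Suc ` I} = I" "{j. Suc j \<notin> Suc ` I} = - I" by auto
      moreover have "{i. i < ?n \<and> i \<in> I} = I" using I by auto
      ultimately show "?g (Suc ` I) = shuffle_sign ?n I *
          ((-1) ^ length (nths us I) * T (nths us I) (v # nths us (- I)))"
        by (simp add: nths_Cons shuffle_sign_Suc length_nths mult_ac)
    qed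
    finally show ?thesis .
  qed
  finally show ?thesis .
qed

lemma wedge_contract_sum:
  "wedge_contract (\<lambda>xs ys. \<Sum>i\<in>I. T i xs ys) us = (\<Sum>i\<in>I. wedge_contract (T i) us)"
  unfolding wedge_contract_def sum_distrib_left by (rule sum.swap)

lemma wedge_contract_scale:
  "wedge_contract (\<lambda>xs ys. c * T xs ys) us = c * wedge_contract T us"
  by (simp add: wedge_contract_def sum_distrib_left mult_ac)

lemma wedge_contract_add:
  "wedge_contract (\<lambda>xs ys. S xs ys + T xs ys) us = wedge_contract S us + wedge_contract T us"
  by (simp add: wedge_contract_def sum.distrib distrib_left)

lemma wedge_contract_diff:
  "wedge_contract (\<lambda>xs ys. S xs ys - T xs ys) us = wedge_contract S us - wedge_contract T us"
  by (simp add: wedge_contract_def sum_subtractf right_diff_distrib)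

lemma wedge_contract_zero: "wedge_contract (\<lambda>xs ys. 0) us = 0"
  by (simp add: wedge_contract_def)

lemma wedge_sum_left:
  "wedge (\<lambda>us. \<Sum>i\<in>B. \<alpha> i us) \<beta> us = (\<Sum>i\<in>B. wedge (\<alpha> i) \<beta> us)"
  by (simp add: wedge_def sum_distrib_right wedge_contract_sum)

lemma wedge_zero: "wedge (\<lambda>_. 0) \<beta> us = 0" "wedge \<alpha> (\<lambda>_. 0) us = 0"
  by (simp_all add: wedge_def wedge_contract_zero)

lemma wedge_add_right: "wedge \<alpha> (\<lambda>us. \<beta> us + \<beta>' us) us = wedge \<alpha> \<beta> us + wedge \<alpha> \<beta>' us"
  by (simp add: wedge_def distrib_left wedge_contract_add)

lemma wedge_diff_right: "wedge \<alpha> (\<lambda>us. \<beta> us - \<beta>' us) us = wedge \<alpha> \<beta> us - wedge \<alpha> \<beta>' us"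
  by (simp add: wedge_def right_diff_distrib wedge_contract_diff)

lemma wedge_minus_left: "wedge (\<lambda>us. - \<alpha> us) \<beta> us = - wedge \<alpha> \<beta> us"
  and wedge_minus_right: "wedge \<alpha> (\<lambda>us. - \<beta> us) us = - wedge \<alpha> \<beta> us"
  using wedge_scale_left[of "-1" \<alpha> \<beta> us] wedge_scale_right[of \<alpha> "-1" \<beta> us] by simp_all

lemma alt_formsI:
  assumes "\<And>us. length us \<noteq> p \<Longrightarrow> \<alpha> us = 0"
    and "\<And>us i. length us = p \<Longrightarrow> i < p \<Longrightarrow> linear (\<lambda>v. \<alpha> (us[i := v]))"
    and "\<And>us. length us = p \<Longrightarrow> \<not> distinct us \<Longrightarrow> \<alpha> us = 0"
  shows "\<alpha> \<in> alt_forms p"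
  using assms by (simp add: alt_forms_def)

lemma alt_forms_length: "\<alpha> \<in> alt_forms p \<Longrightarrow> length us \<noteq> p \<Longrightarrow> \<alpha> us = 0"
  by (simp add: alt_forms_def)

lemma alt_forms_linear:
  assumes "\<alpha> \<in> alt_forms p" "i < length us"
  shows "linear (\<lambda>v. \<alpha> (us[i := v]))"
  using assms
  by (cases "length us = p") (auto simp: alt_forms_def intro: linear_zero)

lemma alt_forms_distinct: "\<alpha> \<in> alt_forms p \<Longrightarrow> \<not> distinct us \<Longrightarrow> \<alpha> us = 0"
  by (cases "length us = p") (auto simp: alt_forms_def)

lemma alt_forms_linear_hd: "\<alpha> \<in> alt_forms p \<Longrightarrow> linear (\<lambda>v. \<alpha> (v # us))"
  using alt_forms_linear[of \<alpha> p 0 "0 # us"] by simp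

lemma alt_forms_linear_hd2: "\<alpha> \<in> alt_forms p \<Longrightarrow> linear (\<lambda>v. \<alpha> (u # v # us))"
  using alt_forms_linear[of \<alpha> p 1 "u # 0 # us"] by simp

text \<open>Polarisation.\<close>

lemma swap_of_linear_diagonal:
  assumes "\<And>b. linear (\<lambda>a. g a b)" "\<And>a. linear (\<lambda>b. g a b)" "\<And>a. g a a = 0"
  shows "g u v = - g v u"
proof -
  have "0 = g (u + v) (u + v)" using assms(3) by simp
  also have "\<dots> = g u v + g v u"
    unfolding linear_add[OF assms(1)] linear_add[OF assms(2)] by (simp add: assms(3))
  finally show ?thesis by (simp add: eq_neg_iff_add_eq_0)
qed

lemma alt_forms_swap:
  assumes "\<alpha> \<in> alt_forms p"
  shows "\<alpha> (u # v # us) = - \<alpha> (v # u # us)"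
  by (rule swap_of_linear_diagonal[where g="\<lambda>u v. \<alpha> (u # v # us)"])
     (use assms in \<open>auto intro: alt_forms_linear_hd alt_forms_linear_hd2 alt_forms_distinct\<close>)

lemma alt_forms_zero: "(\<lambda>_. 0) \<in> alt_forms p"
  by (rule alt_formsI) (auto intro: linear_zero)

lemma alt_forms_add: "\<alpha> \<in> alt_forms p \<Longrightarrow> \<beta> \<in> alt_forms p \<Longrightarrow> (\<lambda>us. \<alpha> us + \<beta> us) \<in> alt_forms p"
  by (rule alt_formsI) (auto intro: linear_compose_add simp: alt_forms_def)

lemma alt_forms_compose_linear:
  fixes \<alpha> :: "'a::real_vector list \<Rightarrow> 'b::real_vector" and f :: "'b \<Rightarrow> 'c::real_vector"
  assumes "linear f" "\<alpha> \<in> alt_forms p"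
  shows "(\<lambda>us. f (\<alpha> us)) \<in> alt_forms p"
proof (rule alt_formsI)
  fix us :: "'a list" and i assume "length us = p" "i < p"
  then have "linear (\<lambda>v. \<alpha> (us[i := v]))" using assms(2) by (simp add: alt_forms_def)
  from linear_compose[OF this assms(1)] show "linear (\<lambda>v. f (\<alpha> (us[i := v])))"
    by (simp add: o_def)
qed (use assms in \<open>auto simp: alt_forms_def linear_0\<close>)

lemma alt_forms_scale: "\<alpha> \<in> alt_forms p \<Longrightarrow> (\<lambda>us. c *\<^sub>R \<alpha> us) \<in> alt_forms p"
  by (rule alt_forms_compose_linear) (simp_all add: linear_scaleR)

lemma alt_forms_mult:
  fixes \<alpha> :: "'a::real_vector form"
  shows "\<alpha> \<in> alt_forms p \<Longrightarrow> (\<lambda>us. c * \<alpha> us) \<in> alt_forms p"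
  using alt_forms_scale[of \<alpha> p c] by simp

lemma alt_forms_minus: "\<alpha> \<in> alt_forms p \<Longrightarrow> (\<lambda>us. - \<alpha> us) \<in> alt_forms p"
  using alt_forms_scale[of \<alpha> p "-1"] by simp

lemma alt_forms_diff: "\<alpha> \<in> alt_forms p \<Longrightarrow> \<beta> \<in> alt_forms p \<Longrightarrow> (\<lambda>us. \<alpha> us - \<beta> us) \<in> alt_forms p"
  using alt_forms_add[OF _ alt_forms_minus, of \<alpha> p \<beta>] by simp

lemma alt_forms_sum: "(\<And>i. i \<in> I \<Longrightarrow> \<alpha> i \<in> alt_forms p) \<Longrightarrow> (\<lambda>us. \<Sum>i\<in>I. \<alpha> i us) \<in> alt_forms p"
proof (induction I rule: infinite_finite_induct)
  case (insert i I)
  then have "(\<lambda>us. \<alpha> i us + (\<Sum>i\<in>I. \<alpha> i us)) \<in> alt_forms p" by (simp add: alt_forms_add)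
  with insert show ?case by simp
qed (simp_all add: alt_forms_zero)

lemma alt_forms_scaleR_right:
  fixes \<alpha> :: "'a::real_vector form"
  shows "\<alpha> \<in> alt_forms p \<Longrightarrow> (\<lambda>us. \<alpha> us *\<^sub>R v) \<in> alt_forms p"
  by (rule alt_forms_compose_linear[of "\<lambda>c. c *\<^sub>R v"]) (auto intro: linearI simp: algebra_simps)

lemma alt_forms_Cons_zero: "\<alpha> \<in> alt_forms 0 \<Longrightarrow> \<alpha> (v # us) = 0"
  by (rule alt_forms_length) auto

lemma alt_forms_iota: "\<alpha> \<in> alt_forms p \<Longrightarrow> iota v \<alpha> \<in> alt_forms (p - 1)"
proof (cases p)
  case 0
  assume "\<alpha> \<in> alt_forms p"
  then have "iota v \<alpha> = (\<lambda>_. 0)" using 0 by (auto simp: iota_def alt_forms_Cons_zero)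
  then show ?thesis by (simp add: alt_forms_zero)
next
  case (Suc k)
  assume \<alpha>: "\<alpha> \<in> alt_forms p"
  show ?thesis unfolding Suc
  proof (rule alt_formsI)
    fix us :: "'a list" and i assume "length us = Suc k - 1" "i < Suc k - 1"
    then show "linear (\<lambda>w. iota v \<alpha> (us[i := w]))"
      using alt_forms_linear[OF \<alpha>, of "Suc i" "v # us"] by (simp add: iota_def)
  qed (use \<alpha> Suc in \<open>auto simp: iota_def intro: alt_forms_length alt_forms_distinct\<close>)
qed

lemma alt_forms_vcomp: "A \<in> alt_forms p \<Longrightarrow> vcomp i A \<in> alt_forms p"
  unfolding vcomp_def
  by (rule alt_forms_compose_linear) (auto intro: linearI simp: algebra_simps)

lemma length_nths_add: "length (nths us I) + length (nths us (- I)) = length us"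
proof -
  have "{i. i < length us \<and> i \<in> I} \<union> {i. i < length us \<and> i \<in> - I} = {..<length us}" by auto
  then have "card {..<length us} = card {i. i < length us \<and> i \<in> I} + card {i. i < length us \<and> i \<in> - I}"
    by (subst card_Un_disjoint[symmetric]) auto
  then show ?thesis by (simp add: length_nths)
qed

lemma wedge_contract_length:
  assumes "\<And>xs ys. length xs \<noteq> p \<or> length ys \<noteq> q \<Longrightarrow> T xs ys = 0" "length us \<noteq> p + q"
  shows "wedge_contract T us = 0"
  unfolding wedge_contract_def
proof (rule sum.neutral, rule ballI)
  fix I
  have "T (nths us I) (nths us (- I)) = 0"
    using assms length_nths_add[of us I] by force
  then show "shuffle_sign (length us) I * T (nths us I) (nths us (- I)) = 0" by simp
qed

lemma wedge_contract_linear_family: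
  assumes "\<And>xs ys. linear (\<lambda>v. F v xs ys)"
  shows "linear (\<lambda>v. wedge_contract (F v) us)"
  unfolding wedge_contract_def
proof (rule linear_compose_sum, rule ballI)
  fix I
  show "linear (\<lambda>v. shuffle_sign (length us) I * F v (nths us I) (nths us (- I)))"
    using linear_compose[OF assms linear_times] by (simp add: o_def)
qed

lemma wedge_contract_multilinear:
  fixes T :: "'a::real_vector tform"
  assumes "\<And>xs ys i. i < length xs \<Longrightarrow> linear (\<lambda>v. T (xs[i := v]) ys)"
    and "\<And>xs ys i. i < length ys \<Longrightarrow> linear (\<lambda>v. T xs (ys[i := v]))"
    and "i < length us"
  shows "linear (\<lambda>v. wedge_contract T (us[i := v]))"
  using assms
proof (induction us arbitrary: T i)
  case (Cons u us)
  show ?case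
  proof (cases i)
    case 0
    have "linear (\<lambda>v. iota v T xs ys)" for xs ys
      using Cons.prems(1)[of 0 "0 # xs" ys] by (simp add: iota_def)
    moreover have "linear (\<lambda>v. (-1) ^ length xs * T xs (v # ys))" for xs ys
      using linear_compose[OF Cons.prems(2)[of 0 "0 # ys" xs] linear_times] by (simp add: o_def)
    ultimately show ?thesis
      by (simp add: 0 wedge_contract_Cons linear_compose_add wedge_contract_linear_family)
  next
    case (Suc k)
    have 1: "linear (\<lambda>v. iota u T (xs[i := v]) ys)" if "i < length xs" for xs ys i
      using Cons.prems(1)[of "Suc i" "u # xs" ys] that by (simp add: iota_def)
    have 2: "linear (\<lambda>v. (-1) ^ length (xs[i := v]) * T (xs[i := v]) (u # ys))"
      if "i < length xs" for xs ys i
      using linear_compose[OF Cons.prems(1)[OF that, of "u # ys"] linear_times] by (simp add: o_def)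
    have 3: "linear (\<lambda>v. (-1) ^ length xs * T xs (u # ys[i := v]))" if "i < length ys" for xs ys i
      using linear_compose[OF Cons.prems(2)[of "Suc i" "u # ys" xs] linear_times] that
      by (simp add: o_def)
    show ?thesis
      unfolding Suc list_update.simps nat.case wedge_contract_Cons
      by (intro linear_compose_add Cons.IH)
         (use 1 2 3 Cons.prems Suc in \<open>auto simp: iota_def\<close>)
  qed
qed simp

text \<open>If the first two arguments are equal, the mixed terms of the iterated Leibniz rule cancel.
  Otherwise a repetition that involves the first argument is moved by one place, where the induction
  hypothesis applies to the rest of the list.\<close>

lemma wedge_contract_distinct:
  fixes T :: "'a::real_vector tform"
  assumes "\<And>xs ys i. i < length xs \<Longrightarrow> linear (\<lambda>v. T (xs[i := v]) ys)"
    and "\<And>xs ys i. i < length ys \<Longrightarrow> linear (\<lambda>v. T xs (ys[i := v]))"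
    and "\<And>xs ys. \<not> distinct xs \<or> \<not> distinct ys \<Longrightarrow> T xs ys = 0"
    and "\<not> distinct us"
  shows "wedge_contract T us = 0"
  using assms
proof (induction "length us" arbitrary: T us rule: less_induct)
  case less
  note lin1 = less.prems(1) and lin2 = less.prems(2) and alt = less.prems(3)
  obtain u us' where us: "us = u # us'" using less.prems(4) by (cases us) auto
  have rest: "wedge_contract T (w # ws) = 0" if "\<not> distinct ws" "length ws < length us" for w ws
  proof -
    have 1: "linear (\<lambda>v. iota w T (xs[i := v]) ys)" if "i < length xs" for xs ys i
      using lin1[of "Suc i" "w # xs" ys] that by (simp add: iota_def)
    have 2: "linear (\<lambda>v. (-1) ^ length (xs[i := v]) * T (xs[i := v]) (w # ys))"
      if "i < length xs" for xs ys i
      using linear_compose[OF lin1[OF that, of "w # ys"] linear_times] by (simp add: o_def)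
    have 3: "linear (\<lambda>v. (-1) ^ length xs * T xs (w # ys[i := v]))" if "i < length ys" for xs ys i
      using linear_compose[OF lin2[of "Suc i" "w # ys" xs] linear_times] that by (simp add: o_def)
    have "wedge_contract (iota w T) ws = 0"
      by (rule less.hyps) (use that 1 lin2 alt in \<open>auto simp: iota_def\<close>)
    moreover have "wedge_contract (\<lambda>xs ys. (-1) ^ length xs * T xs (w # ys)) ws = 0"
      by (rule less.hyps) (use that 2 3 alt in \<open>auto\<close>)
    ultimately show ?thesis by (simp add: wedge_contract_Cons)
  qed
  have sq: "wedge_contract T (w # w # ws) = 0" for w ws
  proof -
    have a: "iota w (iota w T) = (\<lambda>xs ys. 0)"
      by (intro ext) (simp add: iota_def alt)
    have b: "iota w (\<lambda>xs ys. (-1) ^ length xs * T xs (w # ys)) =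
        (\<lambda>xs ys. (-1) * ((-1) ^ length xs * iota w T xs (w # ys)))"
      by (auto simp: iota_def)
    have c: "(\<lambda>xs ys. (-1) ^ length xs * ((-1) ^ length xs * T xs (w # w # ys))) = (\<lambda>xs ys. 0)"
      by (auto simp: alt)
    show ?thesis
      by (simp only: wedge_contract_Cons a b c wedge_contract_scale wedge_contract_zero mult_zero_right add_0)
  qed
  show ?case
  proof (cases "distinct us'")
    case False
    then show ?thesis using rest[of us' u] us by simp
  next
    case True
    then obtain w ws where us': "us' = w # ws" using less.prems(4) us by (cases us') auto
    have "linear (\<lambda>a. wedge_contract T (a # b # ws))" for b
      using wedge_contract_multilinear[of T 0 "0 # b # ws"] lin1 lin2 by simp
    moreover have "linear (\<lambda>b. wedge_contract T (a # b # ws))" for a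
      using wedge_contract_multilinear[of T 1 "a # 0 # ws"] lin1 lin2 by simp
    ultimately have "wedge_contract T (u # w # ws) = - wedge_contract T (w # u # ws)"
      by (rule swap_of_linear_diagonal[where g="\<lambda>a b. wedge_contract T (a # b # ws)"]) (rule sq)
    moreover have "w = u \<or> u \<in> set ws" using True less.prems(4) us us' by auto
    ultimately show ?thesis
      using sq rest[of "u # ws" w] us us' by auto
  qed
qed

lemma wedge_contract_alt:
  fixes T :: "'a::real_vector tform"
  assumes "\<And>ys. (\<lambda>xs. T xs ys) \<in> alt_forms p" "\<And>xs. T xs \<in> alt_forms q"
  shows "wedge_contract T \<in> alt_forms (p + q)"
proof -
  note lin = alt_forms_linear[OF assms(1)] alt_forms_linear[OF assms(2)]
  show ?thesis
  proof (rule alt_formsI)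
    fix us :: "'a list" assume "length us \<noteq> p + q"
    then show "wedge_contract T us = 0"
      using alt_forms_length[OF assms(1)] alt_forms_length[OF assms(2)]
      by (intro wedge_contract_length[of p q]) auto
  next
    fix us :: "'a list" and i assume "length us = p + q" "i < p + q"
    then show "linear (\<lambda>v. wedge_contract T (us[i := v]))"
      by (intro wedge_contract_multilinear lin) auto
  next
    fix us :: "'a list" assume "\<not> distinct us"
    then show "wedge_contract T us = 0"
      using alt_forms_distinct[OF assms(1)] alt_forms_distinct[OF assms(2)]
      by (intro wedge_contract_distinct lin) auto
  qed
qed

lemma wedge_alt:
  fixes \<alpha> \<beta> :: "'a::real_vector form"
  assumes "\<alpha> \<in> alt_forms p" "\<beta> \<in> alt_forms q"
  shows "wedge \<alpha> \<beta> \<in> alt_forms (p + q)"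
  unfolding wedge_def
proof (rule wedge_contract_alt)
  show "(\<lambda>xs. \<alpha> xs * \<beta> ys) \<in> alt_forms p" for ys
    using alt_forms_mult[OF assms(1), of "\<beta> ys"] by (simp add: mult.commute)
qed (rule alt_forms_mult[OF assms(2)])

lemma wedge_Nil: "wedge \<alpha> \<beta> [] = \<alpha> [] * \<beta> []"
  by (simp add: wedge_def wedge_contract_Nil)

text \<open>The sign of \<open>wedge_contract_Cons\<close> depends on the number of arguments of the first factor, which is
  \<open>p\<close> wherever \<open>\<alpha>\<close> does not vanish.\<close>

lemma wedge_Cons:
  assumes "\<alpha> \<in> alt_forms p"
  shows "wedge \<alpha> \<beta> (v # us) = wedge (iota v \<alpha>) \<beta> us + (-1) ^ p * wedge \<alpha> (iota v \<beta>) us"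
proof -
  have 1: "(\<lambda>xs ys. (-1) ^ length xs * (\<alpha> xs * \<beta> (v # ys))) =
      (\<lambda>xs ys. (-1) ^ p * (\<alpha> xs * iota v \<beta> ys))"
  proof (intro ext)
    fix xs ys
    show "(-1) ^ length xs * (\<alpha> xs * \<beta> (v # ys)) = (-1) ^ p * (\<alpha> xs * iota v \<beta> ys)"
      by (cases "length xs = p") (simp_all add: iota_def alt_forms_length[OF assms])
  qed
  have 2: "iota v (\<lambda>xs ys. \<alpha> xs * \<beta> ys) = (\<lambda>xs ys. iota v \<alpha> xs * \<beta> ys)"
    by (simp add: iota_def)
  show ?thesis
    by (simp only: wedge_def wedge_contract_Cons 1 2 wedge_contract_scale)
qed

text \<open>Both sides satisfy the same Leibniz recursion.\<close>

lemma wedge_commute: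
  fixes \<alpha> \<beta> :: "'a::real_vector form"
  assumes "\<alpha> \<in> alt_forms p" "\<beta> \<in> alt_forms q"
  shows "wedge \<alpha> \<beta> us = (-1) ^ (p * q) * wedge \<beta> \<alpha> us"
  using assms
proof (induction us arbitrary: \<alpha> \<beta> p q)
  case Nil
  show ?case
    using alt_forms_length[OF Nil(1), of "[]"] by (cases p) (auto simp: wedge_Nil mult.commute)
next
  case (Cons v us)
  have 1: "wedge (iota v \<alpha>) \<beta> us = (-1) ^ (p * q) * ((-1) ^ q * wedge \<beta> (iota v \<alpha>) us)"
  proof (cases p)
    case 0
    then have "iota v \<alpha> = (\<lambda>_. 0)" using Cons.prems by (auto simp: iota_def alt_forms_Cons_zero)
    then show ?thesis by (simp add: wedge_zero)
  next
    case (Suc k)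
    then show ?thesis
      using Cons.IH[OF alt_forms_iota[OF Cons.prems(1)] Cons.prems(2)]
      by (simp add: power_add)
  qed
  have 2: "(-1) ^ p * wedge \<alpha> (iota v \<beta>) us = (-1) ^ (p * q) * wedge (iota v \<beta>) \<alpha> us"
  proof (cases q)
    case 0
    then have "iota v \<beta> = (\<lambda>_. 0)" using Cons.prems by (auto simp: iota_def alt_forms_Cons_zero)
    then show ?thesis by (simp add: wedge_zero)
  next
    case (Suc k)
    then show ?thesis
      using Cons.IH[OF Cons.prems(1) alt_forms_iota[OF Cons.prems(2)]]
      by (simp add: power_add)
  qed
  show ?case
    unfolding wedge_Cons[OF Cons.prems(1)] wedge_Cons[OF Cons.prems(2)] 1 2
    by (simp add: algebra_simps)
qed

section \<open>The function-linear parts of the brackets\<close>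

lemma linear_basis_expand:
  fixes f :: "'a::euclidean_space \<Rightarrow> 'b::real_vector"
  assumes "linear f"
  shows "(\<Sum>i\<in>Basis. (w \<bullet> i) *\<^sub>R f i) = f w"
  using linear_sum[OF assms, of "\<lambda>i. (w \<bullet> i) *\<^sub>R i" Basis] linear_scale[OF assms]
  by (simp add: euclidean_representation)

lemma linear_basis_expand_real:
  fixes f :: "'a::euclidean_space \<Rightarrow> real"
  assumes "linear f"
  shows "(\<Sum>i\<in>Basis. (w \<bullet> i) * f i) = f w"
  using linear_basis_expand[OF assms] by simp

text \<open>For \<open>G j = iota j \<beta>\<close> this is the insertion \<open>\<Sum>j. A\<^sup>j \<and> \<iota>\<^sub>j \<beta>\<close> of \<open>A\<close> into \<open>\<beta>\<close>. The
  function-linear terms of the brackets have this form, where \<open>G\<close> depends linearly on \<open>j\<close>.\<close>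

definition insertion :: "'a::euclidean_space vform \<Rightarrow> ('a \<Rightarrow> 'a form) \<Rightarrow> 'a form" where
  "insertion A G us = (\<Sum>j\<in>Basis. wedge (vcomp j A) (G j) us)"

lemma insertion_scale: "insertion A (\<lambda>j ws. c * G j ws) us = c * insertion A G us"
  by (simp add: insertion_def wedge_scale_right sum_distrib_left)

lemma insertion_minus: "insertion A (\<lambda>j ws. - G j ws) us = - insertion A G us"
  by (simp add: insertion_def wedge_minus_right sum_negf)

lemma insertion_diff: "insertion A (\<lambda>j ws. G j ws - H j ws) us = insertion A G us - insertion A H us"
  by (simp add: insertion_def wedge_diff_right sum_subtractf)

lemma insertion_minus_left: "insertion (\<lambda>us. - A us) G us = - insertion A G us"
  by (simp add: insertion_def vcomp_def wedge_minus_left sum_negf)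

lemma insertion_zero_left: "insertion (\<lambda>_. 0) G us = 0"
  by (simp add: insertion_def vcomp_def wedge_zero)

lemma insertion_zero_right: "insertion A (\<lambda>_ _. 0) us = 0"
  by (simp add: insertion_def wedge_zero)

lemma insertion_Cons:
  assumes "A \<in> alt_forms p"
  shows "insertion A G (v # us) = insertion (iota v A) G us + (-1) ^ p * insertion A (\<lambda>j. iota v (G j)) us"
proof -
  have "vcomp j (iota v A) = iota v (vcomp j A)" for j
    by (simp add: vcomp_def iota_def)
  then show ?thesis
    by (simp add: insertion_def wedge_Cons[OF alt_forms_vcomp[OF assms]] sum.distrib sum_distrib_left)
qed

lemma wedge_degree_0:
  assumes "\<alpha> \<in> alt_forms 0"
  shows "wedge \<alpha> \<beta> us = \<alpha> [] * \<beta> us"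
proof (induction us arbitrary: \<beta>)
  case (Cons v us)
  have "iota v \<alpha> = (\<lambda>_. 0)" using assms by (auto simp: iota_def alt_forms_Cons_zero)
  then show ?case by (simp add: wedge_Cons[OF assms] wedge_zero Cons.IH) (simp add: iota_def)
qed (simp add: wedge_Nil)

lemma insertion_degree_0:
  assumes "A \<in> alt_forms 0" "linear (\<lambda>j. G j us)"
  shows "insertion A G us = G (A []) us"
  using linear_basis_expand_real[OF assms(2), of "A []"]
  by (simp add: insertion_def wedge_degree_0[OF alt_forms_vcomp[OF assms(1)]]) (simp add: vcomp_def)

text \<open>The sum is \<open>\<Sum>j k. \<omega> j k P\<^sup>k \<and> Q\<^sup>j\<close>, and \<open>\<omega>\<close> is skew.\<close>

lemma insertion_antisymmetric:
  assumes "bilinear \<omega>" "\<And>v. \<omega> v v = 0"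
    and P: "P \<in> alt_forms a" and Q: "Q \<in> alt_forms b"
  shows "insertion P (\<lambda>k ws. \<omega> (Q ws) k) us = - ((-1) ^ (a * b) * insertion Q (\<lambda>k ws. \<omega> (P ws) k) us)"
proof -
  have lin: "linear (\<lambda>v. \<omega> v w)" "linear (\<omega> w)" for w
    using assms(1) by (auto simp: bilinear_def)
  have omega_swap: "\<omega> u v = - \<omega> v u" for u v
    by (rule swap_of_linear_diagonal) (use lin assms(2) in auto)
  have expand: "insertion P (\<lambda>k ws. \<omega> (Q ws) k) us =
      (\<Sum>k\<in>Basis. \<Sum>j\<in>Basis. \<omega> j k * wedge (vcomp k P) (vcomp j Q) us)" for P Q
  proof -
    have "\<omega> (Q ws) k = (\<Sum>j\<in>Basis. \<omega> j k * vcomp j Q ws)" for ws k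
    proof -
      have "linear (\<lambda>v. \<omega> v k)" by (rule lin(1))
      from linear_basis_expand_real[OF this, of "Q ws"] show ?thesis
        by (simp add: vcomp_def mult.commute)
    qed
    then show ?thesis
      by (simp add: insertion_def wedge_sum_right wedge_scale_right)
  qed
  have "\<omega> j k * wedge (vcomp k P) (vcomp j Q) us =
      - ((-1) ^ (a * b) * (\<omega> k j * wedge (vcomp j Q) (vcomp k P) us))" for j k
    using wedge_commute[OF alt_forms_vcomp[OF P, of k] alt_forms_vcomp[OF Q, of j], of us] omega_swap[of j k]
    by simp
  then have "insertion P (\<lambda>k ws. \<omega> (Q ws) k) us =
      (\<Sum>k\<in>Basis. \<Sum>j\<in>Basis. - ((-1) ^ (a * b) * (\<omega> k j * wedge (vcomp j Q) (vcomp k P) us)))"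
    unfolding expand by simp
  also have "\<dots> = - ((-1) ^ (a * b) * insertion Q (\<lambda>k ws. \<omega> (P ws) k) us)"
    unfolding expand by (subst sum.swap) (simp add: sum_negf sum_distrib_left)
  finally show ?thesis .
qed

lemma alt_tforms_left: "T \<in> alt_tforms p \<Longrightarrow> (\<lambda>us. T us vs) \<in> alt_forms p"
  and alt_tforms_right: "T \<in> alt_tforms p \<Longrightarrow> T us \<in> alt_forms 2"
  by (simp_all add: alt_tforms_def)

text \<open>Tensor-valued forms are compared componentwise below: for fixed \<open>u\<close> and \<open>v\<close>, the function
  \<open>\<lambda>us. T us [u, v]\<close> is a scalar form, and the wedge products with the \<open>e\<^sup>i\<close> disappear.\<close>

lemma tform_eqI:
  fixes S T :: "'a::real_vector tform"
  assumes "\<And>us. S us \<in> alt_forms 2" "\<And>us. T us \<in> alt_forms 2"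
    and "\<And>us u v. S us [u, v] = T us [u, v]"
  shows "S = T"
proof (intro ext)
  fix us vs
  show "S us vs = T us vs"
  proof (cases "length vs = 2")
    case True
    then obtain u v where "vs = [u, v]" by (auto simp: numeral_2_eq_2 length_Suc_conv)
    then show ?thesis using assms(3) by simp
  next
    case False
    then show ?thesis
      using alt_forms_length[OF assms(1)] alt_forms_length[OF assms(2)] by simp
  qed
qed

lemma one_form_alt: "linear f \<Longrightarrow> one_form f \<in> alt_forms 1"
proof (rule alt_formsI)
  fix us :: "'a list" and i :: nat assume "linear f" "length us = 1" "i < 1"
  then show "linear (\<lambda>v. one_form f (us[i := v]))"
    by (auto simp: length_Suc_conv one_form_def)
qed (auto simp: one_form_def length_Suc_conv split: list.splits)

lemma wedge_one_form_pair: "wedge (one_form f) \<sigma> [u, v] = f u * \<sigma> [v] - f v * \<sigma> [u]"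
  by (simp add: wedge_def wedge_contract_Cons wedge_contract_Nil iota_def one_form_def)

lemma alt_forms_wedge_parameter:
  fixes \<alpha> :: "'a::real_vector form"
  assumes "\<And>ws. S ws \<in> alt_forms q"
  shows "(\<lambda>vs. wedge \<alpha> (\<lambda>ws. S ws vs) us) \<in> alt_forms q"
  unfolding wedge_def wedge_contract_def
  by (intro alt_forms_sum alt_forms_mult assms)

text \<open>The part of the bracket that is linear over functions and hence defined at each point. The bracket
  of sections differs from it by the anchor term.\<close>

definition alg_bracket_VT :: "nat \<Rightarrow> 'a::euclidean_space vform \<Rightarrow> 'a tform \<Rightarrow> 'a tform" where
  "alg_bracket_VT p A T us vs = (\<Sum>j\<in>Basis. (-1) ^ (p + 1) * wedge (vcomp j A) (\<lambda>ws. iota j T ws vs) us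
     + (\<Sum>i\<in>Basis. wedge (one_form (\<lambda>v. i \<bullet> v))
          (\<lambda>zs. wedge (iota i (vcomp j A)) (\<lambda>ws. iota j (T ws) zs) us) vs))"

definition alg_bracket_VV :: "nat \<Rightarrow> nat \<Rightarrow> 'a::euclidean_space vform \<Rightarrow> 'a vform \<Rightarrow> 'a vform" where
  "alg_bracket_VV p q A B us = (\<Sum>i\<in>Basis. \<Sum>j\<in>Basis. wedge (vcomp i A) (iota i (vcomp j B)) us *\<^sub>R j
     - (-1) ^ ((p + 1) * (q + 1)) *\<^sub>R wedge (vcomp j B) (iota j (vcomp i A)) us *\<^sub>R i)"

lemma linear_inner_left: "linear (\<lambda>v::'a::real_inner. i \<bullet> v)"
  by (auto intro!: linearI simp: inner_right_distrib)

lemma alg_bracket_VT_alt: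
  assumes "A \<in> alt_forms p" "T \<in> alt_tforms q" "p \<ge> 1"
  shows "alg_bracket_VT p A T \<in> alt_tforms (p + q - 1)"
proof -
  note T = alt_tforms_left[OF assms(2)] alt_tforms_right[OF assms(2)]
  have iT: "(\<lambda>ws. iota j T ws vs) \<in> alt_forms (q - 1)" for j vs
  proof -
    have "iota j (\<lambda>ws. T ws vs) \<in> alt_forms (q - 1)" by (rule alt_forms_iota[OF T(1)])
    then show ?thesis by (simp add: iota_def)
  qed
  have w1: "wedge (vcomp j A) (\<lambda>ws. iota j T ws vs) \<in> alt_forms (p + q - 1)" for j vs
  proof (cases q)
    case 0
    then have "(\<lambda>ws. iota j T ws vs) = (\<lambda>_. 0)"
      using assms(2) by (auto simp: iota_def alt_tforms_def alt_forms_def)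
    then show ?thesis by (simp add: wedge_zero alt_forms_zero wedge_zero(2)[abs_def])
  next
    case (Suc k)
    then show ?thesis
      using wedge_alt[OF alt_forms_vcomp[OF assms(1)] iT] by simp
  qed
  have w2: "wedge (iota i (vcomp j A)) (\<lambda>ws. iota j (T ws) zs) \<in> alt_forms (p + q - 1)" for i j zs
    using wedge_alt[OF alt_forms_iota[OF alt_forms_vcomp[OF assms(1), of j], of i] T(1)[of "j # zs"]] assms(3)
    by (simp add: iota_def)
  have w3: "(\<lambda>us. wedge \<alpha> (\<lambda>zs. wedge (iota i (vcomp j A)) (\<lambda>ws. iota j (T ws) zs) us) vs)
      \<in> alt_forms (p + q - 1)" for \<alpha> i j vs
    unfolding wedge_def[of \<alpha>] wedge_contract_def
    by (intro alt_forms_sum alt_forms_mult w2)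
  have w4: "wedge (one_form ((\<bullet>) i)) (\<lambda>zs. wedge (iota i (vcomp j A)) (\<lambda>ws. iota j (T ws) zs) us)
      \<in> alt_forms 2" for i j us
    using wedge_alt[OF one_form_alt[OF linear_inner_left]
        alt_forms_wedge_parameter[OF alt_forms_iota[OF T(2)]]]
    by (simp add: numeral_2_eq_2)
  have w5: "(\<lambda>vs. wedge (vcomp j A) (\<lambda>ws. iota j T ws vs) us) \<in> alt_forms 2" for j us
    by (rule alt_forms_wedge_parameter) (simp add: iota_def T)
  show ?thesis
    unfolding alt_tforms_def alg_bracket_VT_def[abs_def] mem_Collect_eq
    by (intro conjI allI alt_forms_sum alt_forms_add alt_forms_mult w1 w3 w4 w5)
qed

lemma alg_bracket_VV_alt:
  assumes "A \<in> alt_forms p" "B \<in> alt_forms q" "p \<ge> 1" "q \<ge> 1"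
  shows "alg_bracket_VV p q A B \<in> alt_forms (p + q - 1)"
proof -
  have 1: "wedge (vcomp i A) (iota i (vcomp j B)) \<in> alt_forms (p + q - 1)" for i j
    using wedge_alt[OF alt_forms_vcomp[OF assms(1), of i] alt_forms_iota[OF alt_forms_vcomp[OF assms(2), of j], of i]]
      assms(4) by simp
  have 2: "wedge (vcomp j B) (iota j (vcomp i A)) \<in> alt_forms (p + q - 1)" for i j
    using wedge_alt[OF alt_forms_vcomp[OF assms(2), of j] alt_forms_iota[OF alt_forms_vcomp[OF assms(1), of i], of j]]
      assms(3) by (simp add: add.commute)
  show ?thesis
    unfolding alg_bracket_VV_def[abs_def]
    by (intro alt_forms_sum alt_forms_diff alt_forms_scale alt_forms_scaleR_right 1 2)
qed

text \<open>Summing \<open>e\<^sup>i \<and> \<iota>\<^sub>v\<close> over the basis replaces \<open>\<iota>\<^sub>i A\<close> by the contractions of \<open>A\<close> with the two tensor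
  arguments.\<close>

lemma alg_bracket_VT_pair:
  assumes "A \<in> alt_forms p"
  shows "alg_bracket_VT p A T us [u, v] = (-1) ^ (p + 1) * insertion A (\<lambda>j ws. T (j # ws) [u, v]) us
     + insertion (iota u A) (\<lambda>j ws. T ws [j, v]) us - insertion (iota v A) (\<lambda>j ws. T ws [j, u]) us"
proof -
  have e: "(\<Sum>i\<in>Basis. (i \<bullet> w) * wedge (iota i (vcomp j A)) \<beta> us) = wedge (vcomp j (iota w A)) \<beta> us"
    for w j \<beta>
  proof -
    have "vcomp j (iota w A) = (\<lambda>us. \<Sum>i\<in>Basis. (i \<bullet> w) * iota i (vcomp j A) us)"
      using iota_expand[OF alt_forms_vcomp[OF assms], of w j]
      by (simp add: iota_def vcomp_def inner_commute)
    then show ?thesis by (simp only: wedge_sum_left wedge_scale_left)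
  qed
  show ?thesis
    unfolding alg_bracket_VT_def wedge_one_form_pair
    by (simp add: sum.distrib sum_subtractf e insertion_def sum_distrib_left iota_def[of _ T] iota_def[of _ "T _"] sum_negf)
qed

text \<open>Composing with a linear functional reduces identities between \<open>V\<close>-valued forms to scalar ones.
  Below, the functional is a coordinate or \<open>\<omega>(\<cdot>, v)\<close>.\<close>

lemma linear_alg_bracket_VV:
  fixes l :: "'a::euclidean_space \<Rightarrow> real"
  assumes l: "linear l"
  shows "l (alg_bracket_VV p q A B us) = insertion A (\<lambda>j ws. l (B (j # ws))) us
     - (-1) ^ ((p + 1) * (q + 1)) * insertion B (\<lambda>j ws. l (A (j # ws))) us"
proof -
  have e: "(\<Sum>j\<in>Basis. wedge \<alpha> (iota i (vcomp j B)) us * l j) = wedge \<alpha> (\<lambda>ws. l (B (i # ws))) us"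
    for \<alpha> i B
  proof -
    have "(\<lambda>ws. l (B (i # ws))) = (\<lambda>ws. \<Sum>j\<in>Basis. l j * iota i (vcomp j B) ws)"
      using linear_basis_expand_real[OF l] by (simp add: iota_def vcomp_def mult.commute)
    then show ?thesis by (simp add: wedge_sum_right wedge_scale_right mult.commute)
  qed
  define s :: real where "s = (-1) ^ ((p + 1) * (q + 1))"
  have "l (alg_bracket_VV p q A B us) = (\<Sum>i\<in>Basis. \<Sum>j\<in>Basis. wedge (vcomp i A) (iota i (vcomp j B)) us * l j)
      - s * (\<Sum>i\<in>Basis. \<Sum>j\<in>Basis. wedge (vcomp j B) (iota j (vcomp i A)) us * l i)"
    unfolding alg_bracket_VV_def s_def[symmetric]
    by (simp add: linear_sum[OF l] linear_diff[OF l] linear_scale[OF l] sum_subtractf sum_distrib_left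
        mult.assoc)
  also have "(\<Sum>i\<in>Basis. \<Sum>j\<in>Basis. wedge (vcomp j B) (iota j (vcomp i A)) us * l i)
      = (\<Sum>j\<in>Basis. \<Sum>i\<in>Basis. wedge (vcomp j B) (iota j (vcomp i A)) us * l i)"
    by (rule sum.swap)
  finally show ?thesis by (simp only: e insertion_def s_def)
qed

text \<open>Contractions graded-commute with the action of \<open>A\<close> up to the action of the contraction of \<open>A\<close>. With
  \<open>x\<close> the point of \<open>V\<close>, this is the compatibility of the bracket with \<open>\<partial>\<close> and \<open>d\<close>.\<close>

lemma alg_bracket_VT_Cons:
  assumes A: "A \<in> alt_forms p" and T: "T \<in> alt_tforms q" and "p \<ge> 1"
  shows "alg_bracket_VT p A T (x # us) [u, v] =
    (-1) ^ (p + 1) * alg_bracket_VT p A (iota x T) us [u, v] - alg_bracket_VT (p - 1) (iota x A) T us [u, v]"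
proof -
  have swap: "iota x (iota w A) = (\<lambda>us. - iota w (iota x A) us)" for w
    by (intro ext) (simp only: iota_def, rule alt_forms_swap[OF A])
  have T2: "iota x (\<lambda>ws. T (j # ws) vs) = (\<lambda>ws. - iota x T (j # ws) vs)" for j vs
    by (intro ext) (simp only: iota_def, rule alt_forms_swap[OF alt_tforms_left[OF T]])
  have T1: "iota x (\<lambda>ws. T ws vs) = (\<lambda>ws. iota x T ws vs)" for vs
    by (auto simp: iota_def)
  obtain k where p: "p = Suc k" using assms(3) by (cases p) auto
  have ia: "iota x A \<in> alt_forms k" "\<And>w. iota w A \<in> alt_forms k"
    using alt_forms_iota[OF A] p by auto
  show ?thesis
    unfolding p diff_Suc_1 alg_bracket_VT_pair[OF A[unfolded p]] alg_bracket_VT_pair[OF ia(1)]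
      insertion_Cons[OF A[unfolded p]] insertion_Cons[OF ia(2)] T1 T2 swap insertion_minus insertion_minus_left
    by (simp add: algebra_simps)
qed

section \<open>The map phi and the Koszul maps\<close>

lemma phi_pair:
  assumes "bilinear \<omega>" "A \<in> alt_forms p"
  shows "phi \<omega> p A us [u, v] = (-1) ^ (p - 1) * (\<omega> (A (u # us)) v - \<omega> (A (v # us)) u)"
proof -
  have "linear (\<lambda>a. \<omega> (A (a # us)) w)" for w
    using linear_compose[OF alt_forms_linear_hd[OF assms(2)], of "\<lambda>a. \<omega> a w"] assms(1)
    by (simp add: bilinear_def o_def)
  then have "(\<Sum>i\<in>Basis. (i \<bullet> a) * \<omega> (A (i # us)) w) = \<omega> (A (a # us)) w" for a w
    using linear_basis_expand_real[of "\<lambda>a. \<omega> (A (a # us)) w" a] by (simp add: inner_commute)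
  then show ?thesis
    by (simp add: phi_def wedge_one_forms iota_def sum_subtractf)
qed

lemma phi_alt:
  assumes "bilinear \<omega>" "A \<in> alt_forms p"
  shows "phi \<omega> p A \<in> alt_tforms (p - 1)"
proof -
  have lin: "linear (\<omega> w)" "linear (\<lambda>v. \<omega> v w)" for w using assms(1) by (auto simp: bilinear_def)
  have 1: "wedge (one_form ((\<bullet>) i)) (one_form (\<omega> w)) \<in> alt_forms 2" for i w
    using wedge_alt[OF one_form_alt[OF linear_inner_left] one_form_alt[OF lin(1)]]
    by (simp add: numeral_2_eq_2)
  have 2: "(\<lambda>us. wedge \<alpha> (one_form (\<omega> (iota i A us))) vs) \<in> alt_forms (p - 1)" for \<alpha> i vs
    unfolding wedge_def wedge_contract_def
  proof (intro alt_forms_sum alt_forms_mult)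
    fix I
    let ?ys = "nths vs (- I)"
    have "(\<lambda>us. \<omega> (iota i A us) w) \<in> alt_forms (p - 1)" for w
      by (rule alt_forms_compose_linear[OF lin(2) alt_forms_iota[OF assms(2)]])
    then show "(\<lambda>us. one_form (\<omega> (iota i A us)) ?ys) \<in> alt_forms (p - 1)"
    proof (cases "\<exists>w. ?ys = [w]")
      case False
      then have "(\<lambda>us. one_form (\<omega> (iota i A us)) ?ys) = (\<lambda>_. 0)"
        by (auto simp: one_form_def split: list.splits)
      then show ?thesis by (simp add: alt_forms_zero)
    qed (auto simp: one_form_def)
  qed
  show ?thesis
    unfolding alt_tforms_def phi_def mem_Collect_eq
    by (intro conjI allI alt_forms_mult alt_forms_sum 1 2)
qed

text \<open>In components \<open>\<phi> B\<close> is, up to sign, the skew part of \<open>\<iota>\<^sub>u B\<^sub>v\<close> for \<open>B\<^sub>v = \<omega>(B, v)\<close>. The terms in which both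
  \<open>A\<close> and \<open>B\<close> are contracted with a tensor argument and which have no counterpart on the left cancel by
  \<open>insertion_antisymmetric\<close>; the remaining ones are the Leibniz expansion of the left-hand side.\<close>

lemma phi_alg_bracket_VV:
  assumes \<omega>: "bilinear \<omega>" "\<And>v. \<omega> v v = 0"
    and A: "A \<in> alt_forms p" and B: "B \<in> alt_forms q" and "p \<ge> 1" "q \<ge> 1"
  shows "phi \<omega> (p + q - 1) (alg_bracket_VV p q A B) us [u, v] =
    (-1) ^ (p + 1) * alg_bracket_VT p A (phi \<omega> q B) us [u, v]
    - (-1) ^ (p * (q + 1)) * alg_bracket_VT q B (phi \<omega> p A) us [u, v]"
proof -
  obtain k l where p: "p = Suc k" and q: "q = Suc l" using assms(5,6) by (cases p; cases q) auto
  have lin: "linear (\<lambda>v. \<omega> v w)" for w using \<omega>(1) by (auto simp: bilinear_def)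
  have iA: "iota w A \<in> alt_forms k" and iB: "iota w B \<in> alt_forms l" for w
    using alt_forms_iota[OF A] alt_forms_iota[OF B] p q by auto
  have sg: "(-1) ^ ((p + 1) * (q + 1)) = ((-1) ^ (k * l) :: real)" "(-1) ^ p = - ((-1) ^ k :: real)"
    "(-1) ^ q = - ((-1) ^ l :: real)" by (simp_all add: p q minus_one_power_iff)
  \<comment> \<open>\<open>FA a b\<close> is \<open>\<iota>\<^sub>a A\<^sub>b\<close>, where \<open>A\<^sub>b = \<omega>(A, b)\<close>.\<close>
  define FA FB where "FA = (\<lambda>a b us. \<omega> (A (a # us)) b)" and "FB = (\<lambda>a b us. \<omega> (B (a # us)) b)"
  have FA: "iota w (\<lambda>ws. \<omega> (A (j # ws)) v) = (\<lambda>ws. - iota j (FA w v) ws)" for j v w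
    by (intro ext)
      (simp only: iota_def FA_def alt_forms_swap[OF A, of w j] linear_neg[OF lin])
  have FB: "iota w (\<lambda>ws. \<omega> (B (j # ws)) v) = (\<lambda>ws. - iota j (FB w v) ws)" for j v w
    by (intro ext)
      (simp only: iota_def FB_def alt_forms_swap[OF B, of w j] linear_neg[OF lin])
  \<comment> \<open>The Leibniz expansion of \<open>\<iota>\<^sub>a [A, B]\<^sub>b\<close>. The signs of \<open>FA\<close> and \<open>FB\<close> come from exchanging two contractions.\<close>
  have L: "\<omega> (alg_bracket_VV p q A B (a # us)) b = insertion (iota a A) (\<lambda>j. FB j b) us
      + (-1) ^ k * insertion A (\<lambda>j. iota j (FB a b)) us
      - (-1) ^ (k * l) * (insertion (iota a B) (\<lambda>j. FA j b) us + (-1) ^ l * insertion B (\<lambda>j. iota j (FA a b)) us)"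
    for a b
    unfolding linear_alg_bracket_VV[OF lin] insertion_Cons[OF A] insertion_Cons[OF B] FA FB insertion_minus sg
    by (simp add: FA_def FB_def iota_def)
  have half: "alg_bracket_VT (Suc m) P (phi \<omega> (Suc n) Q) us [u, v] = (-1) ^ n * ((-1) ^ m *
        (insertion P (\<lambda>j ws. \<omega> (Q (u # j # ws)) v) us - insertion P (\<lambda>j ws. \<omega> (Q (v # j # ws)) u) us)
      + (insertion (iota u P) (\<lambda>j ws. \<omega> (Q (j # ws)) v) us - insertion (iota u P) (\<lambda>j ws. \<omega> (Q (v # ws)) j) us)
      - (insertion (iota v P) (\<lambda>j ws. \<omega> (Q (j # ws)) u) us - insertion (iota v P) (\<lambda>j ws. \<omega> (Q (u # ws)) j) us))"
    if P: "P \<in> alt_forms (Suc m)" and Q: "Q \<in> alt_forms (Suc n)" for P Q m n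
    unfolding alg_bracket_VT_pair[OF P] phi_pair[OF \<omega>(1) Q] insertion_scale insertion_diff
    by (simp add: algebra_simps)
  have cross: "insertion (iota a A) (\<lambda>j. FB b j) us = - ((-1) ^ (k * l) * insertion (iota b B) (\<lambda>j. FA a j) us)" for a b
    using insertion_antisymmetric[OF \<omega> iA iB, of a b us] by (simp add: FA_def FB_def iota_def)
  have RB: "alg_bracket_VT p A (phi \<omega> q B) us [u, v] = (-1) ^ l * ((-1) ^ k *
        (insertion A (\<lambda>j. iota j (FB u v)) us - insertion A (\<lambda>j. iota j (FB v u)) us)
      + (insertion (iota u A) (\<lambda>j. FB j v) us + (-1) ^ (k * l) * insertion (iota v B) (FA u) us)
      - (insertion (iota v A) (\<lambda>j. FB j u) us + (-1) ^ (k * l) * insertion (iota u B) (FA v) us))"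
    using half[OF A[unfolded p] B[unfolded q]] cross[of u v] cross[of v u]
    by (simp add: p q FB_def iota_def)
  have RA: "alg_bracket_VT q B (phi \<omega> p A) us [u, v] = (-1) ^ k * ((-1) ^ l *
        (insertion B (\<lambda>j. iota j (FA u v)) us - insertion B (\<lambda>j. iota j (FA v u)) us)
      + (insertion (iota u B) (\<lambda>j. FA j v) us - insertion (iota u B) (FA v) us)
      - (insertion (iota v B) (\<lambda>j. FA j u) us - insertion (iota v B) (FA u) us))"
    using half[OF B[unfolded q] A[unfolded p]]
    by (simp add: p q FA_def iota_def)
  have "alg_bracket_VV p q A B \<in> alt_forms (p + q - 1)" by (intro alg_bracket_VV_alt A B assms)
  from phi_pair[OF \<omega>(1) this] have PH: "phi \<omega> (p + q - 1) (alg_bracket_VV p q A B) us [u, v] =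
      (-1) ^ (k + l) * (\<omega> (alg_bracket_VV p q A B (u # us)) v - \<omega> (alg_bracket_VV p q A B (v # us)) u)"
    by (simp add: p q)
  show ?thesis
    unfolding PH L RA RB unfolding p q
    by (cases "even k"; cases "even l") (simp_all add: algebra_simps)
qed

lemma wedge_contract_right_degree_0:
  assumes "\<And>xs ys. ys \<noteq> [] \<Longrightarrow> T xs ys = 0"
  shows "wedge_contract T us = T us []"
  using assms
proof (induction us arbitrary: T)
  case (Cons v us)
  have "wedge_contract (iota v T) us = T (v # us) []"
    using Cons.IH[of "iota v T"] Cons.prems by (simp add: iota_def)
  moreover have "(\<lambda>xs ys. (-1) ^ length xs * T xs (v # ys)) = (\<lambda>xs ys. 0)"
    using Cons.prems by (intro ext) simp
  ultimately show ?case by (simp add: wedge_contract_Cons wedge_contract_zero)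
qed (simp add: wedge_contract_Nil)

text \<open>The composite of the comultiplication \<open>\<Lambda>\<^sup>k \<rightarrow> \<Lambda>\<^sup>k\<^sup>-\<^sup>1 \<otimes> \<Lambda>\<^sup>1\<close> with the product is \<open>k\<close> times the identity, up
  to sign: this is Euler's formula \<open>\<Sum>i. e\<^sup>i \<and> \<iota>\<^sub>i \<alpha> = k \<alpha>\<close>.\<close>

lemma wedge_contract_koszul_form:
  assumes "\<alpha> \<in> alt_forms k" "\<And>xs m. T xs [m] = \<alpha> (m # xs)"
    and "\<And>xs ys. length ys \<noteq> 1 \<Longrightarrow> T xs ys = 0"
  shows "wedge_contract T us = (-1) ^ (k + 1) * real k * \<alpha> us"
  using assms
proof (induction us arbitrary: T \<alpha> k)
  case Nil
  then show ?case
    using alt_forms_length[OF Nil(1), of "[]"] by (cases "k = 0") (auto simp: wedge_contract_Nil)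
next
  case (Cons v us)
  note \<alpha> = Cons.prems(1) and T1 = Cons.prems(2) and T0 = Cons.prems(3)
  show ?case
  proof (cases k)
    case 0
    have "T xs ys = 0" for xs ys
    proof (cases "length ys = 1")
      case True
      then obtain m where "ys = [m]" by (auto simp: length_Suc_conv)
      then show ?thesis using \<alpha> T1 0 by (simp add: alt_forms_Cons_zero)
    qed (rule T0)
    then have "T = (\<lambda>xs ys. 0)" by (intro ext)
    then show ?thesis using 0 by (simp add: wedge_contract_zero)
  next
    case (Suc l)
    have "(\<lambda>us. - iota v \<alpha> us) \<in> alt_forms l"
      using alt_forms_minus[OF alt_forms_iota[OF \<alpha>]] Suc by simp
    then have "wedge_contract (iota v T) us = (-1) ^ (l + 1) * real l * (- iota v \<alpha> us)"
    proof (rule Cons.IH)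
      show "iota v T xs [m] = - iota v \<alpha> (m # xs)" for xs m
        using alt_forms_swap[OF \<alpha>, of m v xs] by (simp add: iota_def T1)
    qed (simp add: iota_def T0)
    moreover have "wedge_contract (\<lambda>xs ys. (-1) ^ length xs * T xs (v # ys)) us = (-1) ^ l * iota v \<alpha> us"
    proof -
      have "wedge_contract (\<lambda>xs ys. (-1) ^ length xs * T xs (v # ys)) us = (-1) ^ length us * T us [v]"
        by (rule wedge_contract_right_degree_0) (simp add: T0)
      also have "\<dots> = (-1) ^ l * iota v \<alpha> us"
        using alt_forms_length[OF \<alpha>, of "v # us"] Suc
        by (cases "length us = l") (simp_all add: T1 iota_def)
      finally show ?thesis .
    qed
    ultimately show ?thesis by (simp add: wedge_contract_Cons Suc iota_def algebra_simps)
  qed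
qed

text \<open>The next case of the same principle, for the Koszul map \<open>\<Lambda>\<^sup>p \<otimes> \<Lambda>\<^sup>1 \<rightarrow> \<Lambda>\<^sup>p\<^sup>-\<^sup>1 \<otimes> \<Lambda>\<^sup>2\<close>: composed with the
  product it is \<open>\<plusminus>p\<close> times the product.\<close>

lemma wedge_contract_koszul_one_form:
  assumes "\<And>ys. (\<lambda>xs. G xs ys) \<in> alt_forms p" "\<And>xs ys. length ys \<noteq> 1 \<Longrightarrow> G xs ys = 0"
    and "\<And>xs l m. H xs [l, m] = G (l # xs) [m] - G (m # xs) [l]"
    and "\<And>xs ys. length ys \<noteq> 2 \<Longrightarrow> H xs ys = 0"
  shows "wedge_contract H us = (-1) ^ (p + 1) * real p * wedge_contract G us"
  using assms
proof (induction us arbitrary: G H p)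
  case Nil
  then show ?case by (simp add: wedge_contract_Nil)
next
  case (Cons v us)
  note G = Cons.prems(1) and G0 = Cons.prems(2) and H2 = Cons.prems(3) and H0 = Cons.prems(4)
  show ?case
  proof (cases p)
    case 0
    have "H xs ys = 0" for xs ys
    proof (cases "length ys = 2")
      case True
      then obtain l m where "ys = [l, m]" by (auto simp: numeral_2_eq_2 length_Suc_conv)
      then show ?thesis using alt_forms_Cons_zero[OF G[unfolded 0]] H2 by simp
    qed (rule H0)
    then have "H = (\<lambda>xs ys. 0)" by (intro ext)
    then show ?thesis using 0 by (simp add: wedge_contract_zero)
  next
    case (Suc k)
    let ?F = "\<lambda>xs ys. case ys of [m] \<Rightarrow> G (m # xs) [v] | _ \<Rightarrow> 0"
    have sign: "(-1) ^ length xs * G xs ys = (-1) ^ p * G xs ys" for xs ys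
      using alt_forms_length[OF G, of xs ys] by (cases "length xs = p") auto
    have iG: "(\<lambda>xs. - iota v G xs ys) \<in> alt_forms k" for ys
      using alt_forms_minus[OF alt_forms_iota[OF G, of v ys]] Suc by (simp add: iota_def)
    have "wedge_contract (iota v H) us = (-1) ^ (k + 1) * real k * wedge_contract (\<lambda>xs ys. - iota v G xs ys) us"
      using iG
    proof (rule Cons.IH)
      show "iota v H xs [l, m] = - iota v G (l # xs) [m] - - iota v G (m # xs) [l]" for xs l m
        using alt_forms_swap[OF G, of l v xs "[m]"] alt_forms_swap[OF G, of m v xs "[l]"]
        by (simp add: iota_def H2)
    qed (simp_all add: iota_def G0 H0)
    also have "wedge_contract (\<lambda>xs ys. - iota v G xs ys) us = - wedge_contract (iota v G) us"
      using wedge_contract_scale[of "-1" "iota v G" us] by simp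
    finally have 1: "wedge_contract (iota v H) us = (-1) ^ k * real k * wedge_contract (iota v G) us"
      by simp
    have F: "wedge_contract ?F us = (-1) ^ (p + 1) * real p * G us [v]"
      by (rule wedge_contract_koszul_form[OF G]) (auto split: list.splits)
    have "(\<lambda>xs ys. (-1) ^ length xs * H xs (v # ys)) = (\<lambda>xs ys. (-1) ^ k * (iota v G xs ys - ?F xs ys))"
    proof (intro ext)
      fix xs ys
      show "(-1) ^ length xs * H xs (v # ys) = (-1) ^ k * (iota v G xs ys - ?F xs ys)"
      proof (cases "length ys = 1")
        case True
        then obtain m where m: "ys = [m]" by (auto simp: length_Suc_conv)
        have "(-1) ^ length xs * H xs [v, m] =
            - ((-1) ^ length (v # xs) * G (v # xs) [m]) + (-1) ^ length (m # xs) * G (m # xs) [v]"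
          by (simp add: H2 algebra_simps)
        then show ?thesis unfolding m sign by (simp add: iota_def Suc algebra_simps)
      next
        case False
        then show ?thesis by (auto simp: H0 G0 iota_def split: list.splits)
      qed
    qed
    then have 2: "wedge_contract (\<lambda>xs ys. (-1) ^ length xs * H xs (v # ys)) us
        = (-1) ^ k * (wedge_contract (iota v G) us - wedge_contract ?F us)"
      by (simp only: wedge_contract_scale wedge_contract_diff)
    have 3: "wedge_contract (\<lambda>xs ys. (-1) ^ length xs * G xs (v # ys)) us = (-1) ^ p * G us [v]"
    proof -
      have "wedge_contract (\<lambda>xs ys. (-1) ^ length xs * G xs (v # ys)) us = (-1) ^ length us * G us [v]"
        by (rule wedge_contract_right_degree_0) (simp add: G0)
      then show ?thesis by (simp only: sign)
    qed
    show ?thesis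
      unfolding wedge_contract_Cons[of H] wedge_contract_Cons[of G] 1 2 3 F unfolding Suc
      by (cases "even k") (simp_all add: algebra_simps)
  qed
qed

section \<open>Smooth sections\<close>

lemma smooth_wedge_contract:
  "(\<And>xs ys. smooth (\<lambda>x. F x xs ys)) \<Longrightarrow> smooth (\<lambda>x. wedge_contract (F x) us)"
  unfolding wedge_contract_def by (intro smooth_sum smooth_mult smooth_const)

lemma smooth_wedge:
  "(\<And>xs. smooth (\<lambda>x. \<alpha> x xs)) \<Longrightarrow> (\<And>xs. smooth (\<lambda>x. \<beta> x xs)) \<Longrightarrow>
    smooth (\<lambda>x. wedge (\<alpha> x) (\<beta> x) us)"
  unfolding wedge_def by (intro smooth_wedge_contract smooth_mult)

lemma alt_forms_frechet:
  fixes B :: "'a::euclidean_space \<Rightarrow> 'a list \<Rightarrow> 'b::real_normed_vector"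
  assumes B: "\<And>x. B x \<in> alt_forms p" and smooth: "\<And>us. smooth (\<lambda>x. B x us)"
  shows "(\<lambda>us. frechet_derivative (\<lambda>y. B y us) (at x) h) \<in> alt_forms p"
proof (rule alt_formsI)
  fix us :: "'a list" and i assume us: "length us = p" "i < p"
  have lin: "linear (\<lambda>v. B y (us[i := v]))" for y
    using alt_forms_linear[OF B] us by simp
  show "linear (\<lambda>v. frechet_derivative (\<lambda>y. B y (us[i := v])) (at x) h)"
  proof (rule linearI)
    show "frechet_derivative (\<lambda>y. B y (us[i := v + w])) (at x) h =
        frechet_derivative (\<lambda>y. B y (us[i := v])) (at x) h + frechet_derivative (\<lambda>y. B y (us[i := w])) (at x) h"
      for v w unfolding linear_add[OF lin] by (rule frechet_add[OF smooth smooth])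
    show "frechet_derivative (\<lambda>y. B y (us[i := c *\<^sub>R v])) (at x) h =
        c *\<^sub>R frechet_derivative (\<lambda>y. B y (us[i := v])) (at x) h" for c v
      unfolding linear_scale[OF lin] by (rule frechet_bounded_linear[OF bounded_linear_scaleR_right smooth])
  qed
next
  fix us :: "'a list" assume "length us \<noteq> p"
  then show "frechet_derivative (\<lambda>y. B y us) (at x) h = 0"
    by (simp add: alt_forms_length[OF B] frechet_zero)
next
  fix us :: "'a list" assume "\<not> distinct us"
  then show "frechet_derivative (\<lambda>y. B y us) (at x) h = 0"
    by (simp add: alt_forms_distinct[OF B] frechet_zero)
qed

text \<open>The Euler field enters through evaluation at the point itself. Both \<open>d\<close> and \<open>\<partial>\<close> have this form, and
  so does the vector \<open>A x [x]\<close> in the anchor.\<close>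

lemma smooth_diagonal:
  fixes B :: "'a::euclidean_space \<Rightarrow> 'a list \<Rightarrow> 'b::real_normed_vector"
  assumes B: "\<And>x. B x \<in> alt_forms p" and smooth: "\<And>us. smooth (\<lambda>x. B x us)"
  shows "smooth (\<lambda>x. B x (x # us))"
proof -
  have "B x (x # us) = (\<Sum>i\<in>Basis. (x \<bullet> i) *\<^sub>R B x (i # us))" for x
    using linear_basis_expand[OF alt_forms_linear_hd[OF B], where w = x] by simp
  then show ?thesis
    by (simp only:) (intro smooth_sum smooth_scaleR smooth_coordinate smooth)
qed

lemma frechet_diagonal:
  fixes B :: "'a::euclidean_space \<Rightarrow> 'a list \<Rightarrow> 'b::real_normed_vector"
  assumes B: "\<And>x. B x \<in> alt_forms p" and smooth: "\<And>us. smooth (\<lambda>x. B x us)"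
  shows "frechet_derivative (\<lambda>y. B y (y # us)) (at x) h =
    B x (h # us) + frechet_derivative (\<lambda>y. B y (x # us)) (at x) h"
proof -
  let ?D = "\<lambda>us h. frechet_derivative (\<lambda>y. B y us) (at x) h"
  have D: "((\<lambda>y. B y us) has_derivative ?D us) (at x)" for us
    by (rule smooth_has_derivative[OF smooth])
  have e: "(\<lambda>y. B y (y # us)) = (\<lambda>y. \<Sum>i\<in>Basis. (y \<bullet> i) *\<^sub>R B y (i # us))"
    using linear_basis_expand[OF alt_forms_linear_hd[OF B]] by simp
  have "((\<lambda>y. \<Sum>i\<in>Basis. (y \<bullet> i) *\<^sub>R B y (i # us)) has_derivative
      (\<lambda>h. \<Sum>i\<in>Basis. (x \<bullet> i) *\<^sub>R ?D (i # us) h + (h \<bullet> i) *\<^sub>R B x (i # us))) (at x)"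
    by (intro has_derivative_sum has_derivative_scaleR has_derivative_inner_left has_derivative_ident D)
  from frechet_derivative_at[OF this, symmetric]
  have "frechet_derivative (\<lambda>y. B y (y # us)) (at x) h =
      (\<Sum>i\<in>Basis. (x \<bullet> i) *\<^sub>R ?D (i # us) h + (h \<bullet> i) *\<^sub>R B x (i # us))"
    unfolding e by metis
  also have "\<dots> = ?D (x # us) h + B x (h # us)"
    using linear_basis_expand[OF alt_forms_linear_hd[OF alt_forms_frechet[OF B smooth]], where w = x]
      linear_basis_expand[OF alt_forms_linear_hd[OF B], where w = h]
    by (simp add: sum.distrib)
  finally show ?thesis by (simp add: add.commute)
qed

lemma Gamma_VD: "A \<in> Gamma_V p \<Longrightarrow> A x \<in> alt_forms p" "A \<in> Gamma_V p \<Longrightarrow> smooth (\<lambda>x. A x us)"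
  by (auto simp: Gamma_V_def)

lemma Gamma_TD: "T \<in> Gamma_T p \<Longrightarrow> T x \<in> alt_tforms p" "T \<in> Gamma_T p \<Longrightarrow> smooth (\<lambda>x. T x us vs)"
  by (auto simp: Gamma_T_def)

lemma Gamma_VI: "(\<And>x. A x \<in> alt_forms p) \<Longrightarrow> (\<And>us. smooth (\<lambda>x. A x us)) \<Longrightarrow> A \<in> Gamma_V p"
  by (auto simp: Gamma_V_def)

lemma Gamma_TI: "(\<And>x. T x \<in> alt_tforms p) \<Longrightarrow> (\<And>us vs. smooth (\<lambda>x. T x us vs)) \<Longrightarrow> T \<in> Gamma_T p"
  by (auto simp: Gamma_T_def)

lemma Gamma_T_alt:
  assumes "T \<in> Gamma_T p"
  shows "(\<lambda>us. T x us vs) \<in> alt_forms p" "T x us \<in> alt_forms 2"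
  using alt_tforms_left[OF Gamma_TD(1)[OF assms]] alt_tforms_right[OF Gamma_TD(1)[OF assms]] by auto

lemma Gamma_V_zero: "0 \<in> Gamma_V p"
  by (rule Gamma_VI) (simp_all add: zero_fun_def alt_forms_zero smooth_const)

lemma Gamma_V_add: "A \<in> Gamma_V p \<Longrightarrow> B \<in> Gamma_V p \<Longrightarrow> A + B \<in> Gamma_V p"
  by (rule Gamma_VI) (simp_all add: plus_fun_def alt_forms_add smooth_add Gamma_VD)

lemma Gamma_V_scale: "A \<in> Gamma_V p \<Longrightarrow> (\<lambda>x us. c *\<^sub>R A x us) \<in> Gamma_V p"
  by (rule Gamma_VI) (simp_all add: alt_forms_scale smooth_scaleR smooth_const Gamma_VD)

lemma Gamma_T_zero: "0 \<in> Gamma_T p"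
  by (rule Gamma_TI) (simp_all add: zero_fun_def alt_tforms_def alt_forms_zero smooth_const)

lemma Gamma_T_add: "S \<in> Gamma_T p \<Longrightarrow> T \<in> Gamma_T p \<Longrightarrow> S + T \<in> Gamma_T p"
  by (rule Gamma_TI) (simp_all add: plus_fun_def alt_tforms_def alt_forms_add smooth_add Gamma_TD Gamma_T_alt)

lemma Gamma_T_scale: "T \<in> Gamma_T p \<Longrightarrow> (\<lambda>x us vs. c * T x us vs) \<in> Gamma_T p"
  by (rule Gamma_TI)
     (simp_all add: alt_tforms_def alt_forms_mult smooth_mult smooth_const Gamma_TD Gamma_T_alt)

lemma Gamma_T_minus: "T \<in> Gamma_T p \<Longrightarrow> - T \<in> Gamma_T p"
  using Gamma_T_scale[of T p "-1"] by (simp add: fun_Compl_def)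

lemma Gamma_T_diff: "S \<in> Gamma_T p \<Longrightarrow> T \<in> Gamma_T p \<Longrightarrow> S - T \<in> Gamma_T p"
  using Gamma_T_add[OF _ Gamma_T_minus, of S p T] by simp

lemma tsection_eqI:
  assumes "S \<in> Gamma_T p" "T \<in> Gamma_T q" "\<And>x us u v. S x us [u, v] = T x us [u, v]"
  shows "S = T"
  by (rule ext, rule tform_eqI) (use assms Gamma_T_alt in auto)

text \<open>The sums in the definitions of \<open>d\<close> and \<open>\<partial>\<close> are the contraction with the point, up to the sign in
  \<open>\<partial>\<close>.\<close>

lemma d_op_eq: "A \<in> Gamma_V p \<Longrightarrow> d_op A x us = A x (x # us)"
  using linear_basis_expand[OF alt_forms_linear_hd[OF Gamma_VD(1)], where w = x]
  by (simp add: d_op_def iota_def)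

lemma del_eq: "T \<in> Gamma_T p \<Longrightarrow> del T x us vs = - T x (x # us) vs"
  using linear_basis_expand_real[OF alt_forms_linear_hd[OF Gamma_T_alt(1)], where w = x]
  by (simp add: del_def iota_def)

lemma d_op_Gamma:
  assumes A: "A \<in> Gamma_V p" shows "d_op A \<in> Gamma_V (p - 1)"
proof (rule Gamma_VI)
  show "d_op A x \<in> alt_forms (p - 1)" for x
  proof -
    have "d_op A x = iota x (A x)" by (intro ext) (simp add: d_op_eq[OF A] iota_def)
    then show ?thesis using alt_forms_iota[OF Gamma_VD(1)[OF A]] by simp
  qed
  show "smooth (\<lambda>x. d_op A x us)" for us
    unfolding d_op_eq[OF A] by (rule smooth_diagonal) (rule Gamma_VD[OF A])+
qed

lemma del_Gamma:
  assumes T: "T \<in> Gamma_T p" shows "del T \<in> Gamma_T (p - 1)"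
proof (rule Gamma_TI)
  show "del T x \<in> alt_tforms (p - 1)" for x
    unfolding alt_tforms_def mem_Collect_eq
  proof (intro conjI allI)
    show "(\<lambda>us. del T x us vs) \<in> alt_forms (p - 1)" for vs
      using alt_forms_minus[OF alt_forms_iota[OF Gamma_T_alt(1)[OF T]]]
      by (simp add: del_eq[OF T] iota_def)
    show "del T x us \<in> alt_forms 2" for us
      using alt_forms_minus[OF Gamma_T_alt(2)[OF T]] by (simp add: del_eq[OF T, abs_def])
  qed
  show "smooth (\<lambda>x. del T x us vs)" for us vs
    unfolding del_eq[OF T]
    by (rule smooth_minus, rule smooth_diagonal[where B="\<lambda>x us. T x us vs"])
       (rule Gamma_T_alt[OF T] Gamma_TD[OF T])+
qed

lemma del_add: "del (S + T) = del S + del T"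
  and del_diff: "del (S - T) = del S - del T"
  and del_zero: "del 0 = 0"
  by (intro ext; simp add: del_def iota_def algebra_simps sum.distrib sum_subtractf)+

lemma d_op_diff: "d_op (A - B) = d_op A - d_op B"
  and d_op_zero: "d_op 0 = 0"
  by (intro ext; simp add: d_op_def iota_def algebra_simps sum.distrib sum_subtractf)+

lemma d_op_d_op: "A \<in> Gamma_V p \<Longrightarrow> d_op (d_op A) = 0"
  by (intro ext) (simp add: d_op_eq[OF d_op_Gamma] d_op_eq alt_forms_distinct[OF Gamma_VD(1)])

lemma del_del: "T \<in> Gamma_T p \<Longrightarrow> del (del T) = 0"
  by (intro ext) (simp add: del_eq[OF del_Gamma] del_eq alt_forms_distinct[OF Gamma_T_alt(1)])

lemma Gamma_T_sum: "(\<And>i. i \<in> I \<Longrightarrow> T i \<in> Gamma_T p) \<Longrightarrow> (\<Sum>i\<in>I. T i) \<in> Gamma_T p"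
  by (induction I rule: infinite_finite_induct) (auto intro: Gamma_T_add Gamma_T_zero)

section \<open>Brackets of smooth sections\<close>

lemma bracket_VT_eq: "bracket_VT p A T x us vs =
    alg_bracket_VT p (A x) (T x) us vs + (if p = 1 then rho A (\<lambda>y. T y us vs) x else 0)"
  by (simp add: bracket_VT_def alg_bracket_VT_def)

lemma bracket_VV_eq: "bracket_VV p q A B x us = alg_bracket_VV p q (A x) (B x) us
    + (if p = 1 then rho A (\<lambda>y. B y us) x else 0) - (if q = 1 then rho B (\<lambda>y. A y us) x else 0)"
  by (simp add: bracket_VV_def alg_bracket_VV_def)

lemma smooth_rho:
  assumes "A \<in> Gamma_V p" "smooth f"
  shows "smooth (rho A f)"
  unfolding rho_def[abs_def]
  by (rule smooth_frechet_section[OF assms(2) smooth_diagonal[where B=A, OF Gamma_VD[OF assms(1)]]])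

lemma smooth_if: "smooth f \<Longrightarrow> smooth (\<lambda>x. if c then f x else 0)"
  by (cases c) (simp_all add: smooth_const)

lemma rho_alt:
  fixes B :: "'a::euclidean_space \<Rightarrow> 'a list \<Rightarrow> 'b::real_normed_vector"
  assumes "\<And>x. B x \<in> alt_forms p" "\<And>us. smooth (\<lambda>x. B x us)"
  shows "(\<lambda>us. rho A (\<lambda>y. B y us) x) \<in> alt_forms p"
  unfolding rho_def by (rule alt_forms_frechet) (rule assms)+

text \<open>This makes the anchor term of \<open>dX\<close> vanish if \<open>X\<close> has degree \<open>2\<close>: there \<open>(dX) x [x] = X x [x, x] = 0\<close>.\<close>

lemma rho_eq_0: "smooth f \<Longrightarrow> A x [x] = 0 \<Longrightarrow> rho A f x = 0"
  by (simp add: rho_def linear_0[OF smooth_linear_frechet])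

lemma smooth_alg_bracket_VT:
  assumes "\<And>us. smooth (\<lambda>x. A x us)" "\<And>us vs. smooth (\<lambda>x. T x us vs)"
  shows "smooth (\<lambda>x. alg_bracket_VT p (A x) (T x) us vs)"
  unfolding alg_bracket_VT_def iota_def vcomp_def
  by (intro smooth_sum smooth_add smooth_mult smooth_const smooth_wedge smooth_inner assms)

lemma bracket_VT_Gamma:
  assumes A: "A \<in> Gamma_V p" and T: "T \<in> Gamma_T q" and p: "p \<ge> 1"
  shows "bracket_VT p A T \<in> Gamma_T (p + q - 1)"
proof (rule Gamma_TI)
  have r1: "(\<lambda>us. if p = 1 then rho A (\<lambda>y. T y us vs) x else 0) \<in> alt_forms (p + q - 1)" for x vs
  proof (cases "p = 1")
    case True
    have "(\<lambda>us. rho A (\<lambda>y. T y us vs) x) \<in> alt_forms q"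
      by (rule rho_alt[where B="\<lambda>x us. T x us vs"]) (rule Gamma_T_alt[OF T] Gamma_TD[OF T])+
    then show ?thesis using True by simp
  qed (simp add: alt_forms_zero)
  have r2: "(\<lambda>vs. if p = 1 then rho A (\<lambda>y. T y us vs) x else 0) \<in> alt_forms 2" for x us
  proof (cases "p = 1")
    case True
    have "(\<lambda>vs. rho A (\<lambda>y. T y us vs) x) \<in> alt_forms 2"
      by (rule rho_alt[where B="\<lambda>x vs. T x us vs"]) (rule Gamma_T_alt[OF T] Gamma_TD[OF T])+
    then show ?thesis using True by simp
  qed (simp add: alt_forms_zero)
  have l: "alg_bracket_VT p (A x) (T x) \<in> alt_tforms (p + q - 1)" for x
    by (rule alg_bracket_VT_alt[OF Gamma_VD(1)[OF A] Gamma_TD(1)[OF T] p])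
  show "bracket_VT p A T x \<in> alt_tforms (p + q - 1)" for x
    unfolding alt_tforms_def mem_Collect_eq
  proof (intro conjI allI)
    show "(\<lambda>us. bracket_VT p A T x us vs) \<in> alt_forms (p + q - 1)" for vs
      unfolding bracket_VT_eq by (rule alt_forms_add[OF alt_tforms_left[OF l] r1])
    show "bracket_VT p A T x us \<in> alt_forms 2" for us
      unfolding bracket_VT_eq[abs_def] by (rule alt_forms_add[OF alt_tforms_right[OF l] r2])
  qed
  show "smooth (\<lambda>x. bracket_VT p A T x us vs)" for us vs
    unfolding bracket_VT_eq
    by (cases "p = 1") (auto intro!: smooth_add smooth_alg_bracket_VT Gamma_VD[OF A] Gamma_TD[OF T]
        smooth_rho[OF A] simp: smooth_const)
qed

lemma bracket_VV_Gamma: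
  assumes A: "A \<in> Gamma_V p" and B: "B \<in> Gamma_V q" and pq: "p \<ge> 1" "q \<ge> 1"
  shows "bracket_VV p q A B \<in> Gamma_V (p + q - 1)"
proof (rule Gamma_VI)
  have r1: "(\<lambda>us. if p = 1 then rho A (\<lambda>y. B y us) x else 0) \<in> alt_forms (p + q - 1)" for x
  proof (cases "p = 1")
    case True
    have "(\<lambda>us. rho A (\<lambda>y. B y us) x) \<in> alt_forms q" by (rule rho_alt[OF Gamma_VD[OF B]])
    then show ?thesis using True by simp
  qed (simp add: alt_forms_zero)
  have r2: "(\<lambda>us. if q = 1 then rho B (\<lambda>y. A y us) x else 0) \<in> alt_forms (p + q - 1)" for x
  proof (cases "q = 1")
    case True
    have "(\<lambda>us. rho B (\<lambda>y. A y us) x) \<in> alt_forms p" by (rule rho_alt[OF Gamma_VD[OF A]])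
    then show ?thesis using True by simp
  qed (simp add: alt_forms_zero)
  have l: "alg_bracket_VV p q (A x) (B x) \<in> alt_forms (p + q - 1)" for x
    by (intro alg_bracket_VV_alt Gamma_VD A B pq)
  show "bracket_VV p q A B x \<in> alt_forms (p + q - 1)" for x
    unfolding bracket_VV_eq[abs_def] by (intro alt_forms_add alt_forms_diff l r1 r2)
  have s: "smooth (\<lambda>x. alg_bracket_VV p q (A x) (B x) us)" for us
    unfolding alg_bracket_VV_def iota_def vcomp_def
    by (intro smooth_sum smooth_diff smooth_scaleR smooth_const smooth_wedge smooth_inner
        Gamma_VD(2)[OF A] Gamma_VD(2)[OF B])
  show "smooth (\<lambda>x. bracket_VV p q A B x us)" for us
    unfolding bracket_VV_eq
    by (rule smooth_diff[OF smooth_add[OF s]])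
      (auto intro!: smooth_if smooth_rho[OF A] smooth_rho[OF B] Gamma_VD[OF A] Gamma_VD[OF B])
qed

lemma alg_bracket_VT_add: "alg_bracket_VT p A (S + T) us vs = alg_bracket_VT p A S us vs + alg_bracket_VT p A T us vs"
  by (simp only: alg_bracket_VT_def iota_def plus_fun_def wedge_add_right distrib_left sum.distrib add_ac)

lemma alg_bracket_VT_scale: "alg_bracket_VT p A (\<lambda>us vs. c * T us vs) us vs = c * alg_bracket_VT p A T us vs"
  by (simp only: alg_bracket_VT_def iota_def wedge_scale_right distrib_left sum_distrib_left mult.left_commute)

lemma alg_bracket_VT_zero: "alg_bracket_VT p 0 T us vs = 0" "alg_bracket_VT p A 0 us vs = 0"
  by (simp_all add: alg_bracket_VT_def iota_def vcomp_def zero_fun_def wedge_zero)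

lemma alg_bracket_VV_zero: "alg_bracket_VV p q 0 B us = 0" "alg_bracket_VV p q A 0 us = 0"
  by (simp_all add: alg_bracket_VV_def iota_def vcomp_def zero_fun_def wedge_zero)

lemma bracket_VT_add:
  assumes "S \<in> Gamma_T q" "T \<in> Gamma_T q"
  shows "bracket_VT p A (S + T) = bracket_VT p A S + bracket_VT p A T"
  using frechet_add[OF Gamma_TD(2)[OF assms(1)] Gamma_TD(2)[OF assms(2)]]
  by (intro ext) (simp add: bracket_VT_eq alg_bracket_VT_add[unfolded plus_fun_def] rho_def plus_fun_def)

lemma bracket_VT_scale:
  assumes "T \<in> Gamma_T q"
  shows "bracket_VT p A (\<lambda>x us vs. c * T x us vs) = (\<lambda>x us vs. c * bracket_VT p A T x us vs)"
  using frechet_bounded_linear[OF bounded_linear_mult_right Gamma_TD(2)[OF assms]]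
  by (intro ext) (simp add: bracket_VT_eq alg_bracket_VT_scale rho_def distrib_left)

lemma bracket_VT_minus: "T \<in> Gamma_T q \<Longrightarrow> bracket_VT p A (- T) = - bracket_VT p A T"
  using bracket_VT_scale[of T q p A "-1"] by (simp add: fun_Compl_def)

lemma bracket_VT_diff:
  "S \<in> Gamma_T q \<Longrightarrow> T \<in> Gamma_T q \<Longrightarrow> bracket_VT p A (S - T) = bracket_VT p A S - bracket_VT p A T"
  using bracket_VT_add[OF _ Gamma_T_minus, of S q T] by (simp add: bracket_VT_minus)

lemma bracket_VT_zero_left: "T \<in> Gamma_T q \<Longrightarrow> bracket_VT p 0 T = 0"
  by (intro ext) (simp add: bracket_VT_eq alg_bracket_VT_zero rho_eq_0 Gamma_TD)

lemma bracket_VT_zero_right: "bracket_VT p A 0 = 0"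
  by (intro ext) (simp add: bracket_VT_eq alg_bracket_VT_zero rho_def frechet_zero)

lemma bracket_VV_zero_right: "A \<in> Gamma_V p \<Longrightarrow> bracket_VV p q A 0 = 0"
  by (intro ext) (simp add: bracket_VV_eq alg_bracket_VV_zero rho_eq_0 Gamma_VD, simp add: rho_def frechet_zero)

lemma bracket_VV_zero_left: "B \<in> Gamma_V q \<Longrightarrow> bracket_VV p q 0 B = 0"
  by (intro ext) (simp add: bracket_VV_eq alg_bracket_VV_zero rho_eq_0 Gamma_VD, simp add: rho_def frechet_zero)

lemma bracket_VV_anti: "bracket_VV 1 1 A B = - bracket_VV 1 1 B A"
proof -
  define X where "X A B us = (\<Sum>i\<in>Basis. \<Sum>j\<in>Basis. wedge (vcomp i A) (iota i (vcomp j B)) us *\<^sub>R j)"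
    for A B :: "'a::euclidean_space vform" and us
  have "alg_bracket_VV 1 1 A B us = X A B us - X B A us" for A B :: "'a::euclidean_space vform" and us
  proof -
    have "alg_bracket_VV 1 1 A B us = X A B us
        - (\<Sum>i\<in>Basis. \<Sum>j\<in>Basis. wedge (vcomp j B) (iota j (vcomp i A)) us *\<^sub>R i)"
      by (simp add: alg_bracket_VV_def X_def sum_subtractf)
    also have "(\<Sum>i\<in>Basis. \<Sum>j\<in>Basis. wedge (vcomp j B) (iota j (vcomp i A)) us *\<^sub>R i) = X B A us"
      unfolding X_def by (rule sum.swap)
    finally show ?thesis .
  qed
  then show ?thesis by (intro ext) (simp add: bracket_VV_eq)
qed

lemma alg_bracket_VT_minus: "alg_bracket_VT p A (\<lambda>us vs. - T us vs) us vs = - alg_bracket_VT p A T us vs"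
  using alg_bracket_VT_scale[of p A "-1" T us vs] by simp

lemma alg_bracket_VT_degree_0:
  assumes "A \<in> alt_forms 0" "T \<in> alt_tforms q"
  shows "alg_bracket_VT 0 A T us [u, v] = - T (A [] # us) [u, v]"
proof -
  have "iota w A = (\<lambda>_. 0)" for w
    using assms(1) by (auto simp: iota_def alt_forms_Cons_zero)
  moreover have "insertion A (\<lambda>j ws. T (j # ws) [u, v]) us = T (A [] # us) [u, v]"
    by (rule insertion_degree_0[OF assms(1) alt_forms_linear_hd[OF alt_tforms_left[OF assms(2)]]])
  ultimately show ?thesis by (simp add: alg_bracket_VT_pair[OF assms(1)] insertion_zero_left)
qed

lemma rho_diagonal:
  fixes B :: "'a::euclidean_space \<Rightarrow> 'a list \<Rightarrow> 'b::real_normed_vector"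
  assumes "\<And>x. B x \<in> alt_forms p" "\<And>us. smooth (\<lambda>x. B x us)"
  shows "rho A (\<lambda>y. B y (y # us)) x = B x (A x [x] # us) + rho A (\<lambda>y. B y (x # us)) x"
  unfolding rho_def by (rule frechet_diagonal[OF assms])

lemma rho_bounded_linear:
  "bounded_linear L \<Longrightarrow> smooth f \<Longrightarrow> rho A (\<lambda>y. L (f y)) x = L (rho A f x)"
  unfolding rho_def by (rule frechet_bounded_linear)

lemma rho_minus: "smooth f \<Longrightarrow> rho A (\<lambda>y. - f y) x = - rho A f x"
  by (rule rho_bounded_linear[OF bounded_linear_minus[OF bounded_linear_ident]])

text \<open>The Leibniz rule of \<open>\<partial>\<close> is \<open>alg_bracket_VT_Cons\<close> with \<open>x\<close> the point. If \<open>p = 2\<close>, then \<open>dA\<close> has degree \<open>1\<close>,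
  but its anchor is zero.\<close>

lemma del_bracket_VT:
  assumes A: "A \<in> Gamma_V p" and T: "T \<in> Gamma_T q" and p: "p \<ge> 2"
  shows "del (bracket_VT p A T) =
    bracket_VT (p - 1) (d_op A) T + (\<lambda>x us vs. (-1) ^ (p + 1) * bracket_VT p A (del T) x us vs)"
    (is "_ = ?R")
proof (rule tsection_eqI)
  have br: "bracket_VT p A T \<in> Gamma_T (p + q - 1)"
    using bracket_VT_Gamma[OF A T] p by simp
  from del_Gamma[OF br] show "del (bracket_VT p A T) \<in> Gamma_T (p + q - 2)" by (simp add: numeral_2_eq_2)
  show "?R \<in> Gamma_T (p + q - 2)"
  proof (cases q)
    case 0
    have "del T = 0"
      by (intro ext) (simp add: del_eq[OF T] alt_forms_Cons_zero[OF Gamma_T_alt(1)[OF T[unfolded 0]]])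
    then have "?R = bracket_VT (p - 1) (d_op A) T" by (intro ext) (simp add: bracket_VT_zero_right)
    then show ?thesis
      using bracket_VT_Gamma[OF d_op_Gamma[OF A] T] p 0 by (simp add: numeral_2_eq_2)
  next
    case (Suc l)
    have "p - 1 + q - 1 = p + q - 2" "p + (q - 1) - 1 = p + q - 2" using p Suc by auto
    then show ?thesis
      using bracket_VT_Gamma[OF d_op_Gamma[OF A] T] Gamma_T_scale[OF bracket_VT_Gamma[OF A del_Gamma[OF T]], of "(-1) ^ (p + 1)"] p
      by (intro Gamma_T_add) simp_all
  qed
  fix x us u v
  have d: "d_op A x = iota x (A x)"
    by (intro ext) (simp add: d_op_eq[OF A] iota_def)
  have e: "del T x = (\<lambda>us vs. - iota x (T x) us vs)"
    by (intro ext) (simp add: del_eq[OF T] iota_def)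
  have r: "rho (d_op A) (\<lambda>y. T y us [u, v]) x = 0"
    by (rule rho_eq_0[OF Gamma_TD(2)[OF T]])
       (simp add: d_op_eq[OF A] alt_forms_distinct[OF Gamma_VD(1)[OF A]])
  show "del (bracket_VT p A T) x us [u, v] = ?R x us [u, v]"
    using p alg_bracket_VT_Cons[OF Gamma_VD(1)[OF A, of x] Gamma_TD(1)[OF T, of x], of x us u v] r
    by (simp add: del_eq[OF br] bracket_VT_eq d e alg_bracket_VT_minus)
qed

text \<open>The term \<open>[\<iota>\<^sub>x A, T]\<close>, where \<open>\<iota>\<^sub>x A\<close> has degree \<open>0\<close>, is the contraction of \<open>T\<close> with \<open>A x [x]\<close>. It cancels the
  contribution of the anchor differentiating the Euler field in \<open>\<partial>T\<close>.\<close>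

lemma del_bracket_VT_1:
  assumes A: "A \<in> Gamma_V 1" and T: "T \<in> Gamma_T q"
  shows "del (bracket_VT 1 A T) = bracket_VT 1 A (del T)"
proof (rule tsection_eqI)
  have br: "bracket_VT 1 A T \<in> Gamma_T q"
    using bracket_VT_Gamma[OF A T] by simp
  from del_Gamma[OF br] show "del (bracket_VT 1 A T) \<in> Gamma_T (q - 1)" by simp
  show "bracket_VT 1 A (del T) \<in> Gamma_T (q - 1)"
    using bracket_VT_Gamma[OF A del_Gamma[OF T]] by simp
  fix x us u v
  have iA: "iota x (A x) \<in> alt_forms 0" using alt_forms_iota[OF Gamma_VD(1)[OF A]] by simp
  have e: "del T x = (\<lambda>us vs. - iota x (T x) us vs)"
    by (intro ext) (simp add: del_eq[OF T] iota_def)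
  have r: "rho A (\<lambda>y. del T y us [u, v]) x = - T x (A x [x] # us) [u, v] - rho A (\<lambda>y. T y (x # us) [u, v]) x"
  proof -
    have B: "(\<lambda>us. T x us [u, v]) \<in> alt_forms q" "smooth (\<lambda>x. T x us [u, v])" for x us
      using Gamma_T_alt(1)[OF T] Gamma_TD(2)[OF T] by auto
    show ?thesis
      unfolding del_eq[OF T]
      using rho_minus[OF smooth_diagonal[where B="\<lambda>x us. T x us [u, v]", OF B], where A = A and x = x]
        rho_diagonal[where B="\<lambda>x us. T x us [u, v]", OF B, where A = A and x = x] by simp
  qed
  show "del (bracket_VT 1 A T) x us [u, v] = bracket_VT 1 A (del T) x us [u, v]"
    using alg_bracket_VT_Cons[OF Gamma_VD(1)[OF A, of x] Gamma_TD(1)[OF T, of x], of x us u v]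
    unfolding del_eq[OF br] bracket_VT_eq r
    by (simp add: e alg_bracket_VT_minus alg_bracket_VT_degree_0[OF iA Gamma_TD(1)[OF T]]) (simp add: iota_def)
qed

text \<open>As for \<open>\<partial>\<close>, the extra contraction with \<open>A x [x]\<close> is the derivative of the Euler field along the anchor
  of \<open>A\<close>.\<close>

lemma d_op_bracket_VV:
  assumes A: "A \<in> Gamma_V 1" and B: "B \<in> Gamma_V 2"
  shows "d_op (bracket_VV 1 2 A B) = bracket_VV 1 1 A (d_op B)"
proof (intro ext)
  fix x us
  have br: "bracket_VV 1 2 A B \<in> Gamma_V 2"
    using bracket_VV_Gamma[OF A B] by (simp add: numeral_2_eq_2)
  have iA: "iota x (A x) \<in> alt_forms 0" using alt_forms_iota[OF Gamma_VD(1)[OF A]] by simp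
  have d: "d_op B x = iota x (B x)"
    by (intro ext) (simp add: d_op_eq[OF B] iota_def)
  have pt: "alg_bracket_VV 1 2 (A x) (B x) (x # us) = alg_bracket_VV 1 1 (A x) (iota x (B x)) us + B x (A x [x] # us)"
  proof (rule euclidean_eqI)
    fix i :: 'a
    define l where "l = (\<lambda>v::'a. v \<bullet> i)"
    have l: "linear l" by (auto intro!: linearI simp: l_def inner_add_left)
    have 1: "iota x (\<lambda>ws. l (B x (j # ws))) = (\<lambda>ws. - l (iota x (B x) (j # ws)))" for j
      by (intro ext) (simp add: iota_def alt_forms_swap[OF Gamma_VD(1)[OF B, of x], of x j] linear_neg[OF l])
    have 2: "iota x (\<lambda>ws. l (A x (j # ws))) = (\<lambda>ws. 0)" for j
      using alt_forms_length[OF Gamma_VD(1)[OF A, of x], of "j # x # ws" for ws]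
      by (intro ext) (simp add: iota_def linear_0[OF l])
    have 3: "insertion (iota x (A x)) (\<lambda>j ws. l (B x (j # ws))) us = l (B x (A x [x] # us))"
      using insertion_degree_0[OF iA, of "\<lambda>j ws. l (B x (j # ws))" us]
        linear_compose[OF alt_forms_linear_hd[OF Gamma_VD(1)[OF B, of x], of us] l]
      by (simp add: iota_def o_def)
    show "alg_bracket_VV 1 2 (A x) (B x) (x # us) \<bullet> i = (alg_bracket_VV 1 1 (A x) (iota x (B x)) us + B x (A x [x] # us)) \<bullet> i"
      using linear_alg_bracket_VV[OF l, of 1 2 "A x" "B x" "x # us"] linear_alg_bracket_VV[OF l, of 1 1 "A x" "iota x (B x)" us]
      by (simp add: insertion_Cons[OF Gamma_VD(1)[OF A]] insertion_Cons[OF Gamma_VD(1)[OF B]] 1 2 3 insertion_minus insertion_zero_right)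
         (simp add: l_def inner_add_left)
  qed
  have r: "rho (d_op B) (\<lambda>y. A y us) x = 0"
    by (rule rho_eq_0[OF Gamma_VD(2)[OF A]])
       (simp add: d_op_eq[OF B] alt_forms_distinct[OF Gamma_VD(1)[OF B]])
  have r2: "rho A (\<lambda>y. d_op B y us) x = B x (A x [x] # us) + rho A (\<lambda>y. B y (x # us)) x"
    unfolding d_op_eq[OF B] by (rule rho_diagonal[OF Gamma_VD[OF B]])
  show "d_op (bracket_VV 1 2 A B) x us = bracket_VV 1 1 A (d_op B) x us"
    unfolding d_op_eq[OF br] bracket_VV_eq pt r r2 d by simp
qed

lemma bracket_TV_1: "bracket_TV q 1 T A = - bracket_VT 1 A T"
  by (intro ext) (simp add: bracket_TV_def)

lemma bracket_TV_Gamma: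
  assumes "A \<in> Gamma_V p" "T \<in> Gamma_T q" "p \<ge> 1"
  shows "bracket_TV q p T A \<in> Gamma_T (p + q - 1)"
  unfolding bracket_TV_def by (rule Gamma_T_scale[OF bracket_VT_Gamma[OF assms]])

lemma bracket_TV_zero_left: "bracket_TV q p 0 A = 0"
  by (intro ext) (simp add: bracket_TV_def bracket_VT_zero_right)

lemma bracket_TV_zero_right: "T \<in> Gamma_T k \<Longrightarrow> bracket_TV q p T 0 = 0"
  by (intro ext) (simp add: bracket_TV_def bracket_VT_zero_left)

section \<open>Operations on cosets\<close>

text \<open>An operation on cosets, given by the union over all representatives, is the coset of the operation on
  one representative if the operation is well defined.\<close>

lemma coset_UN:
  fixes F :: "'b::ab_group_add \<Rightarrow> 'c::ab_group_add"
  assumes "0 \<in> K" "0 \<in> K'" "\<And>a b. a \<in> K' \<Longrightarrow> b \<in> K' \<Longrightarrow> a + b \<in> K'"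
    and "\<And>k. k \<in> K \<Longrightarrow> F (\<eta> + k) - F \<eta> \<in> K'"
  shows "(\<Union>\<xi>\<in>\<eta> +o K. F \<xi> +o K') = F \<eta> +o K'"
proof (intro equalityI subsetI)
  fix z assume "z \<in> (\<Union>\<xi>\<in>\<eta> +o K. F \<xi> +o K')"
  then obtain k k' where k: "k \<in> K" "k' \<in> K'" "z = F (\<eta> + k) + k'"
    by (auto simp: elt_set_plus_def)
  then have "z = F \<eta> + ((F (\<eta> + k) - F \<eta>) + k')" by simp
  then show "z \<in> F \<eta> +o K'"
    using assms(3)[OF assms(4)[OF k(1)] k(2)] unfolding elt_set_plus_def by blast
next
  fix z assume "z \<in> F \<eta> +o K'"
  moreover have "\<eta> \<in> \<eta> +o K" using assms(1) by (auto simp: elt_set_plus_def)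
  ultimately show "z \<in> (\<Union>\<xi>\<in>\<eta> +o K. F \<xi> +o K')" by blast
qed

section \<open>The left inverse of phi\<close>

locale symplectic_space =
  fixes \<omega> :: "'a::euclidean_space \<Rightarrow> 'a \<Rightarrow> real"
  assumes symplectic: "symplectic \<omega>"
begin

lemma omega_bilinear: "bilinear \<omega>" and omega_self: "\<omega> v v = 0"
  and nondegenerate: "(\<And>v. \<omega> u v = 0) \<Longrightarrow> u = 0"
  using symplectic by (auto simp: symplectic_def)

lemma lin_left: "linear (\<lambda>v. \<omega> v w)" and lin_right: "linear (\<omega> w)"
  using omega_bilinear by (auto simp: bilinear_def)

lemma omega_swap: "\<omega> u v = - \<omega> v u"
  by (rule swap_of_linear_diagonal) (use lin_left lin_right omega_self in auto)

lemma eq_by_pairing: "(\<And>u. \<omega> u v = \<omega> u w) \<Longrightarrow> v = w"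
proof -
  assume "\<And>u. \<omega> u v = \<omega> u w"
  then have "\<omega> (v - w) u = 0" for u
    using omega_swap[of u v] omega_swap[of u w] linear_diff[OF lin_left, of v w u] by simp
  then show ?thesis using nondegenerate[of "v - w"] by simp
qed

text \<open>A nondegenerate form on a finite-dimensional space represents every functional.\<close>

lemma omega_inv:
  assumes \<xi>: "linear \<xi>"
  shows "\<omega> u (omega_inv \<omega> \<xi>) = \<xi> u"
proof -
  \<comment> \<open>\<open>v \<mapsto> \<omega>(\<cdot>, v)\<close>, where a functional is identified with the vector of its coefficients.\<close>
  let ?F = "\<lambda>v. \<Sum>j\<in>Basis. \<omega> j v *\<^sub>R j"
  have F: "?F v \<bullet> j = \<omega> j v" if "j \<in> Basis" for v j using that by simp
  have functional_eqI: "\<eta> = \<zeta>" if "linear \<eta>" "linear \<zeta>" "\<And>j. j \<in> Basis \<Longrightarrow> \<eta> j = \<zeta> j" for \<eta> \<zeta> :: "'a \<Rightarrow> real"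
    by (rule linear_eq_stdbasis) (use that in auto)
  have linF: "linear ?F"
    by (intro linear_compose_sum ballI linearI)
      (simp_all add: linear_add[OF lin_right] linear_scale[OF lin_right] scaleR_add_left)
  have "inj ?F"
    unfolding linear_injective_0[OF linF]
  proof (intro allI impI)
    fix v assume "?F v = 0"
    then have "\<omega> j v = 0" if "j \<in> Basis" for j using F[OF that, of v] by simp
    then have "(\<lambda>u. \<omega> u v) = (\<lambda>_. 0)" by (intro functional_eqI lin_left linear_zero)
    then show "v = 0" using eq_by_pairing[of v 0] linear_0[OF lin_right] by metis
  qed
  then have "surj ?F" by (rule linear_injective_imp_surjective[OF linF]) simp
  then obtain v where v: "(\<Sum>j\<in>Basis. \<xi> j *\<^sub>R j) = ?F v" by (rule surjE)
  have "\<omega> j v = \<xi> j" if "j \<in> Basis" for j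
    using F[OF that, of v] that unfolding v[symmetric] by simp
  then have *: "(\<lambda>u. \<omega> u v) = \<xi>" by (intro functional_eqI lin_left \<xi>)
  have "\<forall>u. \<omega> u (omega_inv \<omega> \<xi>) = \<xi> u"
    unfolding omega_inv_def
  proof (rule theI)
    show "\<forall>u. \<omega> u v = \<xi> u" using * by metis
    show "w = v" if "\<forall>u. \<omega> u w = \<xi> u" for w
      by (rule eq_by_pairing) (use * that in metis)
  qed
  then show ?thesis by blast
qed

text \<open>Pairing with \<open>u\<close> removes \<open>\<omega>\<^sup>-\<^sup>1\<close> and the sum over the basis from the definition of \<open>r\<close>.\<close>

lemma omega_r_inv:
  assumes T: "T \<in> alt_tforms p"
  shows "\<omega> u (r_inv \<omega> p T us) =
    1 / (real p + 1) * wedge_contract (\<lambda>ws. iota u (T ws)) us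
    - (-1) ^ p / (real p * (real p + 1)) * wedge_contract (iota u T) us"
proof -
  have e1: "(\<Sum>i\<in>Basis. (i \<bullet> u) * wedge_contract (\<lambda>ws. iota i (T ws)) us) = wedge_contract (\<lambda>ws. iota u (T ws)) us"
  proof -
    have "(\<lambda>ws. iota u (T ws)) = (\<lambda>ws ys. \<Sum>i\<in>Basis. (i \<bullet> u) * iota i (T ws) ys)"
      using iota_expand[OF alt_tforms_right[OF T], of u] by (simp add: iota_def inner_commute)
    then show ?thesis by (simp only: wedge_contract_sum wedge_contract_scale)
  qed
  have e2: "(\<Sum>i\<in>Basis. (i \<bullet> u) * wedge_contract (iota i T) us) = wedge_contract (iota u T) us"
  proof -
    have "iota u T = (\<lambda>ws ys. \<Sum>i\<in>Basis. (i \<bullet> u) * iota i T ws ys)"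
      using iota_expand[OF alt_tforms_left[OF T], of u] by (simp add: iota_def inner_commute)
    then show ?thesis by (simp only: wedge_contract_sum wedge_contract_scale)
  qed
  define a b where "a = 1 / (real p + 1)" and "b = (-1) ^ p / (real p * (real p + 1))"
  show ?thesis
    unfolding r_inv_def a_def[symmetric] b_def[symmetric] linear_sum[OF lin_right] linear_scale[OF lin_right]
      omega_inv[OF linear_inner_left] e1[symmetric] e2[symmetric]
    by (simp add: sum_distrib_left sum_subtractf algebra_simps)
qed

lemma r_inv_alt:
  assumes T: "T \<in> alt_tforms p" and "p \<ge> 1"
  shows "r_inv \<omega> p T \<in> alt_forms (p + 1)"
proof -
  have 1: "wedge_contract (\<lambda>ws. iota i (T ws)) \<in> alt_forms (p + 1)" for i
  proof (rule wedge_contract_alt)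
    show "(\<lambda>ws. iota i (T ws) ys) \<in> alt_forms p" for ys
      using alt_tforms_left[OF T] by (simp add: iota_def)
    show "iota i (T ws) \<in> alt_forms 1" for ws
      using alt_forms_iota[OF alt_tforms_right[OF T]] by simp
  qed
  have "wedge_contract (iota i T) \<in> alt_forms (p - 1 + 2)" for i
  proof (rule wedge_contract_alt)
    show "(\<lambda>ws. iota i T ws ys) \<in> alt_forms (p - 1)" for ys
      using alt_forms_iota[OF alt_tforms_left[OF T, of ys], of i] by (simp add: iota_def)
    show "iota i T ws \<in> alt_forms 2" for ws
      using alt_tforms_right[OF T] by (simp add: iota_def)
  qed
  moreover have "p - 1 + 2 = p + 1" using assms(2) by simp
  ultimately have 2: "wedge_contract (iota i T) \<in> alt_forms (p + 1)" for i by metis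
  show ?thesis
    unfolding r_inv_def
    by (intro alt_forms_sum alt_forms_scaleR_right alt_forms_diff alt_forms_mult 1 2)
qed

text \<open>Write \<open>A\<^sub>u = \<omega>(A, u)\<close>. Up to sign, \<open>\<phi> A\<close> with one tensor argument \<open>u\<close> inserted is the difference of
  \<open>G = \<iota>\<^sub>u A\<close>, read as a form with values in one-forms, and the comultiplication \<open>F\<close> of \<open>A\<^sub>u\<close>; and \<open>\<iota>\<^sub>u (\<phi> A)\<close> is the
  Koszul image of \<open>G\<close>, again up to sign. By the two Koszul lemmas the
  coefficients in \<open>r\<close> are those for which the terms in \<open>G\<close> cancel and \<open>- A\<^sub>u\<close> remains.\<close>

lemma r_inv_phi:
  assumes A: "A \<in> alt_forms (p + 1)" and "p \<ge> 1"
  shows "r_inv \<omega> p (phi \<omega> (p + 1) A) = A"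
proof (rule ext, rule eq_by_pairing)
  fix us u
  let ?T = "phi \<omega> (p + 1) A"
  define \<alpha> where "\<alpha> = (\<lambda>us. \<omega> (A us) u)"
  define G where "G = (\<lambda>xs ys. case ys of [m] \<Rightarrow> \<omega> (A (u # xs)) m | _ \<Rightarrow> 0)"
  define F where "F = (\<lambda>xs ys. case ys of [m] \<Rightarrow> \<alpha> (m # xs) | _ \<Rightarrow> 0)"
  have T: "?T \<in> alt_tforms p" using phi_alt[OF omega_bilinear A] by simp
  have \<alpha>: "\<alpha> \<in> alt_forms (p + 1)"
    unfolding \<alpha>_def by (rule alt_forms_compose_linear[OF lin_left A])
  have iA: "iota u A \<in> alt_forms p" using alt_forms_iota[OF A] by simp
  have G: "(\<lambda>xs. G xs ys) \<in> alt_forms p" for ys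
  proof (cases "\<exists>m. ys = [m]")
    case True
    then show ?thesis
      using alt_forms_compose_linear[OF lin_left iA] by (auto simp: G_def iota_def)
  next
    case False
    then have "(\<lambda>xs. G xs ys) = (\<lambda>_. 0)" by (auto simp: G_def split: list.splits)
    then show ?thesis by (simp add: alt_forms_zero)
  qed
  have G0: "G xs ys = 0" if "length ys \<noteq> 1" for xs ys
    using that by (auto simp: G_def split: list.splits)
  have F: "wedge_contract F us = (-1) ^ p * (real p + 1) * \<alpha> us"
  proof -
    have "wedge_contract F us = (-1) ^ (p + 1 + 1) * real (p + 1) * \<alpha> us"
      by (rule wedge_contract_koszul_form[OF \<alpha>]) (auto simp: F_def split: list.splits)
    then show ?thesis by (simp add: add.commute)
  qed
  have W1: "wedge_contract (\<lambda>ws. iota u (?T ws)) us = (-1) ^ p * (wedge_contract G us - wedge_contract F us)"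
  proof -
    have "(\<lambda>ws. iota u (?T ws)) = (\<lambda>xs ys. (-1) ^ p * (G xs ys - F xs ys))"
    proof (intro ext)
      fix xs ys
      show "iota u (?T xs) ys = (-1) ^ p * (G xs ys - F xs ys)"
      proof (cases "length ys = 1")
        case True
        then obtain m where "ys = [m]" by (auto simp: length_Suc_conv)
        then show ?thesis by (simp add: iota_def phi_pair[OF omega_bilinear A, simplified] G_def F_def \<alpha>_def)
      next
        case False
        then show ?thesis
          using alt_forms_length[OF alt_tforms_right[OF T], of "u # ys" xs]
          by (auto simp: iota_def G_def F_def split: list.splits)
      qed
    qed
    then show ?thesis by (simp only: wedge_contract_scale wedge_contract_diff)
  qed
  have W2: "wedge_contract (iota u ?T) us = real p * wedge_contract G us"
  proof -
    have "wedge_contract (\<lambda>xs ys. (-1) ^ (p + 1) * iota u ?T xs ys) us = (-1) ^ (p + 1) * real p * wedge_contract G us"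
      using G G0
    proof (rule wedge_contract_koszul_one_form)
      show "(-1) ^ (p + 1) * iota u ?T xs [l, m] = G (l # xs) [m] - G (m # xs) [l]" for xs l m
        using alt_forms_swap[OF A, of l u xs] alt_forms_swap[OF A, of m u xs]
        by (simp add: iota_def phi_pair[OF omega_bilinear A, simplified] G_def linear_neg[OF lin_left] flip: mult.assoc power_mult_distrib)
      show "(-1) ^ (p + 1) * iota u ?T xs ys = 0" if "length ys \<noteq> 2" for xs ys
        using alt_forms_length[OF alt_tforms_right[OF T] that] by (simp add: iota_def)
    qed
    then show ?thesis unfolding wedge_contract_scale by simp
  qed
  have "\<omega> u (r_inv \<omega> p ?T us) = - \<alpha> us"
  proof -
    \<comment> \<open>The values of the two Koszul lemmas enter with \<open>P = p\<close> and \<open>s = (-1)^p\<close>.\<close>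
    have arith: "1 / (P + 1) * (s * (g - s * (P + 1) * a)) - s / (P * (P + 1)) * (P * g) = - (s * s) * a"
      if "P > 0" for P s g a :: real
    proof -
      have "s / (P * (P + 1)) * (P * g) = s * g / (P + 1)" using that by simp
      moreover have "P + 1 \<noteq> 0" using that by simp
      ultimately show ?thesis by (simp add: field_simps)
    qed
    show ?thesis
      unfolding omega_r_inv[OF T] W1 W2 F using arith[of "real p" "(-1) ^ p"] assms(2)
      by (simp flip: power_add)
  qed
  then show "\<omega> u (r_inv \<omega> p ?T us) = \<omega> u (A us)"
    using omega_swap[of u "A us"] by (simp add: \<alpha>_def)
qed

text \<open>Evaluating \<open>r T\<close> on two vectors gives three terms, as in the Koszul formula for the
  Levi-Civita connection; skew-symmetrising it in two arguments leaves \<open>T\<close>.\<close>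

lemma phi_r_inv_1:
  assumes T: "T \<in> alt_tforms 1"
  shows "phi \<omega> 2 (r_inv \<omega> 1 T) = T"
proof (rule tform_eqI)
  have r: "r_inv \<omega> 1 T \<in> alt_forms 2" using r_inv_alt[OF T] by (simp add: numeral_2_eq_2)
  show "phi \<omega> 2 (r_inv \<omega> 1 T) us \<in> alt_forms 2" for us
    using alt_tforms_right[OF phi_alt[OF omega_bilinear r]] .
  show "T us \<in> alt_forms 2" for us using alt_tforms_right[OF T] .
  fix us u v
  show "phi \<omega> 2 (r_inv \<omega> 1 T) us [u, v] = T us [u, v]"
  proof (cases "length us = 1")
    case True
    then obtain w where us: "us = [w]" by (auto simp: length_Suc_conv)
    have T0: "T xs ys = 0" if "length xs \<noteq> 1 \<or> length ys \<noteq> 2" for xs ys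
      using that alt_forms_length[OF alt_tforms_left[OF T], of xs ys]
        alt_forms_length[OF alt_tforms_right[OF T], of ys xs] by auto
    have ev: "\<omega> a (r_inv \<omega> 1 T [b, c]) = (T [b] [a, c] - T [c] [a, b] + T [a] [b, c]) / 2" for a b c
      unfolding omega_r_inv[OF T]
      by (simp add: wedge_contract_Cons wedge_contract_Nil iota_def T0 field_simps)
    have sw: "T xs [a, b] = - T xs [b, a]" for xs a b
      by (rule alt_forms_swap[OF alt_tforms_right[OF T]])
    have "phi \<omega> 2 (r_inv \<omega> 1 T) us [u, v] = \<omega> v (r_inv \<omega> 1 T [u, w]) - \<omega> u (r_inv \<omega> 1 T [v, w])"
      unfolding us phi_pair[OF omega_bilinear r]
      using omega_swap[of "r_inv \<omega> 1 T [u, w]" v] omega_swap[of "r_inv \<omega> 1 T [v, w]" u] by simp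
    then show ?thesis
      unfolding ev us using sw[of "[w]" v u] sw[of "[v]" u w] sw[of "[u]" v w] by (simp add: field_simps)
  next
    case False
    then have "T us [u, v] = 0" "r_inv \<omega> 1 T (x # us) = 0" for x
      using alt_forms_length[OF alt_tforms_left[OF T]] alt_forms_length[OF r, of "x # us"] by auto
    then show ?thesis unfolding phi_pair[OF omega_bilinear r] by (simp add: linear_0[OF lin_left])
  qed
qed

section \<open>The operators on sections\<close>

lemma bounded_linear_left: "bounded_linear (\<lambda>v. \<omega> v w)"
  using lin_left linear_conv_bounded_linear by blast

lemma phi_sec_pair:
  "A \<in> Gamma_V p \<Longrightarrow> phi_sec \<omega> p A x us [u, v] =
    (-1) ^ (p - 1) * (\<omega> (A x (u # us)) v - \<omega> (A x (v # us)) u)"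
  unfolding phi_sec_def by (rule phi_pair[OF omega_bilinear Gamma_VD(1)])

lemma smooth_one_form:
  "(\<And>w. smooth (\<lambda>x. f x w)) \<Longrightarrow> smooth (\<lambda>x. one_form (f x) ys)"
proof (cases "\<exists>v. ys = [v]")
  case False
  then have "one_form (f x) ys = 0" for x by (auto simp: one_form_def split: list.splits)
  then show ?thesis by (simp add: smooth_const)
qed (auto simp: one_form_def)

lemma phi_sec_Gamma:
  assumes A: "A \<in> Gamma_V p" shows "phi_sec \<omega> p A \<in> Gamma_T (p - 1)"
proof (rule Gamma_TI)
  show "phi_sec \<omega> p A x \<in> alt_tforms (p - 1)" for x
    unfolding phi_sec_def by (rule phi_alt[OF omega_bilinear Gamma_VD(1)[OF A]])
  show "smooth (\<lambda>x. phi_sec \<omega> p A x us vs)" for us vs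
    unfolding phi_sec_def phi_def iota_def
    by (intro smooth_mult smooth_const smooth_sum smooth_wedge smooth_one_form
        smooth_bounded_linear[OF bounded_linear_left] Gamma_VD(2)[OF A])
qed

lemma r_sec_Gamma:
  assumes T: "T \<in> Gamma_T p" and p: "p \<ge> 1" shows "r_sec \<omega> p T \<in> Gamma_V (p + 1)"
proof (rule Gamma_VI)
  show "r_sec \<omega> p T x \<in> alt_forms (p + 1)" for x
    unfolding r_sec_def by (rule r_inv_alt[OF Gamma_TD(1)[OF T] p])
  show "smooth (\<lambda>x. r_sec \<omega> p T x us)" for us
    unfolding r_sec_def r_inv_def iota_def
    by (intro smooth_sum smooth_scaleR smooth_diff smooth_mult smooth_const smooth_wedge_contract
        Gamma_TD(2)[OF T])
qed

lemma r_sec_phi_sec: "A \<in> Gamma_V (p + 1) \<Longrightarrow> p \<ge> 1 \<Longrightarrow> r_sec \<omega> p (phi_sec \<omega> (p + 1) A) = A"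
  unfolding r_sec_def phi_sec_def by (intro ext) (simp only: r_inv_phi Gamma_VD)

lemma phi_sec_r_sec_1: "T \<in> Gamma_T 1 \<Longrightarrow> phi_sec \<omega> 2 (r_sec \<omega> 1 T) = T"
  unfolding r_sec_def phi_sec_def by (intro ext) (simp only: phi_r_inv_1 Gamma_TD)

lemma phi2_inv_sec_eq:
  assumes T: "T \<in> Gamma_T 1" shows "phi2_inv_sec \<omega> T = r_sec \<omega> 1 T"
proof
  fix x
  have "inj_on (phi \<omega> 2) (alt_forms 2)"
    by (rule inj_on_inverseI[of _ "r_inv \<omega> 1"]) (use r_inv_phi[of _ 1] in \<open>simp add: numeral_2_eq_2\<close>)
  moreover have "r_inv \<omega> 1 (T x) \<in> alt_forms 2"
    using r_inv_alt[OF Gamma_TD(1)[OF T]] by (simp add: numeral_2_eq_2)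
  ultimately have "the_inv_into (alt_forms 2) (phi \<omega> 2) (phi \<omega> 2 (r_inv \<omega> 1 (T x))) = r_inv \<omega> 1 (T x)"
    by (rule the_inv_into_f_f)
  then show "phi2_inv_sec \<omega> T x = r_sec \<omega> 1 T x"
    unfolding phi_r_inv_1[OF Gamma_TD(1)[OF T]] by (simp add: phi2_inv_sec_def r_sec_def)
qed

lemma phi_sec_add:
  assumes "A \<in> Gamma_V p" "B \<in> Gamma_V p"
  shows "phi_sec \<omega> p (A + B) = phi_sec \<omega> p A + phi_sec \<omega> p B"
proof (rule tsection_eqI)
  show "phi_sec \<omega> p (A + B) \<in> Gamma_T (p - 1)" "phi_sec \<omega> p A + phi_sec \<omega> p B \<in> Gamma_T (p - 1)"
    by (intro phi_sec_Gamma Gamma_V_add Gamma_T_add assms)+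
  show "phi_sec \<omega> p (A + B) x us [u, v] = (phi_sec \<omega> p A + phi_sec \<omega> p B) x us [u, v]" for x us u v
    by (simp add: phi_sec_pair assms Gamma_V_add linear_add[OF lin_left] algebra_simps)
qed

lemma phi_sec_scale:
  assumes "A \<in> Gamma_V p"
  shows "phi_sec \<omega> p (\<lambda>x us. c *\<^sub>R A x us) = (\<lambda>x us vs. c * phi_sec \<omega> p A x us vs)"
proof (rule tsection_eqI)
  show "phi_sec \<omega> p (\<lambda>x us. c *\<^sub>R A x us) \<in> Gamma_T (p - 1)"
    "(\<lambda>x us vs. c * phi_sec \<omega> p A x us vs) \<in> Gamma_T (p - 1)"
    by (intro phi_sec_Gamma Gamma_V_scale Gamma_T_scale assms)+
  show "phi_sec \<omega> p (\<lambda>x us. c *\<^sub>R A x us) x us [u, v] = c * phi_sec \<omega> p A x us [u, v]" for x us u v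
    by (simp add: phi_sec_pair assms Gamma_V_scale linear_scale[OF lin_left] algebra_simps)
qed

lemma phi_sec_zero: "phi_sec \<omega> p 0 = 0"
proof -
  have "phi_sec \<omega> p (\<lambda>x us. 0 *\<^sub>R (0::'a vsection) x us) = (\<lambda>x us vs. 0 * phi_sec \<omega> p 0 x us vs)"
    by (rule phi_sec_scale[OF Gamma_V_zero])
  then show ?thesis by (simp add: zero_fun_def)
qed

lemma r_sec_add: "r_sec \<omega> p (S + T) = r_sec \<omega> p S + r_sec \<omega> p T"
  by (intro ext) (simp only: r_sec_def r_inv_def iota_def plus_fun_def wedge_contract_add
      sum.distrib[symmetric], rule sum.cong[OF refl], simp add: algebra_simps)

lemma r_sec_diff: "r_sec \<omega> p (S - T) = r_sec \<omega> p S - r_sec \<omega> p T"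
  using r_sec_add[of p "S - T" T] by (simp add: eq_diff_eq)

lemma del_phi_sec:
  assumes A: "A \<in> Gamma_V p" and p: "p \<ge> 2"
  shows "del (phi_sec \<omega> p A) = - phi_sec \<omega> (p - 1) (d_op A)"
proof (rule tsection_eqI)
  have ph: "phi_sec \<omega> p A \<in> Gamma_T (p - 1)" by (rule phi_sec_Gamma[OF A])
  show "del (phi_sec \<omega> p A) \<in> Gamma_T (p - 1 - 1)" by (rule del_Gamma[OF ph])
  show "- phi_sec \<omega> (p - 1) (d_op A) \<in> Gamma_T (p - 1 - 1)"
    by (intro Gamma_T_minus phi_sec_Gamma d_op_Gamma A)
  define k where "k = p - 2"
  then have k: "p = Suc (Suc k)" using p by simp
  show "del (phi_sec \<omega> p A) x us [u, v] = (- phi_sec \<omega> (p - 1) (d_op A)) x us [u, v]" for x us u v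
    unfolding del_eq[OF ph] uminus_apply phi_sec_pair[OF A] phi_sec_pair[OF d_op_Gamma[OF A]] d_op_eq[OF A]
      alt_forms_swap[OF Gamma_VD(1)[OF A, of x], of u x] alt_forms_swap[OF Gamma_VD(1)[OF A, of x], of v x]
      linear_neg[OF lin_left]
    by (simp add: k algebra_simps)
qed

text \<open>The pointwise identity together with the fact that \<open>\<phi>\<close> has constant coefficients, so that the anchor
  terms agree. The second term on the right is \<open>[\<phi>A, B]\<close>, written with the arguments exchanged.\<close>

lemma phi_sec_bracket_VV:
  assumes A: "A \<in> Gamma_V p" and B: "B \<in> Gamma_V q" and p: "p \<ge> 1" and q: "q \<ge> 2"
  shows "phi_sec \<omega> (p + q - 1) (bracket_VV p q A B) =
    (\<lambda>x us vs. (-1) ^ (p + 1) * bracket_VT p A (phi_sec \<omega> q B) x us vs)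
    - (\<lambda>x us vs. (-1) ^ (p * (q + 1)) * bracket_VT q B (phi_sec \<omega> p A) x us vs)" (is "_ = ?R")
proof (rule tsection_eqI)
  have br: "bracket_VV p q A B \<in> Gamma_V (p + q - 1)"
    using bracket_VV_Gamma[OF A B p] q by simp
  show "phi_sec \<omega> (p + q - 1) (bracket_VV p q A B) \<in> Gamma_T (p + q - 2)"
    using phi_sec_Gamma[OF br] by (simp add: numeral_2_eq_2)
  have "bracket_VT p A (phi_sec \<omega> q B) \<in> Gamma_T (p + q - 2)"
    using bracket_VT_Gamma[OF A phi_sec_Gamma[OF B] p] q by (simp add: numeral_2_eq_2)
  moreover have "bracket_VT q B (phi_sec \<omega> p A) \<in> Gamma_T (p + q - 2)"
  proof -
    have "q + (p - 1) - 1 = p + q - 2" using p q by simp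
    then show ?thesis using bracket_VT_Gamma[OF B phi_sec_Gamma[OF A]] q by (metis le_trans one_le_numeral)
  qed
  ultimately show "?R \<in> Gamma_T (p + q - 2)" by (intro Gamma_T_diff Gamma_T_scale)
  fix x us u v
  have lie: "phi \<omega> (p + q - 1) (alg_bracket_VV p q (A x) (B x)) us [u, v] =
      (-1) ^ (p + 1) * alg_bracket_VT p (A x) (phi \<omega> q (B x)) us [u, v]
      - (-1) ^ (p * (q + 1)) * alg_bracket_VT q (B x) (phi \<omega> p (A x)) us [u, v]"
    using phi_alg_bracket_VV[OF omega_bilinear omega_self Gamma_VD(1)[OF A] Gamma_VD(1)[OF B] p] q by simp
  have lv: "alg_bracket_VV p q (A x) (B x) \<in> alt_forms (p + q - 1)"
    using alg_bracket_VV_alt[OF Gamma_VD(1)[OF A] Gamma_VD(1)[OF B] p] q by simp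
  have rho: "rho A (\<lambda>y. phi_sec \<omega> q B y us [u, v]) x = (-1) ^ (q - 1) *
      (\<omega> (rho A (\<lambda>y. B y (u # us)) x) v - \<omega> (rho A (\<lambda>y. B y (v # us)) x) u)"
  proof -
    let ?f = "\<lambda>a b y. \<omega> (B y (a # us)) b"
    have s: "smooth (?f a b)" for a b
      by (rule smooth_bounded_linear[OF bounded_linear_left Gamma_VD(2)[OF B]])
    have "rho A (\<lambda>y. phi_sec \<omega> q B y us [u, v]) x = (-1) ^ (q - 1) * rho A (\<lambda>y. ?f u v y + - ?f v u y) x"
      unfolding phi_sec_pair[OF B]
      using rho_bounded_linear[OF bounded_linear_mult_right smooth_diff[OF s[of u v] s[of v u]], of A "(-1) ^ (q - 1)" x]
      by simp
    also have "rho A (\<lambda>y. ?f u v y + - ?f v u y) x = rho A (?f u v) x - rho A (?f v u) x"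
      using frechet_add[OF s[of u v] smooth_minus[OF s[of v u]], of x] rho_minus[OF s[of v u], of A x]
      by (simp add: rho_def)
    also have "\<dots> = \<omega> (rho A (\<lambda>y. B y (u # us)) x) v - \<omega> (rho A (\<lambda>y. B y (v # us)) x) u"
      by (simp only: rho_bounded_linear[OF bounded_linear_left Gamma_VD(2)[OF B]])
    finally show ?thesis .
  qed
  have "phi_sec \<omega> (p + q - 1) (bracket_VV p q A B) x us [u, v] =
      phi \<omega> (p + q - 1) (alg_bracket_VV p q (A x) (B x)) us [u, v] + (if p = 1 then (-1) ^ (p + q - 1 - 1) *
      (\<omega> (rho A (\<lambda>y. B y (u # us)) x) v - \<omega> (rho A (\<lambda>y. B y (v # us)) x) u) else 0)"
    unfolding phi_sec_pair[OF br] phi_pair[OF omega_bilinear lv] bracket_VV_eq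
    using q by (simp add: linear_add[OF lin_left] linear_0[OF lin_left] algebra_simps)
  then show "phi_sec \<omega> (p + q - 1) (bracket_VV p q A B) x us [u, v] = ?R x us [u, v]"
    unfolding lie using q by (auto simp: bracket_VT_eq phi_sec_def rho[unfolded phi_sec_def])
qed

text \<open>In degree \<open>1\<close>, \<open>\<phi> A\<close> is the two-form \<open>\<omega>(A u, v) + \<omega>(u, A v)\<close>.\<close>

lemma Gamma_sp_iff: "A \<in> Gamma_sp \<omega> \<longleftrightarrow> A \<in> Gamma_V 1 \<and> phi_sec \<omega> 1 A = 0"
proof
  assume A: "A \<in> Gamma_sp \<omega>"
  then have V: "A \<in> Gamma_V 1" by (simp add: Gamma_sp_def)
  have "phi_sec \<omega> 1 A = 0"
  proof (rule tsection_eqI[OF phi_sec_Gamma[OF V] Gamma_T_zero])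
    fix x us u v
    have "\<omega> (A x [u]) v + \<omega> u (A x [v]) = 0"
      using A by (simp add: Gamma_sp_def sp_def)
    then have "\<omega> (A x [u]) v = \<omega> (A x [v]) u" using omega_swap[of u "A x [v]"] by simp
    moreover have "A x (w # us) = 0" if "us \<noteq> []" for w
      using that by (intro alt_forms_length[OF Gamma_VD(1)[OF V]]) simp
    ultimately show "phi_sec \<omega> 1 A x us [u, v] = (0::'a tsection) x us [u, v]"
      by (cases "us = []") (simp_all add: phi_sec_pair[OF V, simplified] linear_0[OF lin_left])
  qed
  with V show "A \<in> Gamma_V 1 \<and> phi_sec \<omega> 1 A = 0" by simp
next
  assume A: "A \<in> Gamma_V 1 \<and> phi_sec \<omega> 1 A = 0"
  have "\<omega> (A x [u]) v + \<omega> u (A x [v]) = 0" for x u v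
    using phi_sec_pair[of A 1 x "[]" u v] A omega_swap[of u "A x [v]"] by simp
  then show "A \<in> Gamma_sp \<omega>" using A by (simp add: Gamma_sp_def sp_def Gamma_VD)
qed

text \<open>Hence the action of \<open>sp(V, \<omega>)\<close> descends to the cokernels of \<open>\<phi>\<close>.\<close>

lemma phi_sec_bracket_sp:
  assumes A: "A \<in> Gamma_sp \<omega>" and B: "B \<in> Gamma_V q" and q: "q \<ge> 2"
  shows "phi_sec \<omega> q (bracket_VV 1 q A B) = bracket_VT 1 A (phi_sec \<omega> q B)"
proof -
  have "A \<in> Gamma_V 1" "phi_sec \<omega> 1 A = 0" using A by (auto simp: Gamma_sp_iff)
  with phi_sec_bracket_VV[OF _ B _ q, of A 1] show ?thesis
    by (intro ext) (simp add: bracket_VT_zero_right)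
qed

section \<open>The image of phi and its cosets\<close>

lemma im_phi_Gamma: "k \<in> im_phi \<omega> p \<Longrightarrow> k \<in> Gamma_T (p - 1)"
  by (auto simp: im_phi_def simp del: One_nat_def intro: phi_sec_Gamma)

lemma im_phi_zero: "0 \<in> im_phi \<omega> p"
  unfolding im_phi_def using Gamma_V_zero phi_sec_zero by (metis image_eqI)

lemma im_phi_add: "a \<in> im_phi \<omega> p \<Longrightarrow> b \<in> im_phi \<omega> p \<Longrightarrow> a + b \<in> im_phi \<omega> p"
  unfolding im_phi_def by (auto simp flip: phi_sec_add intro: Gamma_V_add)

lemma im_phi_scale: "a \<in> im_phi \<omega> p \<Longrightarrow> (\<lambda>x us vs. c * a x us vs) \<in> im_phi \<omega> p"
  unfolding im_phi_def by (auto simp flip: phi_sec_scale intro: Gamma_V_scale)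

lemma im_phi_minus: "a \<in> im_phi \<omega> p \<Longrightarrow> - a \<in> im_phi \<omega> p"
  using im_phi_scale[of a p "-1"] by (simp add: fun_Compl_def)

lemma im_phi_plus_im_phi: "im_phi \<omega> p + im_phi \<omega> p = im_phi \<omega> p"
  using im_phi_add im_phi_zero by (auto simp: set_plus_def) (metis add_0)

lemma del_im_phi:
  assumes "k \<in> im_phi \<omega> p" "p \<ge> 2" shows "del k \<in> im_phi \<omega> (p - 1)"
proof -
  obtain B where B: "B \<in> Gamma_V p" "k = phi_sec \<omega> p B" using assms by (auto simp: im_phi_def)
  have "phi_sec \<omega> (p - 1) (d_op B) \<in> im_phi \<omega> (p - 1)" using d_op_Gamma[OF B(1)] by (auto simp: im_phi_def)
  then show ?thesis using im_phi_minus by (simp add: B del_phi_sec[OF B(1) assms(2)])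
qed

lemma bracket_sp_im_phi:
  assumes "A \<in> Gamma_sp \<omega>" "k \<in> im_phi \<omega> p" "p \<ge> 2" shows "bracket_VT 1 A k \<in> im_phi \<omega> p"
proof -
  obtain B where B: "B \<in> Gamma_V p" "k = phi_sec \<omega> p B" using assms by (auto simp: im_phi_def)
  have "bracket_VV 1 p A B \<in> Gamma_V p"
    using bracket_VV_Gamma[OF _ B(1), of A 1] assms by (simp add: Gamma_sp_def)
  then show ?thesis
    unfolding B(2) phi_sec_bracket_sp[OF assms(1) B(1) assms(3), symmetric] by (auto simp: im_phi_def)
qed

lemma coset_eqI: "a - b \<in> im_phi \<omega> p \<Longrightarrow> a +o im_phi \<omega> p = b +o im_phi \<omega> p"
proof -
  assume k: "a - b \<in> im_phi \<omega> p"
  have "b - a \<in> im_phi \<omega> p" using im_phi_minus[OF k] by simp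
  have sub: "a +o im_phi \<omega> p \<subseteq> b +o im_phi \<omega> p" if "a - b \<in> im_phi \<omega> p" for a b
  proof
    fix z assume "z \<in> a +o im_phi \<omega> p"
    then obtain c where "c \<in> im_phi \<omega> p" "z = a + c" by (auto simp: elt_set_plus_def)
    then have "z = b + ((a - b) + c)" "(a - b) + c \<in> im_phi \<omega> p" using im_phi_add[OF that] by auto
    then show "z \<in> b +o im_phi \<omega> p" unfolding elt_set_plus_def by blast
  qed
  show ?thesis using sub[OF k] sub[OF \<open>b - a \<in> im_phi \<omega> p\<close>] by blast
qed

lemma coset_nonempty: "\<eta> +o im_phi \<omega> p \<noteq> {}"
  using im_phi_zero unfolding elt_set_plus_def by blast

lemma coset_add: "(a +o im_phi \<omega> p) + (b +o im_phi \<omega> p) = (a + b) +o im_phi \<omega> p"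
  by (simp add: set_plus_rearrange im_phi_plus_im_phi)

lemma coset_sum: "finite I \<Longrightarrow> (a +o im_phi \<omega> p) + (\<Sum>i\<in>I. f i +o im_phi \<omega> p) = (a + (\<Sum>i\<in>I. f i)) +o im_phi \<omega> p"
proof (induction I arbitrary: a rule: finite_induct)
  case empty then show ?case by simp
next
  case (insert i I)
  show ?case
    unfolding sum.insert[OF insert.hyps] add.assoc[symmetric] coset_add insert.IH ..
qed

lemma coset_UN_im_phi:
  assumes "\<And>k. k \<in> im_phi \<omega> p \<Longrightarrow> F (\<eta> + k) - F \<eta> \<in> im_phi \<omega> q"
  shows "(\<Union>\<xi>\<in>\<eta> +o im_phi \<omega> p. F \<xi> +o im_phi \<omega> q) = F \<eta> +o im_phi \<omega> q"
  by (rule coset_UN) (use im_phi_zero im_phi_add assms in auto)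

section \<open>The complex in terms of representatives\<close>

text \<open>Elements of the complex by representatives \<open>\<eta> p\<close> of their components. The values of \<open>\<eta>\<close> at \<open>0\<close> and \<open>1\<close> are
  ignored, as those entries carry no information.\<close>

definition cx_of :: "'a vsection \<Rightarrow> (nat \<Rightarrow> 'a tsection) \<Rightarrow> 'a cx" where
  "cx_of A \<eta> = (A, \<lambda>p. if p < 2 then zero_class \<omega> p else \<eta> p +o im_phi \<omega> (p + 1))"

lemma eq_cx_ofI:
  assumes "fst c = A" "\<And>p. p < 2 \<Longrightarrow> snd c p = zero_class \<omega> p"
    and "\<And>p. p \<ge> 2 \<Longrightarrow> snd c p = \<eta> p +o im_phi \<omega> (p + 1)"
  shows "c = cx_of A \<eta>"
proof (rule prod_eqI)
  show "snd c = snd (cx_of A \<eta>)"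
  proof (rule ext)
    show "snd c p = snd (cx_of A \<eta>) p" for p
      by (cases "p < 2") (simp_all add: assms cx_of_def)
  qed
qed (simp add: cx_of_def assms)

lemma cx_of_eqI:
  assumes "A = B" "\<And>p. p \<ge> 2 \<Longrightarrow> \<eta> p - \<zeta> p \<in> im_phi \<omega> (p + 1)"
  shows "cx_of A \<eta> = cx_of B \<zeta>"
proof -
  have "(if p < 2 then zero_class \<omega> p else \<eta> p +o im_phi \<omega> (p + 1)) = (if p < 2 then zero_class \<omega> p else \<zeta> p +o im_phi \<omega> (p + 1))" for p
    using coset_eqI[OF assms(2), of p] by simp
  then show ?thesis unfolding cx_of_def assms(1) by presburger
qed

lemma cx_of_add: "cx_of A \<eta> + cx_of B \<zeta> = cx_of (A + B) (\<lambda>p. \<eta> p + \<zeta> p)"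
proof -
  have "(\<lambda>p. if p < 2 then zero_class \<omega> p else \<eta> p +o im_phi \<omega> (p + 1)) + (\<lambda>p. if p < 2 then zero_class \<omega> p else \<zeta> p +o im_phi \<omega> (p + 1))
      = (\<lambda>p. if p < 2 then zero_class \<omega> p else (\<eta> p + \<zeta> p) +o im_phi \<omega> (p + 1))"
  proof (rule ext, goal_cases)
    case (1 p)
    show ?case by (cases "p < 2") (simp_all add: zero_class_def im_phi_plus_im_phi coset_add)
  qed
  then show ?thesis unfolding cx_of_def add_Pair by (simp only:)
qed

lemma cx_scale_cx_of: "cx_scale \<omega> s (cx_of A \<eta>) = cx_of (\<lambda>x us. s *\<^sub>R A x us) (\<lambda>p x us vs. s * \<eta> p x us vs)"
proof -
  have 1: "(\<Union>\<xi>\<in>\<eta> +o im_phi \<omega> p. (\<lambda>x us vs. s * \<xi> x us vs) +o im_phi \<omega> p) = (\<lambda>x us vs. s * \<eta> x us vs) +o im_phi \<omega> p"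
    for \<eta> :: "'a tsection" and p
  proof (rule coset_UN_im_phi)
    fix k assume "k \<in> im_phi \<omega> p"
    then have "(\<lambda>x us vs. s * k x us vs) \<in> im_phi \<omega> p" by (rule im_phi_scale)
    then show "(\<lambda>x us vs. s * (\<eta> + k) x us vs) - (\<lambda>x us vs. s * \<eta> x us vs) \<in> im_phi \<omega> p"
      by (simp add: plus_fun_def fun_diff_def distrib_left)
  qed
  have 2: "(\<Union>\<xi>\<in>im_phi \<omega> p. (\<lambda>x us vs. s * \<xi> x us vs) +o im_phi \<omega> p) = im_phi \<omega> p" for p
  proof -
    have "(\<lambda>x us vs. s * (0::'a tsection) x us vs) = 0" by (intro ext) simp
    then show ?thesis using 1[where \<eta>=0 and p=p] by (simp only: set_zero_plus)
  qed
  have "(\<Union>\<xi>\<in>(if p < 2 then zero_class \<omega> p else \<eta> p +o im_phi \<omega> (p + 1)). (\<lambda>x us vs. s * \<xi> x us vs) +o im_phi \<omega> (p + 1))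
      = (if p < 2 then zero_class \<omega> p else (\<lambda>x us vs. s * \<eta> p x us vs) +o im_phi \<omega> (p + 1))" for p
    by (cases "p < 2") (simp_all only: if_True if_False zero_class_def 1 2)
  then show ?thesis
    unfolding cx_scale_def cx_of_def fst_conv snd_conv by presburger
qed

text \<open>A change of the representative by \<open>\<phi>_3 B\<close> changes \<open>\<phi>_2\<^sup>-\<^sup>1 \<partial> T\<close> by \<open>- dB\<close>, which is killed by \<open>d\<close>.\<close>

lemma diff_last_shift:
  assumes T: "T \<in> Gamma_T 2" and k: "k \<in> im_phi \<omega> 3"
  shows "d_op (r_sec \<omega> 1 (del (T + k))) = d_op (r_sec \<omega> 1 (del T))"
proof -
  obtain B where B: "B \<in> Gamma_V 3" "k = phi_sec \<omega> 3 B" using k by (auto simp: im_phi_def)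
  have dB: "d_op B \<in> Gamma_V 2" using d_op_Gamma[OF B(1)] by simp
  have "del k = - phi_sec \<omega> 2 (d_op B)" using del_phi_sec[OF B(1)] B(2) by simp
  then have "r_sec \<omega> 1 (del (T + k)) = r_sec \<omega> 1 (del T) - r_sec \<omega> 1 (phi_sec \<omega> 2 (d_op B))"
    by (simp add: del_add flip: r_sec_diff)
  also have "r_sec \<omega> 1 (phi_sec \<omega> 2 (d_op B)) = d_op B"
    using r_sec_phi_sec[of "d_op B" 1] dB by (simp add: numeral_2_eq_2)
  finally have e: "r_sec \<omega> 1 (del (T + k)) = r_sec \<omega> 1 (del T) - d_op B" .
  show ?thesis unfolding e d_op_diff d_op_d_op[OF B(1)] by simp
qed

definition last_diff :: "'a tsection \<Rightarrow> 'a vsection" where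
  "last_diff T = d_op (r_sec \<omega> 1 (del T))"

lemma last_diff_zero: "last_diff 0 = 0"
  using r_sec_diff[of 1 0 0] by (simp add: last_diff_def del_zero d_op_zero)

lemma r_del_Gamma: "T \<in> Gamma_T p \<Longrightarrow> p \<ge> 2 \<Longrightarrow> r_sec \<omega> (p - 1) (del T) \<in> Gamma_V p"
  using r_sec_Gamma[OF del_Gamma, of T p] by simp

text \<open>This uses \<open>\<phi>d = - \<partial>\<phi>\<close> and \<open>\<partial>\<partial> = 0\<close>.\<close>

lemma last_diff_sp:
  assumes T: "T \<in> Gamma_T 2" shows "last_diff T \<in> Gamma_sp \<omega>"
proof -
  have r: "r_sec \<omega> 1 (del T) \<in> Gamma_V 2" using r_del_Gamma[OF T] by simp
  have "phi_sec \<omega> 1 (last_diff T) = - del (phi_sec \<omega> 2 (r_sec \<omega> 1 (del T)))"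
    unfolding last_diff_def using del_phi_sec[OF r] by simp
  also have "phi_sec \<omega> 2 (r_sec \<omega> 1 (del T)) = del T"
    by (rule phi_sec_r_sec_1) (use del_Gamma[OF T] in simp)
  finally have "phi_sec \<omega> 1 (last_diff T) = 0" unfolding del_del[OF T] minus_zero .
  then show ?thesis
    using d_op_Gamma[OF r] unfolding Gamma_sp_iff last_diff_def by simp
qed

lemma cx_diff_cx_of:
  assumes \<eta>: "\<And>p. p \<ge> 2 \<Longrightarrow> \<eta> p \<in> Gamma_T p"
  shows "cx_diff \<omega> (cx_of A \<eta>) = cx_of (last_diff (\<eta> 2)) (\<lambda>p. del (\<eta> (p + 1)))"
proof -
  have shift: "d_op (phi2_inv_sec \<omega> (del \<xi>)) = last_diff (\<eta> 2)" if \<xi>: "\<xi> \<in> \<eta> 2 +o im_phi \<omega> 3" for \<xi>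
  proof -
    obtain k where k: "k \<in> im_phi \<omega> 3" "\<xi> = \<eta> 2 + k" using \<xi> unfolding elt_set_plus_def by blast
    have "\<xi> \<in> Gamma_T 2" unfolding k(2) using im_phi_Gamma[OF k(1)] by (intro Gamma_T_add \<eta>) auto
    from del_Gamma[OF this] have "phi2_inv_sec \<omega> (del \<xi>) = r_sec \<omega> 1 (del \<xi>)"
      by (intro phi2_inv_sec_eq) simp
    then show ?thesis using diff_last_shift[OF \<eta> k(1)] k(2) by (simp add: last_diff_def)
  qed
  have "(\<lambda>\<xi>. d_op (phi2_inv_sec \<omega> (del \<xi>))) ` (\<eta> 2 +o im_phi \<omega> 3) = (\<lambda>\<xi>. last_diff (\<eta> 2)) ` (\<eta> 2 +o im_phi \<omega> 3)"
    by (rule image_cong[OF refl shift])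
  also have "\<dots> = {last_diff (\<eta> 2)}"
    unfolding image_constant_conv using coset_nonempty by simp
  finally have 1: "diff_last \<omega> (\<eta> 2 +o im_phi \<omega> 3) = last_diff (\<eta> 2)" by (simp add: diff_last_def)
  have 2: "del_bar \<omega> (p + 1) (\<eta> (p + 1) +o im_phi \<omega> (p + 1 + 1)) = del (\<eta> (p + 1)) +o im_phi \<omega> (p + 1)" if "p \<ge> 2" for p
    unfolding del_bar_def
  proof (rule coset_UN_im_phi)
    fix k assume "k \<in> im_phi \<omega> (p + 1 + 1)"
    then show "del (\<eta> (p + 1) + k) - del (\<eta> (p + 1)) \<in> im_phi \<omega> (p + 1)"
      using del_im_phi[of k "p + 1 + 1"] by (simp add: del_add)
  qed
  show ?thesis
  proof (rule eq_cx_ofI)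
    show "fst (cx_diff \<omega> (cx_of A \<eta>)) = last_diff (\<eta> 2)"
      unfolding cx_diff_def fst_conv using 1 by (simp add: cx_of_def)
    show "snd (cx_diff \<omega> (cx_of A \<eta>)) p = zero_class \<omega> p" if "p < 2" for p
      using that by (simp add: cx_diff_def)
    show "snd (cx_diff \<omega> (cx_of A \<eta>)) p = del (\<eta> (p + 1)) +o im_phi \<omega> (p + 1)" if "p \<ge> 2" for p
      using 2[OF that] that by (simp add: cx_diff_def cx_of_def)
  qed
qed

lemma P_Gamma: "T \<in> Gamma_T p \<Longrightarrow> p \<ge> 1 \<Longrightarrow> P_op \<omega> p T \<in> Gamma_T p"
  unfolding P_op_def using phi_sec_Gamma[OF r_sec_Gamma, of T p] by (intro Gamma_T_diff) auto

lemma r_phi: "A \<in> Gamma_V p \<Longrightarrow> p \<ge> 2 \<Longrightarrow> r_sec \<omega> (p - 1) (phi_sec \<omega> p A) = A"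
  using r_sec_phi_sec[of A "p - 1"] by simp

lemma P_diff:
  assumes "S \<in> Gamma_T p" "T \<in> Gamma_T p" "p \<ge> 1"
  shows "P_op \<omega> p (S - T) = P_op \<omega> p S - P_op \<omega> p T"
proof -
  have "phi_sec \<omega> (p + 1) (r_sec \<omega> p S) = phi_sec \<omega> (p + 1) (r_sec \<omega> p (S - T)) + phi_sec \<omega> (p + 1) (r_sec \<omega> p T)"
    unfolding phi_sec_add[OF r_sec_Gamma[OF Gamma_T_diff[OF assms(1,2)] assms(3)] r_sec_Gamma[OF assms(2,3)], symmetric]
    by (simp add: r_sec_diff)
  then show ?thesis by (simp add: P_op_def)
qed

lemma P_im_phi:
  assumes "k \<in> im_phi \<omega> (p + 1)" "p \<ge> 1" shows "P_op \<omega> p k = 0"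
  using assms r_sec_phi_sec by (auto simp: im_phi_def P_op_def)

text \<open>As \<open>r\<phi> = id\<close>, the projection is zero on the image of \<open>\<phi>\<close>. This is why the bracket of two classes of
  negative degree is well defined.\<close>

lemma P_shift:
  assumes T: "T \<in> Gamma_T p" and k: "k \<in> im_phi \<omega> (p + 1)" and p: "p \<ge> 1"
  shows "P_op \<omega> p (T + k) = P_op \<omega> p T"
proof -
  have kG: "k \<in> Gamma_T p" using im_phi_Gamma[OF k] by simp
  have "P_op \<omega> p (T + k - T) = P_op \<omega> p (T + k) - P_op \<omega> p T"
    by (rule P_diff[OF Gamma_T_add[OF T kG] T p])
  then show ?thesis using P_im_phi[OF k p] by simp
qed

lemma P_eq: "P_op \<omega> p T = T + - phi_sec \<omega> (p + 1) (r_sec \<omega> p T)"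
  by (simp add: P_op_def)

lemma phi_r_im_phi: "T \<in> Gamma_T p \<Longrightarrow> p \<ge> 1 \<Longrightarrow> phi_sec \<omega> (p + 1) (r_sec \<omega> p T) \<in> im_phi \<omega> (p + 1)"
  unfolding im_phi_def by (intro imageI r_sec_Gamma)

text \<open>The element \<open>X = r\<partial>PS\<close> through which \<open>S\<close> acts in the bracket.\<close>

definition r_del_P :: "nat \<Rightarrow> 'a tsection \<Rightarrow> 'a vsection" where
  "r_del_P p S = r_sec \<omega> (p - 1) (del (P_op \<omega> p S))"

text \<open>The representative \<open>[X, PT] + [PS, Y]\<close> of the bracket of the classes of \<open>S\<close> and \<open>T\<close>, where \<open>X\<close> and \<open>Y\<close> are
  the elements \<open>r_del_P\<close> of \<open>S\<close> and \<open>T\<close>.\<close>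

definition bracket_rep :: "nat \<Rightarrow> nat \<Rightarrow> 'a tsection \<Rightarrow> 'a tsection \<Rightarrow> 'a tsection" where
  "bracket_rep p q S T = bracket_VT p (r_del_P p S) (P_op \<omega> q T) + bracket_TV p q (P_op \<omega> p S) (r_del_P q T)"

lemma r_del_P_Gamma: "S \<in> Gamma_T p \<Longrightarrow> p \<ge> 2 \<Longrightarrow> r_del_P p S \<in> Gamma_V p"
  unfolding r_del_P_def by (intro r_del_Gamma P_Gamma) auto

lemma bracket_rep_Gamma:
  assumes "S \<in> Gamma_T p" "T \<in> Gamma_T q" "p \<ge> 2" "q \<ge> 2"
  shows "bracket_rep p q S T \<in> Gamma_T (p + q - 1)"
proof -
  have "bracket_VT p (r_del_P p S) (P_op \<omega> q T) \<in> Gamma_T (p + q - 1)"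
    using assms by (intro bracket_VT_Gamma r_del_P_Gamma P_Gamma) auto
  moreover have "bracket_TV p q (P_op \<omega> p S) (r_del_P q T) \<in> Gamma_T (q + p - 1)"
    using assms by (intro bracket_TV_Gamma r_del_P_Gamma P_Gamma) auto
  ultimately show ?thesis unfolding bracket_rep_def by (intro Gamma_T_add) (simp_all add: add.commute)
qed

lemma P_zero: "P_op \<omega> p 0 = 0"
  using r_sec_diff[of p 0 0] by (simp add: P_op_def phi_sec_zero)

lemma r_del_P_zero: "r_del_P p 0 = 0"
  using r_sec_diff[of "p - 1" 0 0] by (simp add: r_del_P_def P_zero del_zero)

lemma bracket_rep_zero_left: "T \<in> Gamma_T q \<Longrightarrow> q \<ge> 2 \<Longrightarrow> bracket_rep p q 0 T = 0"
  by (simp add: bracket_rep_def P_zero r_del_P_zero bracket_VT_zero_left[OF P_Gamma] bracket_TV_zero_left)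

lemma bracket_rep_zero_right: "S \<in> Gamma_T p \<Longrightarrow> p \<ge> 2 \<Longrightarrow> bracket_rep p q S 0 = 0"
  by (simp add: bracket_rep_def P_zero r_del_P_zero bracket_VT_zero_right bracket_TV_zero_right[OF P_Gamma])

lemma bracket_C_C_coset:
  assumes S: "S \<in> Gamma_T p" and T: "T \<in> Gamma_T q" and pq: "p \<ge> 2" "q \<ge> 2"
  shows "bracket_C_C \<omega> p q (S +o im_phi \<omega> (p + 1)) (T +o im_phi \<omega> (q + 1)) = bracket_rep p q S T +o im_phi \<omega> (p + q)"
proof -
  have P: "P_op \<omega> p S' = P_op \<omega> p S" if "S' \<in> S +o im_phi \<omega> (p + 1)" for S'
    using that P_shift[OF S] pq by (auto simp: elt_set_plus_def)
  have Q: "P_op \<omega> q T' = P_op \<omega> q T" if "T' \<in> T +o im_phi \<omega> (q + 1)" for T'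
    using that P_shift[OF T] pq by (auto simp: elt_set_plus_def)
  show ?thesis unfolding bracket_C_C_def bracket_rep_def r_del_P_def using coset_nonempty by (simp add: P Q)
qed

text \<open>The minus sign is that of \<open>bracket_TV_1\<close>.\<close>

definition cx_bracket_rep :: "'a vsection \<Rightarrow> (nat \<Rightarrow> 'a tsection) \<Rightarrow> 'a vsection \<Rightarrow> (nat \<Rightarrow> 'a tsection) \<Rightarrow> nat \<Rightarrow> 'a tsection" where
  "cx_bracket_rep A \<eta> B \<zeta> m = bracket_VT 1 A (\<zeta> m) - bracket_VT 1 B (\<eta> m)
     + (\<Sum>p\<in>{2..<m}. bracket_rep p (m + 1 - p) (\<eta> p) (\<zeta> (m + 1 - p)))"

lemma cx_bracket_cx_of:
  assumes A: "A \<in> Gamma_sp \<omega>" and B: "B \<in> Gamma_sp \<omega>"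
    and \<eta>: "\<And>p. p \<ge> 2 \<Longrightarrow> \<eta> p \<in> Gamma_T p" and \<zeta>: "\<And>p. p \<ge> 2 \<Longrightarrow> \<zeta> p \<in> Gamma_T p"
  shows "cx_bracket \<omega> (cx_of A \<eta>) (cx_of B \<zeta>) = cx_of (bracket_VV 1 1 A B) (cx_bracket_rep A \<eta> B \<zeta>)"
proof -
  have 1: "bracket_sp_C \<omega> m A (\<zeta> m +o im_phi \<omega> (m + 1)) = bracket_VT 1 A (\<zeta> m) +o im_phi \<omega> (m + 1)" if "m \<ge> 2" for m
    unfolding bracket_sp_C_def
  proof (rule coset_UN_im_phi)
    fix k assume k: "k \<in> im_phi \<omega> (m + 1)"
    then show "bracket_VT 1 A (\<zeta> m + k) - bracket_VT 1 A (\<zeta> m) \<in> im_phi \<omega> (m + 1)"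
      using bracket_sp_im_phi[OF A k] bracket_VT_add[OF \<zeta>[OF that], of k 1 A] im_phi_Gamma[OF k] that by simp
  qed
  have 2: "bracket_C_sp \<omega> m (\<eta> m +o im_phi \<omega> (m + 1)) B = (- bracket_VT 1 B (\<eta> m)) +o im_phi \<omega> (m + 1)" if "m \<ge> 2" for m
    unfolding bracket_C_sp_def bracket_TV_1
  proof (rule coset_UN_im_phi)
    fix k assume k: "k \<in> im_phi \<omega> (m + 1)"
    then show "- bracket_VT 1 B (\<eta> m + k) - - bracket_VT 1 B (\<eta> m) \<in> im_phi \<omega> (m + 1)"
      using im_phi_minus[OF bracket_sp_im_phi[OF B k]] bracket_VT_add[OF \<eta>[OF that], of k 1 B] im_phi_Gamma[OF k] that by simp
  qed
  have 3: "(\<Sum>p\<in>{2..<m}. bracket_C_C \<omega> p (m + 1 - p) (snd (cx_of A \<eta>) p) (snd (cx_of B \<zeta>) (m + 1 - p)))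
      = (\<Sum>p\<in>{2..<m}. bracket_rep p (m + 1 - p) (\<eta> p) (\<zeta> (m + 1 - p)) +o im_phi \<omega> (m + 1))" for m
  proof (rule sum.cong[OF refl])
    fix p assume p: "p \<in> {2..<m}"
    then have "p \<ge> 2" "m + 1 - p \<ge> 2" "p + (m + 1 - p) = m + 1" by auto
    then show "bracket_C_C \<omega> p (m + 1 - p) (snd (cx_of A \<eta>) p) (snd (cx_of B \<zeta>) (m + 1 - p))
        = bracket_rep p (m + 1 - p) (\<eta> p) (\<zeta> (m + 1 - p)) +o im_phi \<omega> (m + 1)"
      using bracket_C_C_coset[OF \<eta> \<zeta>, of p "m + 1 - p"] by (simp add: cx_of_def)
  qed
  have 4: "bracket_sp_C \<omega> m A (\<zeta> m +o im_phi \<omega> (m + 1)) + bracket_C_sp \<omega> m (\<eta> m +o im_phi \<omega> (m + 1)) B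
      + (\<Sum>p\<in>{2..<m}. bracket_C_C \<omega> p (m + 1 - p) (snd (cx_of A \<eta>) p) (snd (cx_of B \<zeta>) (m + 1 - p)))
      = cx_bracket_rep A \<eta> B \<zeta> m +o im_phi \<omega> (m + 1)" if "m \<ge> 2" for m
    unfolding 1[OF that] 2[OF that] 3 coset_add by (simp add: coset_sum cx_bracket_rep_def)
  show ?thesis
    unfolding cx_bracket_def cx_of_def[of "bracket_VV 1 1 A B"]
    using 4 by (auto simp: fun_eq_iff cx_of_def)
qed

lemma cx_bracket_rep_Gamma:
  assumes A: "A \<in> Gamma_sp \<omega>" and B: "B \<in> Gamma_sp \<omega>"
    and \<eta>: "\<And>p. p \<ge> 2 \<Longrightarrow> \<eta> p \<in> Gamma_T p" and \<zeta>: "\<And>p. p \<ge> 2 \<Longrightarrow> \<zeta> p \<in> Gamma_T p" and m: "m \<ge> 2"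
  shows "cx_bracket_rep A \<eta> B \<zeta> m \<in> Gamma_T m"
proof -
  have "bracket_rep p (m + 1 - p) (\<eta> p) (\<zeta> (m + 1 - p)) \<in> Gamma_T m" if "p \<in> {2..<m}" for p
  proof -
    have "p \<ge> 2" "m + 1 - p \<ge> 2" "p + (m + 1 - p) - 1 = m" using that by auto
    then show ?thesis using bracket_rep_Gamma[OF \<eta> \<zeta>, of p "m + 1 - p"] by (simp only:)
  qed
  moreover have "bracket_VT 1 A (\<zeta> m) \<in> Gamma_T m" "bracket_VT 1 B (\<eta> m) \<in> Gamma_T m"
    using bracket_VT_Gamma[of _ 1] A B \<eta>[OF m] \<zeta>[OF m] by (auto simp: Gamma_sp_def)
  ultimately show ?thesis unfolding cx_bracket_rep_def by (intro Gamma_T_add Gamma_T_diff Gamma_T_sum)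
qed

section \<open>The derivation property\<close>

text \<open>\<open>\<partial>S\<close> and \<open>\<partial>PS\<close> differ by an element of the image of \<open>\<phi>\<close>, whence \<open>P\<partial>S = P\<partial>PS = \<partial>PS - \<phi> r \<partial>PS\<close>. Applying \<open>\<partial>\<close>
  leaves \<open>- \<partial>\<phi>X = \<phi>dX\<close> for \<open>X = r\<partial>PS\<close>.\<close>

lemma P_del:
  assumes S: "S \<in> Gamma_T p" and p: "p \<ge> 3"
  shows "P_op \<omega> (p - 1) (del S) = del (P_op \<omega> p S) - phi_sec \<omega> p (r_del_P p S)"
    and "r_del_P (p - 1) (del S) = d_op (r_del_P p S)"
proof -
  have p1: "p \<ge> 1" "p - 1 \<ge> 1" "p \<ge> 2" "p - 1 + 1 = p" "p + 1 - 1 = p" using p by auto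
  have PS: "P_op \<omega> p S \<in> Gamma_T p" by (rule P_Gamma[OF S p1(1)])
  have dPS: "del (P_op \<omega> p S) \<in> Gamma_T (p - 1)" by (rule del_Gamma[OF PS])
  define k where "k = del (phi_sec \<omega> (p + 1) (r_sec \<omega> p S))"
  have k: "k \<in> im_phi \<omega> (p - 1 + 1)"
    using del_im_phi[OF phi_r_im_phi[OF S p1(1)]] p1 by (simp add: k_def)
  have "del S = del (P_op \<omega> p S) + k" by (simp add: P_op_def del_diff k_def)
  then have "P_op \<omega> (p - 1) (del S) = P_op \<omega> (p - 1) (del (P_op \<omega> p S))"
    using P_shift[OF dPS k p1(2)] by metis
  then show 1: "P_op \<omega> (p - 1) (del S) = del (P_op \<omega> p S) - phi_sec \<omega> p (r_del_P p S)"
    unfolding P_op_def[of \<omega> "p - 1" "del (P_op \<omega> p S)"] p1(4) r_del_P_def .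
  have r_del_P_S: "r_del_P p S \<in> Gamma_V p" by (rule r_del_P_Gamma[OF S p1(3)])
  have "del (P_op \<omega> (p - 1) (del S)) = phi_sec \<omega> (p - 1) (d_op (r_del_P p S))"
    unfolding 1 del_diff del_del[OF PS] del_phi_sec[OF r_del_P_S p1(3)] by simp
  then show "r_del_P (p - 1) (del S) = d_op (r_del_P p S)"
    unfolding r_del_P_def[of "p - 1"] using r_phi[OF d_op_Gamma[OF r_del_P_S]] p by simp
qed

text \<open>The counterpart of \<open>P_del\<close> at the end of the complex, where \<open>\<phi>_2\<close> is invertible.\<close>

lemma del_P_2:
  assumes S: "S \<in> Gamma_T 2"
  shows "phi_sec \<omega> 2 (r_del_P 2 S) = del (P_op \<omega> 2 S)" and "d_op (r_del_P 2 S) = last_diff S"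
proof -
  have "del (P_op \<omega> 2 S) \<in> Gamma_T 1" using del_Gamma[OF P_Gamma[OF S]] by simp
  then show "phi_sec \<omega> 2 (r_del_P 2 S) = del (P_op \<omega> 2 S)"
    using phi_sec_r_sec_1 by (simp add: r_del_P_def)
  have "- phi_sec \<omega> (2 + 1) (r_sec \<omega> 2 S) \<in> im_phi \<omega> (2 + 1)" by (rule im_phi_minus[OF phi_r_im_phi[OF S]]) simp
  then have k: "- phi_sec \<omega> (2 + 1) (r_sec \<omega> 2 S) \<in> im_phi \<omega> 3" by simp
  have "d_op (r_del_P 2 S) = d_op (r_sec \<omega> 1 (del (S + - phi_sec \<omega> (2 + 1) (r_sec \<omega> 2 S))))"
    by (simp only: r_del_P_def P_eq) simp
  also have "\<dots> = last_diff S" unfolding last_diff_def by (rule diff_last_shift[OF S k])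
  finally show "d_op (r_del_P 2 S) = last_diff S" .
qed

text \<open>Representatives of the brackets in which the differential is applied to the first entry and, in
  \<open>right_term\<close>, to the second. In index \<open>2\<close> the differential takes values in sections of \<open>sp(V, \<omega>)\<close>.\<close>

definition left_term :: "nat \<Rightarrow> nat \<Rightarrow> 'a tsection \<Rightarrow> 'a tsection \<Rightarrow> 'a tsection" where
  "left_term p q S T = (if p = 2 then bracket_VT 1 (last_diff S) T else bracket_rep (p - 1) q (del S) T)"

definition right_term :: "nat \<Rightarrow> nat \<Rightarrow> 'a tsection \<Rightarrow> 'a tsection \<Rightarrow> 'a tsection" where
  "right_term p q S T = (if q = 2 then - bracket_VT 1 (last_diff T) S else bracket_rep p (q - 1) S (del T))"

text \<open>For \<open>p = 2\<close> the second bracket is zero because \<open>\<partial>PS = \<phi>X\<close>, and \<open>T\<close> may be replaced by \<open>PT\<close> because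
  \<open>sp(V, \<omega>)\<close> preserves the image of \<open>\<phi>\<close>. For \<open>p \<ge> 3\<close> the difference is zero, by \<open>P_del\<close>.\<close>

lemma left_term_mod:
  assumes S: "S \<in> Gamma_T p" and T: "T \<in> Gamma_T q" and p: "p \<ge> 2" and q: "q \<ge> 2"
  shows "left_term p q S T - (bracket_VT (p - 1) (d_op (r_del_P p S)) (P_op \<omega> q T)
     + bracket_TV (p - 1) q (del (P_op \<omega> p S) - phi_sec \<omega> p (r_del_P p S)) (r_del_P q T)) \<in> im_phi \<omega> (p + q - 1)"
proof (cases "p = 2")
  case True
  have S2: "S \<in> Gamma_T 2" using S True by simp
  have kT: "phi_sec \<omega> (q + 1) (r_sec \<omega> q T) \<in> im_phi \<omega> (q + 1)" by (rule phi_r_im_phi[OF T]) (use q in simp)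
  have sp: "last_diff S \<in> Gamma_sp \<omega>" by (rule last_diff_sp[OF S2])
  have "bracket_VT 1 (last_diff S) T - bracket_VT 1 (last_diff S) (P_op \<omega> q T)
      = bracket_VT 1 (last_diff S) (phi_sec \<omega> (q + 1) (r_sec \<omega> q T))"
    using bracket_VT_diff[OF T, of "phi_sec \<omega> (q + 1) (r_sec \<omega> q T)" 1 "last_diff S"] im_phi_Gamma[OF kT]
    by (simp add: P_op_def)
  also have "\<dots> \<in> im_phi \<omega> (q + 1)" by (rule bracket_sp_im_phi[OF sp kT]) (use q in simp)
  finally have "bracket_VT 1 (last_diff S) T - bracket_VT 1 (last_diff S) (P_op \<omega> q T) \<in> im_phi \<omega> (q + 1)" .
  moreover have "bracket_TV 1 q (del (P_op \<omega> 2 S) - phi_sec \<omega> 2 (r_del_P 2 S)) (r_del_P q T) = 0"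
    unfolding del_P_2(1)[OF S2] diff_self by (rule bracket_TV_zero_left)
  ultimately show ?thesis
    unfolding True by (simp add: left_term_def del_P_2(2)[OF S2])
next
  case False
  then have p3: "p \<ge> 3" using p by simp
  have "left_term p q S T = bracket_VT (p - 1) (d_op (r_del_P p S)) (P_op \<omega> q T)
     + bracket_TV (p - 1) q (del (P_op \<omega> p S) - phi_sec \<omega> p (r_del_P p S)) (r_del_P q T)"
    by (simp only: left_term_def False if_False bracket_rep_def P_del[OF S p3])
  then show ?thesis by (simp add: im_phi_zero)
qed

lemma right_term_mod:
  assumes S: "S \<in> Gamma_T p" and T: "T \<in> Gamma_T q" and p: "p \<ge> 2" and q: "q \<ge> 2"
  shows "right_term p q S T - (bracket_VT p (r_del_P p S) (del (P_op \<omega> q T) - phi_sec \<omega> q (r_del_P q T))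
     + bracket_TV p (q - 1) (P_op \<omega> p S) (d_op (r_del_P q T))) \<in> im_phi \<omega> (p + q - 1)"
proof (cases "q = 2")
  case True
  have T2: "T \<in> Gamma_T 2" using T True by simp
  have kS: "phi_sec \<omega> (p + 1) (r_sec \<omega> p S) \<in> im_phi \<omega> (p + 1)" by (rule phi_r_im_phi[OF S]) (use p in simp)
  have sp: "last_diff T \<in> Gamma_sp \<omega>" by (rule last_diff_sp[OF T2])
  have "bracket_VT 1 (last_diff T) (P_op \<omega> p S) - bracket_VT 1 (last_diff T) S
      = - bracket_VT 1 (last_diff T) (phi_sec \<omega> (p + 1) (r_sec \<omega> p S))"
    using bracket_VT_diff[OF S, of "phi_sec \<omega> (p + 1) (r_sec \<omega> p S)" 1 "last_diff T"] im_phi_Gamma[OF kS]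
    by (simp add: P_op_def)
  also have "\<dots> \<in> im_phi \<omega> (p + 1)" by (rule im_phi_minus[OF bracket_sp_im_phi[OF sp kS]]) (use p in simp)
  finally have "bracket_VT 1 (last_diff T) (P_op \<omega> p S) - bracket_VT 1 (last_diff T) S \<in> im_phi \<omega> (p + 1)" .
  moreover have "bracket_VT p (r_del_P p S) (del (P_op \<omega> 2 T) - phi_sec \<omega> 2 (r_del_P 2 T)) = 0"
    unfolding del_P_2(1)[OF T2] diff_self by (rule bracket_VT_zero_right)
  moreover have "bracket_TV p (2 - 1) (P_op \<omega> p S) (last_diff T) = - bracket_VT 1 (last_diff T) (P_op \<omega> p S)"
    using bracket_TV_1[of p "P_op \<omega> p S" "last_diff T"] by simp
  ultimately show ?thesis
    unfolding True by (simp add: right_term_def del_P_2(2)[OF T2])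
next
  case False
  then have q3: "q \<ge> 3" using q by simp
  have "right_term p q S T = bracket_VT p (r_del_P p S) (del (P_op \<omega> q T) - phi_sec \<omega> q (r_del_P q T))
     + bracket_TV p (q - 1) (P_op \<omega> p S) (d_op (r_del_P q T))"
    by (simp only: right_term_def False if_False bracket_rep_def P_del[OF T q3])
  then show ?thesis by (simp add: im_phi_zero)
qed

text \<open>The heart of the matter: the defect of the derivation rule on representatives is \<open>\<phi>[X, Y]\<close>.\<close>

lemma del_bracket_rep:
  assumes S: "S \<in> Gamma_T p" and T: "T \<in> Gamma_T q" and p: "p \<ge> 2" and q: "q \<ge> 2"
  shows "del (bracket_rep p q S T) - (left_term p q S T
    + (\<lambda>x us vs. (-1) ^ (p + 1) * right_term p q S T x us vs)) \<in> im_phi \<omega> (p + q - 1)"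
proof -
  define X Y S' T' where "X = r_del_P p S" and "Y = r_del_P q T" and "S' = P_op \<omega> p S" and "T' = P_op \<omega> q T"
  have X: "X \<in> Gamma_V p" and Y: "Y \<in> Gamma_V q" unfolding X_def Y_def by (rule r_del_P_Gamma S T p q)+
  have S': "S' \<in> Gamma_T p" and T': "T' \<in> Gamma_T q"
    unfolding S'_def T'_def using p q by (auto intro: P_Gamma S T)
  define L R where "L = bracket_VT (p - 1) (d_op X) T' + bracket_TV (p - 1) q (del S' - phi_sec \<omega> p X) Y"
    and "R = bracket_VT p X (del T' - phi_sec \<omega> q Y) + bracket_TV p (q - 1) S' (d_op Y)"
  have VV: "bracket_VV p q X Y \<in> Gamma_V (p + q - 1)" by (rule bracket_VV_Gamma[OF X Y]) (use p q in auto)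
  have phi: "phi_sec \<omega> (p + q - 1) (bracket_VV p q X Y) =
    (\<lambda>x us vs. (-1) ^ (p + 1) * bracket_VT p X (phi_sec \<omega> q Y) x us vs)
    - (\<lambda>x us vs. (-1) ^ (p * (q + 1)) * bracket_VT q Y (phi_sec \<omega> p X) x us vs)"
    by (rule phi_sec_bracket_VV[OF X Y _ q]) (use p in simp)
  have del_scale: "del (\<lambda>x us vs. c * U x us vs) = (\<lambda>x us vs. c * del U x us vs)" for c U
    by (intro ext) (simp add: del_def iota_def sum_distrib_left mult.left_commute)
  have d1: "del (bracket_VT p X T') = bracket_VT (p - 1) (d_op X) T' + (\<lambda>x us vs. (-1) ^ (p + 1) * bracket_VT p X (del T') x us vs)"
    by (rule del_bracket_VT[OF X T' p])
  have d2: "del (bracket_VT q Y S') = bracket_VT (q - 1) (d_op Y) S' + (\<lambda>x us vs. (-1) ^ (q + 1) * bracket_VT q Y (del S') x us vs)"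
    by (rule del_bracket_VT[OF Y S' q])
  have e1: "bracket_VT p X (del T' - phi_sec \<omega> q Y) = bracket_VT p X (del T') - bracket_VT p X (phi_sec \<omega> q Y)"
    by (rule bracket_VT_diff[OF del_Gamma[OF T'] phi_sec_Gamma[OF Y]])
  have e2: "bracket_VT q Y (del S' - phi_sec \<omega> p X) = bracket_VT q Y (del S') - bracket_VT q Y (phi_sec \<omega> p X)"
    by (rule bracket_VT_diff[OF del_Gamma[OF S'] phi_sec_Gamma[OF X]])
  obtain k l where k: "p = Suc k" and l: "q = Suc l" using p q by (cases p; cases q) auto
  \<comment> \<open>After the Leibniz rule for \<open>\<partial>\<close> everything cancels except the terms in \<open>\<phi>X\<close> and \<open>\<phi>Y\<close>.\<close>
  have "del (bracket_rep p q S T) - (L + (\<lambda>x us vs. (-1) ^ (p + 1) * R x us vs)) = phi_sec \<omega> (p + q - 1) (bracket_VV p q X Y)"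
    unfolding bracket_rep_def X_def[symmetric] Y_def[symmetric] S'_def[symmetric] T'_def[symmetric] del_add
      bracket_TV_def del_scale d1 d2 L_def R_def e1 e2 phi
    by (intro ext; cases "even k"; cases "even l") (simp_all add: k l algebra_simps)
  then have main: "del (bracket_rep p q S T) - (L + (\<lambda>x us vs. (-1) ^ (p + 1) * R x us vs)) \<in> im_phi \<omega> (p + q - 1)"
    using VV by (simp add: im_phi_def)
  have l: "left_term p q S T - L \<in> im_phi \<omega> (p + q - 1)"
    using left_term_mod[OF S T p q] unfolding L_def X_def Y_def S'_def T'_def .
  have "right_term p q S T - R \<in> im_phi \<omega> (p + q - 1)"
    using right_term_mod[OF S T p q] unfolding R_def X_def Y_def S'_def T'_def .
  from im_phi_scale[OF this, of "(-1) ^ (p + 1)"]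
  have r: "(\<lambda>x us vs. (-1) ^ (p + 1) * (right_term p q S T - R) x us vs) \<in> im_phi \<omega> (p + q - 1)" .
  have "del (bracket_rep p q S T) - (left_term p q S T + (\<lambda>x us vs. (-1) ^ (p + 1) * right_term p q S T x us vs))
    = (del (bracket_rep p q S T) - (L + (\<lambda>x us vs. (-1) ^ (p + 1) * R x us vs)))
      + (- (left_term p q S T - L) + - (\<lambda>x us vs. (-1) ^ (p + 1) * (right_term p q S T - R) x us vs))"
    by (intro ext) (simp add: right_diff_distrib)
  also have "\<dots> \<in> im_phi \<omega> (p + q - 1)"
    by (intro im_phi_add main im_phi_minus l r)
  finally show ?thesis .
qed

definition single :: "nat \<Rightarrow> 'a tsection \<Rightarrow> nat \<Rightarrow> 'a tsection" where
  "single p S m = (if m = p then S else 0)"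

lemma single_Gamma: "S \<in> Gamma_T p \<Longrightarrow> single p S m \<in> Gamma_T m"
  by (simp add: single_def Gamma_T_zero)

text \<open>The components of positive degree are zero. They are treated as zero classes whose index gives
  the correct sign.\<close>

lemma cx_deg_cases:
  assumes "a \<in> cx_deg \<omega> i"
  obtains (degree_0) A where "A \<in> Gamma_sp \<omega>" "i = 0" "a = cx_of A (\<lambda>_. 0)"
  | (single) p S where "p \<ge> 2" "S \<in> Gamma_T p" "(-1) powi i = ((-1) ^ (p + 1) :: real)" "a = cx_of 0 (single p S)"
proof -
  have z: "zero_class \<omega> p = 0 +o im_phi \<omega> (p + 1)" for p by (simp add: zero_class_def)
  consider "i = 0" | "i < 0" | "i > 0" by linarith
  then show thesis
  proof cases
    case 1
    then obtain A where A: "A \<in> Gamma_sp \<omega>" "a = (A, zero_class \<omega>)" using assms by (auto simp: cx_deg_def)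
    have "a = cx_of A (\<lambda>_. 0)" by (rule eq_cx_ofI) (auto simp: A z)
    then show thesis using degree_0 A 1 by blast
  next
    case 2
    define p where "p = nat (1 - i)"
    have p: "p \<ge> 2" "i = 1 - int p" using 2 by (auto simp: p_def)
    have "\<exists>C. a = (0, (zero_class \<omega>)(p := C)) \<and> C \<in> Gamma_C \<omega> (p + 1)"
      using assms 2 by (auto simp: cx_deg_def p_def)
    then obtain S where S: "S \<in> Gamma_T p" "a = (0, (zero_class \<omega>)(p := S +o im_phi \<omega> (p + 1)))"
      by (auto simp: Gamma_C_def)
    have "a = cx_of 0 (single p S)"
      by (rule eq_cx_ofI) (use p in \<open>auto simp: S z single_def\<close>)
    moreover have "(-1) powi i = ((-1) ^ (p + 1) :: real)"
      unfolding p(2) by (cases "even p") (auto simp: power_int_minus_left)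
    ultimately show thesis using single[OF p(1) S(1)] by blast
  next
    case 3
    define p where "p = nat i + 1"
    have p: "p \<ge> 2" "i = int p - 1" using 3 by (auto simp: p_def)
    have "a = cx_zero \<omega>" using assms 3 by (auto simp: cx_deg_def)
    then have "a = cx_of 0 (single p 0)"
      by (intro eq_cx_ofI) (auto simp: cx_zero_def z single_def)
    moreover have "(-1) powi i = ((-1) ^ (p + 1) :: real)"
      unfolding p(2) by (cases "even p") (auto simp: power_int_minus_left)
    ultimately show thesis using single[OF p(1) Gamma_T_zero] by blast
  qed
qed

text \<open>Write \<open>\<partial>T = \<phi>_2 Z\<close>. Then \<open>\<partial>[A, T] = [A, \<phi>_2 Z] = \<phi>_2 [A, Z]\<close> and \<open>d[A, Z] = [A, dZ]\<close>.\<close>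

lemma last_diff_bracket_sp:
  assumes A: "A \<in> Gamma_sp \<omega>" and T: "T \<in> Gamma_T 2"
  shows "last_diff (bracket_VT 1 A T) = bracket_VV 1 1 A (last_diff T)"
proof -
  have V: "A \<in> Gamma_V 1" using A by (simp add: Gamma_sp_def)
  define Z where "Z = r_sec \<omega> 1 (del T)"
  have Z: "Z \<in> Gamma_V 2" using r_del_Gamma[OF T] by (simp add: Z_def)
  have "del T \<in> Gamma_T 1" using del_Gamma[OF T] by simp
  then have dT: "del T = phi_sec \<omega> 2 Z" using phi_sec_r_sec_1 by (simp add: Z_def)
  have AZ: "bracket_VV 1 2 A Z \<in> Gamma_V 2" using bracket_VV_Gamma[OF V Z] by (simp add: numeral_2_eq_2)
  have "del (bracket_VT 1 A T) = phi_sec \<omega> 2 (bracket_VV 1 2 A Z)"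
    unfolding del_bracket_VT_1[OF V T] dT phi_sec_bracket_sp[OF A Z order_refl] ..
  then have "r_sec \<omega> 1 (del (bracket_VT 1 A T)) = bracket_VV 1 2 A Z"
    using r_phi[OF AZ order_refl] by simp
  then show ?thesis
    unfolding last_diff_def Z_def[symmetric] d_op_bracket_VV[OF V Z, symmetric] by simp
qed

text \<open>The bracket of two homogeneous elements has at most one nonzero component.\<close>

lemma sum_single:
  assumes S: "S \<in> Gamma_T p" and T: "T \<in> Gamma_T q" and p: "p \<ge> 2" and q: "q \<ge> 2"
  shows "(\<Sum>k\<in>{2..<m}. bracket_rep k (m + 1 - k) (single p S k) (single q T (m + 1 - k))) =
    (if m + 1 = p + q then bracket_rep p q S T else 0)"
proof -
  have "bracket_rep k (m + 1 - k) (single p S k) (single q T (m + 1 - k)) =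
      (if k = p then if m + 1 = p + q then bracket_rep p q S T else 0 else 0)" if k: "k \<in> {2..<m}" for k
  proof (cases "k = p")
    case True
    show ?thesis
    proof (cases "m + 1 = p + q")
      case eq: True
      then have "m + 1 - p = q" by simp
      then show ?thesis using True eq by (simp add: single_def)
    next
      case False
      then have "single q T (m + 1 - k) = 0" using True k by (auto simp: single_def)
      then show ?thesis using True False bracket_rep_zero_right[OF S p] by (simp add: single_def)
    qed
  next
    case False
    have "single q T (m + 1 - k) \<in> Gamma_T (m + 1 - k)" by (rule single_Gamma[OF T])
    then have "bracket_rep k (m + 1 - k) 0 (single q T (m + 1 - k)) = 0" by (rule bracket_rep_zero_left) (use k in auto)
    then show ?thesis using False by (simp add: single_def[of p])
  qed
  then have "(\<Sum>k\<in>{2..<m}. bracket_rep k (m + 1 - k) (single p S k) (single q T (m + 1 - k))) =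
      (\<Sum>k\<in>{2..<m}. if k = p then if m + 1 = p + q then bracket_rep p q S T else 0 else 0)"
    by (rule sum.cong[OF refl])
  also have "\<dots> = (if p \<in> {2..<m} then if m + 1 = p + q then bracket_rep p q S T else 0 else 0)"
    by (simp add: sum.delta)
  also have "\<dots> = (if m + 1 = p + q then bracket_rep p q S T else 0)" using p q by auto
  finally show ?thesis .
qed

lemma cx_bracket_rep_sp_left:
  assumes "\<And>p. p \<ge> 2 \<Longrightarrow> \<zeta> p \<in> Gamma_T p" "m \<ge> 2"
  shows "cx_bracket_rep A (\<lambda>_. 0) B \<zeta> m = bracket_VT 1 A (\<zeta> m)"
proof -
  have "(\<Sum>p\<in>{2..<m}. bracket_rep p (m + 1 - p) 0 (\<zeta> (m + 1 - p))) = 0"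
    by (rule sum.neutral) (auto intro!: bracket_rep_zero_left assms)
  then show ?thesis by (simp add: cx_bracket_rep_def bracket_VT_zero_right)
qed

lemma cx_bracket_rep_sp_right:
  assumes "\<And>p. p \<ge> 2 \<Longrightarrow> \<eta> p \<in> Gamma_T p" "m \<ge> 2"
  shows "cx_bracket_rep A \<eta> B (\<lambda>_. 0) m = - bracket_VT 1 B (\<eta> m)"
proof -
  have "(\<Sum>p\<in>{2..<m}. bracket_rep p (m + 1 - p) (\<eta> p) 0) = 0"
    by (rule sum.neutral) (auto intro!: bracket_rep_zero_right assms)
  then show ?thesis by (simp add: cx_bracket_rep_def bracket_VT_zero_right)
qed

lemma bracket_VV_Gamma_sp_zero:
  assumes "A \<in> Gamma_sp \<omega>"
  shows "bracket_VV 1 1 A 0 = 0" "bracket_VV 1 1 0 A = 0"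
  using assms bracket_VV_zero_right[of A 1 1] bracket_VV_zero_left[of A 1 1] by (auto simp: Gamma_sp_def)

lemma zero_sp: "0 \<in> Gamma_sp \<omega>"
  by (simp add: Gamma_sp_iff Gamma_V_zero phi_sec_zero)

text \<open>On homogeneous representatives, if an entry is a section of
  \<open>sp(V, \<omega>)\<close>, then the two sides have equal representatives; otherwise they agree modulo the image of \<open>\<phi>\<close>,
  by \<open>del_bracket_rep\<close>.\<close>

lemma cx_diff_derivation:
  assumes "a \<in> cx_deg \<omega> i" "b \<in> cx_deg \<omega> j"
  shows "cx_diff \<omega> (cx_bracket \<omega> a b) =
    cx_bracket \<omega> (cx_diff \<omega> a) b + cx_scale \<omega> ((-1) powi i) (cx_bracket \<omega> a (cx_diff \<omega> b))"
proof -
  have zero_V: "(0::'a vsection) + (\<lambda>x us. c *\<^sub>R (0::'a vsection) x us) = 0" for c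
    by (intro ext) simp
  have zero_im_phi: "(0::'a tsection) - (0 + (\<lambda>x us vs. c * (0::'a tsection) x us vs)) \<in> im_phi \<omega> k" for c k
  proof -
    have "(0::'a tsection) - (0 + (\<lambda>x us vs. c * (0::'a tsection) x us vs)) = 0" by (intro ext) simp
    then show ?thesis using im_phi_zero by metis
  qed
  \<comment> \<open>The rule on representatives: an equation in degree \<open>0\<close> and a congruence in every index.\<close>
  have rule: "cx_diff \<omega> (cx_bracket \<omega> (cx_of A \<eta>) (cx_of B \<zeta>)) = cx_bracket \<omega> (cx_diff \<omega> (cx_of A \<eta>)) (cx_of B \<zeta>)
      + cx_scale \<omega> s (cx_bracket \<omega> (cx_of A \<eta>) (cx_diff \<omega> (cx_of B \<zeta>)))"
    if A: "A \<in> Gamma_sp \<omega>" and B: "B \<in> Gamma_sp \<omega>"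
      and \<eta>: "\<And>p. \<eta> p \<in> Gamma_T p" and \<zeta>: "\<And>p. \<zeta> p \<in> Gamma_T p"
      and deg_0: "last_diff (cx_bracket_rep A \<eta> B \<zeta> 2) =
        bracket_VV 1 1 (last_diff (\<eta> 2)) B + (\<lambda>x us. s *\<^sub>R bracket_VV 1 1 A (last_diff (\<zeta> 2)) x us)"
      and deg_m: "\<And>m. m \<ge> 2 \<Longrightarrow> del (cx_bracket_rep A \<eta> B \<zeta> (m + 1)) -
        (cx_bracket_rep (last_diff (\<eta> 2)) (\<lambda>p. del (\<eta> (p + 1))) B \<zeta> m
         + (\<lambda>x us vs. s * cx_bracket_rep A \<eta> (last_diff (\<zeta> 2)) (\<lambda>p. del (\<zeta> (p + 1))) m x us vs)) \<in> im_phi \<omega> (m + 1)"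
    for A B \<eta> \<zeta> s
  proof -
    have d\<eta>: "del (\<eta> (p + 1)) \<in> Gamma_T p" and d\<zeta>: "del (\<zeta> (p + 1)) \<in> Gamma_T p" for p
      using del_Gamma[OF \<eta>, of "p + 1"] del_Gamma[OF \<zeta>, of "p + 1"] by simp_all
    have DA: "last_diff (\<eta> 2) \<in> Gamma_sp \<omega>" and DB: "last_diff (\<zeta> 2) \<in> Gamma_sp \<omega>" by (rule last_diff_sp \<eta> \<zeta>)+
    have "cx_diff \<omega> (cx_bracket \<omega> (cx_of A \<eta>) (cx_of B \<zeta>)) =
        cx_of (last_diff (cx_bracket_rep A \<eta> B \<zeta> 2)) (\<lambda>m. del (cx_bracket_rep A \<eta> B \<zeta> (m + 1)))"
      unfolding cx_bracket_cx_of[OF A B \<eta> \<zeta>] by (rule cx_diff_cx_of[OF cx_bracket_rep_Gamma[OF A B \<eta> \<zeta>]])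
    also have "\<dots> = cx_of (bracket_VV 1 1 (last_diff (\<eta> 2)) B + (\<lambda>x us. s *\<^sub>R bracket_VV 1 1 A (last_diff (\<zeta> 2)) x us))
        (\<lambda>m. cx_bracket_rep (last_diff (\<eta> 2)) (\<lambda>p. del (\<eta> (p + 1))) B \<zeta> m
         + (\<lambda>x us vs. s * cx_bracket_rep A \<eta> (last_diff (\<zeta> 2)) (\<lambda>p. del (\<zeta> (p + 1))) m x us vs))"
      by (rule cx_of_eqI[OF deg_0 deg_m])
    also have "\<dots> = cx_bracket \<omega> (cx_diff \<omega> (cx_of A \<eta>)) (cx_of B \<zeta>)
      + cx_scale \<omega> s (cx_bracket \<omega> (cx_of A \<eta>) (cx_diff \<omega> (cx_of B \<zeta>)))"
      unfolding cx_diff_cx_of[OF \<eta>] cx_diff_cx_of[OF \<zeta>] cx_bracket_cx_of[OF DA B d\<eta> \<zeta>]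
        cx_bracket_cx_of[OF A DB \<eta> d\<zeta>] cx_scale_cx_of cx_of_add ..
    finally show ?thesis .
  qed
  show ?thesis
    using assms(1)
  proof (cases rule: cx_deg_cases)
    case A: (degree_0 A)
    show ?thesis
      using assms(2)
    proof (cases rule: cx_deg_cases)
      case B: (degree_0 B)
      show ?thesis
        unfolding A B
      proof (rule rule[OF A(1) B(1) Gamma_T_zero Gamma_T_zero])
        show "last_diff (cx_bracket_rep A (\<lambda>_. 0) B (\<lambda>_. 0) 2) = bracket_VV 1 1 (last_diff 0) B + (\<lambda>x us. (-1) powi 0 *\<^sub>R bracket_VV 1 1 A (last_diff 0) x us)"
          unfolding cx_bracket_rep_sp_left[where \<zeta>="\<lambda>_. 0", OF Gamma_T_zero order_refl] bracket_VT_zero_right last_diff_zero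
            bracket_VV_Gamma_sp_zero(1)[OF A(1)] bracket_VV_Gamma_sp_zero(2)[OF B(1)] zero_V ..
      next
        fix m :: nat assume m: "m \<ge> 2"
        have m1: "m + 1 \<ge> 2" using m by simp
        show "del (cx_bracket_rep A (\<lambda>_. 0) B (\<lambda>_. 0) (m + 1)) - (cx_bracket_rep (last_diff 0) (\<lambda>p. del 0) B (\<lambda>_. 0) m
            + (\<lambda>x us vs. (-1) powi 0 * cx_bracket_rep A (\<lambda>_. 0) (last_diff 0) (\<lambda>p. del 0) m x us vs)) \<in> im_phi \<omega> (m + 1)"
          unfolding del_zero cx_bracket_rep_sp_left[where \<zeta>="\<lambda>_. 0", OF Gamma_T_zero m]
            cx_bracket_rep_sp_left[where \<zeta>="\<lambda>_. 0", OF Gamma_T_zero m1] bracket_VT_zero_right del_zero by (rule zero_im_phi)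
      qed
    next
      case T: (single q T)
      note sT = single_Gamma[OF T(2)]
      have V: "A \<in> Gamma_V 1" using A(1) by (simp add: Gamma_sp_def)
      have dT: "del (single q T (p + 1)) \<in> Gamma_T p" for p
        using del_Gamma[OF sT, of "p + 1"] by simp
      show ?thesis
        unfolding A T(4)
      proof (rule rule[OF A(1) zero_sp Gamma_T_zero sT])
        have z: "bracket_VV 1 1 (last_diff 0) 0 = 0" unfolding last_diff_zero by (rule bracket_VV_Gamma_sp_zero(1)[OF zero_sp])
        show "last_diff (cx_bracket_rep A (\<lambda>_. 0) 0 (single q T) 2) =
            bracket_VV 1 1 (last_diff 0) 0 + (\<lambda>x us. (-1) powi 0 *\<^sub>R bracket_VV 1 1 A (last_diff (single q T 2)) x us)"
          unfolding cx_bracket_rep_sp_left[where \<zeta>="single q T", OF sT order_refl] last_diff_bracket_sp[OF A(1) sT] z by simp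
      next
        fix m :: nat assume m: "m \<ge> 2"
        have m1: "m + 1 \<ge> 2" using m by simp
        show "del (cx_bracket_rep A (\<lambda>_. 0) 0 (single q T) (m + 1)) - (cx_bracket_rep (last_diff 0) (\<lambda>p. del 0) 0 (single q T) m
            + (\<lambda>x us vs. (-1) powi 0 * cx_bracket_rep A (\<lambda>_. 0) (last_diff (single q T 2)) (\<lambda>p. del (single q T (p + 1))) m x us vs)) \<in> im_phi \<omega> (m + 1)"
          unfolding last_diff_zero del_zero cx_bracket_rep_sp_left[where \<zeta>="single q T", OF sT m] cx_bracket_rep_sp_left[where \<zeta>="single q T", OF sT m1]
            cx_bracket_rep_sp_left[where \<zeta>="\<lambda>p. del (single q T (p + 1))", OF dT m]
            bracket_VT_zero_left[OF sT] del_bracket_VT_1[OF V sT]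
          by (simp add: im_phi_zero)
      qed
    qed
  next
    case S: (single p S)
    note sS = single_Gamma[OF S(2)]
    have dS: "del (single p S (k + 1)) \<in> Gamma_T k" for k
      using del_Gamma[OF sS, of "k + 1"] by simp
    show ?thesis
      using assms(2)
    proof (cases rule: cx_deg_cases)
      case B: (degree_0 B)
      have V: "B \<in> Gamma_V 1" using B(1) by (simp add: Gamma_sp_def)
      show ?thesis
        unfolding S(4) B(3)
      proof (rule rule[OF zero_sp B(1) sS Gamma_T_zero])
        have "last_diff (- bracket_VT 1 B (single p S 2)) = bracket_VV 1 1 (last_diff (single p S 2)) B"
        proof -
          have neg: "last_diff (- U) = - last_diff U" for U
            unfolding last_diff_def using del_diff[of 0 U] r_sec_diff[of 1 0 "del U"] d_op_diff[of 0 "r_sec \<omega> 1 (del U)"]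
              r_sec_diff[of 1 0 0] by (simp only: diff_0 diff_self del_zero d_op_zero)
          show ?thesis unfolding neg last_diff_bracket_sp[OF B(1) sS] by (rule bracket_VV_anti[symmetric])
        qed
        moreover have "bracket_VV 1 1 0 (last_diff 0) = 0" unfolding last_diff_zero by (rule bracket_VV_Gamma_sp_zero(1)[OF zero_sp])
        ultimately show "last_diff (cx_bracket_rep 0 (single p S) B (\<lambda>_. 0) 2) =
            bracket_VV 1 1 (last_diff (single p S 2)) B + (\<lambda>x us. (-1) powi i *\<^sub>R bracket_VV 1 1 0 (last_diff 0) x us)"
          unfolding cx_bracket_rep_sp_right[where \<eta>="single p S", OF sS order_refl] by (simp add: fun_eq_iff)
      next
        fix m :: nat assume m: "m \<ge> 2"
        have m1: "m + 1 \<ge> 2" using m by simp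
        have neg: "del (- U) = - del U" for U using del_diff[of 0 U] by (simp only: diff_0 del_zero)
        show "del (cx_bracket_rep 0 (single p S) B (\<lambda>_. 0) (m + 1)) - (cx_bracket_rep (last_diff (single p S 2)) (\<lambda>k. del (single p S (k + 1))) B (\<lambda>_. 0) m
            + (\<lambda>x us vs. (-1) powi i * cx_bracket_rep 0 (single p S) (last_diff 0) (\<lambda>p. del 0) m x us vs)) \<in> im_phi \<omega> (m + 1)"
          unfolding last_diff_zero del_zero cx_bracket_rep_sp_right[where \<eta>="single p S", OF sS m] cx_bracket_rep_sp_right[where \<eta>="single p S", OF sS m1]
            cx_bracket_rep_sp_right[where \<eta>="\<lambda>k. del (single p S (k + 1))", OF dS m]
            bracket_VT_zero_left[OF sS] neg del_bracket_VT_1[OF V sS]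
          by (simp add: im_phi_zero flip: zero_fun_def)
      qed
    next
      case T: (single q T)
      note sT = single_Gamma[OF T(2)]
      have dT: "del (single q T (k + 1)) \<in> Gamma_T k" for k
        using del_Gamma[OF sT, of "k + 1"] by simp
      have b: "cx_bracket_rep 0 (single p S) 0 (single q T) m = (if m + 1 = p + q then bracket_rep p q S T else 0)" for m
        unfolding cx_bracket_rep_def sum_single[OF S(2) T(2) S(1) T(1)] bracket_VT_zero_left[OF sS] bracket_VT_zero_left[OF sT] by simp
      \<comment> \<open>For \<open>p = 2\<close> the differential of \<open>S\<close> is a section of \<open>sp(V, \<omega>)\<close>, and all products of forms vanish.\<close>
      have b_left: "cx_bracket_rep (last_diff (single p S 2)) (\<lambda>k. del (single p S (k + 1))) 0 (single q T) m =
          (if m + 2 = p + q then left_term p q S T else 0)" if m: "m \<ge> 2" for m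
      proof (cases "p = 2")
        case True
        have "bracket_rep k (m + 1 - k) (del (single p S (k + 1))) (single q T (m + 1 - k)) = 0" if "k \<in> {2..<m}" for k
        proof -
          have "del (single p S (k + 1)) = 0" using that True by (simp add: single_def del_zero)
          moreover have "m + 1 - k \<ge> 2" using that by auto
          ultimately show ?thesis using bracket_rep_zero_left[OF sT] by (simp only:)
        qed
        then have "(\<Sum>k\<in>{2..<m}. bracket_rep k (m + 1 - k) (del (single p S (k + 1))) (single q T (m + 1 - k))) = 0"
          by (rule sum.neutral[OF ballI])
        then have "cx_bracket_rep (last_diff (single p S 2)) (\<lambda>k. del (single p S (k + 1))) 0 (single q T) m
            = bracket_VT 1 (last_diff S) (single q T m)"
          unfolding cx_bracket_rep_def bracket_VT_zero_left[OF dS] using True by (simp only: single_def if_True) simp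
        also have "\<dots> = (if m = q then bracket_VT 1 (last_diff S) T else 0)"
          by (simp add: single_def bracket_VT_zero_right)
        finally show ?thesis using True by (simp add: left_term_def)
      next
        case False
        then have p3: "p \<ge> 3" using S(1) by simp
        have "single p S (k + 1) = 0" if "k \<noteq> p - 1" for k using that by (auto simp: single_def)
        then have e: "del (single p S (k + 1)) = single (p - 1) (del S) k" for k
          using p3 by (cases "k = p - 1") (auto simp: single_def del_zero)
        have "single p S 2 = 0" using False by (simp add: single_def)
        moreover have "m + 1 = p - 1 + q \<longleftrightarrow> m + 2 = p + q" using p3 by auto
        moreover have "p - 1 \<ge> 2" using p3 by simp
        ultimately show ?thesis
          unfolding cx_bracket_rep_def bracket_VT_zero_left[OF dS]
          using sum_single[OF del_Gamma[OF S(2)] T(2) _ T(1), of m] False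
          by (simp only: e last_diff_zero bracket_VT_zero_left[OF sT] left_term_def if_False) simp
      qed
      have b_right: "cx_bracket_rep 0 (single p S) (last_diff (single q T 2)) (\<lambda>k. del (single q T (k + 1))) m =
          (if m + 2 = p + q then right_term p q S T else 0)" if m: "m \<ge> 2" for m
      proof (cases "q = 2")
        case True
        have "bracket_rep k (m + 1 - k) (single p S k) (del (single q T (m + 1 - k + 1))) = 0" if "k \<in> {2..<m}" for k
        proof -
          have "del (single q T (m + 1 - k + 1)) = 0" using that True by (auto simp: single_def del_zero)
          moreover have "k \<ge> 2" using that by auto
          ultimately show ?thesis using bracket_rep_zero_right[OF sS] by (simp only:)
        qed
        then have "(\<Sum>k\<in>{2..<m}. bracket_rep k (m + 1 - k) (single p S k) (del (single q T (m + 1 - k + 1)))) = 0"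
          by (rule sum.neutral[OF ballI])
        then have "cx_bracket_rep 0 (single p S) (last_diff (single q T 2)) (\<lambda>k. del (single q T (k + 1))) m
            = - bracket_VT 1 (last_diff T) (single p S m)"
          unfolding cx_bracket_rep_def bracket_VT_zero_left[OF dT] using True by (simp only: single_def if_True) simp
        also have "\<dots> = (if m = p then - bracket_VT 1 (last_diff T) S else 0)"
          by (simp add: single_def bracket_VT_zero_right)
        finally show ?thesis using True by (simp add: right_term_def)
      next
        case False
        then have q3: "q \<ge> 3" using T(1) by simp
        have "single q T (k + 1) = 0" if "k \<noteq> q - 1" for k using that by (auto simp: single_def)
        then have e: "del (single q T (k + 1)) = single (q - 1) (del T) k" for k
          using q3 by (cases "k = q - 1") (auto simp: single_def del_zero)
        have "single q T 2 = 0" using False by (simp add: single_def)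
        moreover have "m + 1 = p + (q - 1) \<longleftrightarrow> m + 2 = p + q" using q3 by auto
        moreover have "q - 1 \<ge> 2" using q3 by simp
        ultimately show ?thesis
          unfolding cx_bracket_rep_def bracket_VT_zero_left[OF dT]
          using sum_single[OF S(2) del_Gamma[OF T(2)] S(1), of m] False
          by (simp only: e last_diff_zero bracket_VT_zero_left[OF sS] right_term_def if_False) simp
      qed
      show ?thesis
        unfolding S(3,4) T(4)
      proof (rule rule[OF zero_sp zero_sp sS sT])
        have "last_diff (single p S 2) \<in> Gamma_sp \<omega>" "last_diff (single q T 2) \<in> Gamma_sp \<omega>" by (rule last_diff_sp sS sT)+
        then have "bracket_VV 1 1 (last_diff (single p S 2)) 0 = 0" "bracket_VV 1 1 0 (last_diff (single q T 2)) = 0"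
          using bracket_VV_Gamma_sp_zero by auto
        moreover have "cx_bracket_rep 0 (single p S) 0 (single q T) 2 = 0" unfolding b using S(1) T(1) by simp
        ultimately show "last_diff (cx_bracket_rep 0 (single p S) 0 (single q T) 2) = bracket_VV 1 1 (last_diff (single p S 2)) 0
            + (\<lambda>x us. (-1) ^ (p + 1) *\<^sub>R bracket_VV 1 1 0 (last_diff (single q T 2)) x us)"
          by (simp only: last_diff_zero zero_V)
      next
        fix m :: nat assume m: "m \<ge> 2"
        show "del (cx_bracket_rep 0 (single p S) 0 (single q T) (m + 1)) -
            (cx_bracket_rep (last_diff (single p S 2)) (\<lambda>k. del (single p S (k + 1))) 0 (single q T) m
             + (\<lambda>x us vs. (-1) ^ (p + 1) * cx_bracket_rep 0 (single p S) (last_diff (single q T 2)) (\<lambda>k. del (single q T (k + 1))) m x us vs))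
            \<in> im_phi \<omega> (m + 1)"
        proof (cases "m + 2 = p + q")
          case True
          then have "m + 1 + 1 = p + q" "p + q - 1 = m + 1" by auto
          then show ?thesis
            unfolding b b_left[OF m] b_right[OF m] using True del_bracket_rep[OF S(2) T(2) S(1) T(1)] by (simp only: refl if_True)
        next
          case False
          then have "m + 1 + 1 \<noteq> p + q" by auto
          then show ?thesis
            unfolding b b_left[OF m] b_right[OF m] using False by (simp only: if_False del_zero zero_im_phi)
        qed
      qed
    qed
  qed
qed

end

theorem proposition2p15:
  fixes \<omega> :: "'a::euclidean_space \<Rightarrow> 'a \<Rightarrow> real"
    and i j :: int
    and a b :: "'a cx"
  assumes "even DIM('a)" and "DIM('a) \<ge> 2"
    and "symplectic \<omega>"
    and "a \<in> cx_deg \<omega> i" and "b \<in> cx_deg \<omega> j"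
  shows "cx_diff \<omega> (cx_bracket \<omega> a b) =
    cx_bracket \<omega> (cx_diff \<omega> a) b
    + cx_scale \<omega> ((-1) powi i) (cx_bracket \<omega> a (cx_diff \<omega> b))"
proof -
  interpret symplectic_space \<omega> by standard (rule assms(3))
  show ?thesis by (rule cx_diff_derivation[OF assms(4,5)])
qed

end
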